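(* The linear subspace $$\mathfrak{e}_6 := (\mathfrak{so}(8)\times\mathfrak{t}^2)\times(\mathbb{O}\otimes\mathbb{C})^3$$ of $\mathfrak{e}_8 = (\mathfrak{so}(8)\oplus\mathfrak{so}(8)) \times (\mathbb{O}\otimes\mathbb{O})^3$ is a Lie subalgebra of $\mathfrak{e}_8$ isomorphic to the Lie algebra of the compact exceptional simple Lie group of type $\mathrm{E}_6$.
   Context: Octonions: $\mathbb{O}$ is the 8-dimensional real octonion algebra with basis $e=e_0$ (the identity), $e_1,\dots,e_7$, where $e_i^2=-e$ for $i\ge1$ and $e_1e_2=e_3$, $e_1e_4=e_5$, $e_2e_4=e_6$, $e_3e_4=e_7$, $e_5e_3=e_6$, $e_6e_1=e_7$, $e_7e_2=e_5$ (the remaining products are determined by the alternative laws). Via this basis $\mathbb{O}=\mathbb{R}^8$ (column vectors), with standard scalar product $\langle\cdot,\cdot\rangle$. Conjugation $a\mapsto\bar a$ is linear with $\bar e_0=e_0$, $\bar e_i=-e_i$ for $i\ge1$. $\mathrm{Pu}(\mathbb{O})$ is the span of $e_1,\dots,e_7$. $L_a(x)=ax$, $R_a(x)=xa$. Wedge and triality: $\mathfrak{so}(8)$ is the Lie algebra of real skew-symmetric $8\times8$ matrices with commutator bracket; for $x,y\in\mathbb{O}=\mathbb{R}^8$, $x\wedge y:=xy^t-yx^t\in\mathfrak{so}(8)$ (matrix products). $\lambda$ is the order-three automorphism of $\mathfrak{so}(8)$ determined by $\lambda(a\wedge b)=\tfrac12 L_{\bar b}\circ L_{\bar a}$ for $a\in\mathrm{Pu}(\mathbb{O})$,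 $b\in\mathbb{O}$, $\langle a,b\rangle=0$. $\Lambda$ is the automorphism of $\mathfrak{so}(8)\oplus\mathfrak{so}(8)$ given by $\Lambda(P,Q)=(\lambda(P),\lambda(Q))$, and $\Lambda^2=\Lambda\circ\Lambda$. Oct-octonions: $\mathbb{O}\otimes\mathbb{O}$ (tensor product over $\mathbb{R}$) has multiplication $(a\otimes b)\ast(c\otimes d)=ac\otimes bd$ and linear conjugation $\overline{a\otimes b}=\bar a\otimes\bar b$. It is identified with the space $\mathbb{R}(8)$ of real $8\times8$ matrices via $x\otimes y=xy^t$. For $A=(P,Q)\in\mathfrak{so}(8)\oplus\mathfrak{so}(8)$ and $X,Y\in\mathbb{R}(8)$: $A.X:=PX-XQ$ and $X\curlywedge Y:=(XY^t-YX^t,\;X^tY-Y^tX)$ (ordinary matrix products). The Lie algebra $\mathfrak{e}_8$ (compact real form) is the vector space $(\mathfrak{so}(8)\oplus\mathfrak{so}(8))\times(\mathbb{O}\otimes\mathbb{O})^3$ with Lie bracket $[(A,u,v,w),(B,x,y,z)]=(C,r,s,t)$, where \begin{align*} C &=[A,B]-4\,u \curlywedge x - 4\Lambda^2(v \curlywedge y) - 4\Lambda(w \curlywedge z),\\ r &= A.x-B.u+\overline{v \ast z}-\overline{y \ast w},\\ s &= \Lambda(A).y-\Lambda(B).v+\overline{w \ast x}-\overline{z \ast u},\\ t &= \Lambda^2(A).z-\Lambda^2(B).w+\overline{u \ast y}-\overline{x \ast v}. \end{align*} $\mathfrak{t}^2\subset\mathfrak{so}(8)$ is the abelian subalgebra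 spanned by $L_{e_1}$ and $R_{e_1}$, and $\mathbb{C}\subset\mathbb{O}$ is the linear span of $e_0$ and $e_1$; $\mathbb{O}\otimes\mathbb{C}\subset\mathbb{O}\otimes\mathbb{O}$ and $\mathfrak{so}(8)\times\mathfrak{t}^2\subset\mathfrak{so}(8)\oplus\mathfrak{so}(8)$ (with $\mathfrak{t}^2$ in the second summand). *)

theory Defs
  imports "HOL-Analysis.Analysis"
begin

section \<open>Octonions\<close>

text \<open>The index type \<open>8\<close> has the elements \<open>0, \<dots>, 7\<close> (with \<open>8 = 0\<close>), so that
  \<open>oct_unit i\<close> is the basis vector \<open>e\<^sub>i\<close> and \<open>oct_unit 0\<close> is the identity \<open>e\<close>.\<close>

type_synonym octonion = "real ^ 8"
type_synonym mat8 = "real ^ 8 ^ 8"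

definition oct_unit :: "8 \<Rightarrow> octonion" where
  "oct_unit i = axis i 1"

text \<open>\<open>oct_cycle i j k\<close> says that \<open>e\<^sub>i e\<^sub>j = e\<^sub>k\<close> is one of the seven defining relations up to a
  cyclic permutation of \<open>i, j, k\<close>. In the alternative algebra each relation \<open>e\<^sub>i e\<^sub>j = e\<^sub>k\<close> forces
  \<open>e\<^sub>j e\<^sub>k = e\<^sub>i\<close>, \<open>e\<^sub>k e\<^sub>i = e\<^sub>j\<close> and \<open>e\<^sub>j e\<^sub>i = - e\<^sub>k\<close>.\<close>

definition oct_triples :: "(8 \<times> 8 \<times> 8) set" where
  "oct_triples = {(1,2,3), (1,4,5), (2,4,6), (3,4,7), (5,3,6), (6,1,7), (7,2,5)}"

definition oct_cycle :: "8 \<Rightarrow> 8 \<Rightarrow> 8 \<Rightarrow> bool" where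
  "oct_cycle i j k \<longleftrightarrow>
     (i,j,k) \<in> oct_triples \<or> (j,k,i) \<in> oct_triples \<or> (k,i,j) \<in> oct_triples"

text \<open>The coefficient of \<open>e\<^sub>k\<close> in \<open>e\<^sub>i e\<^sub>j\<close>.\<close>

definition oct_coeff :: "8 \<Rightarrow> 8 \<Rightarrow> 8 \<Rightarrow> real" where
  "oct_coeff i j k =
     (if i = 0 then (if j = k then 1 else 0)
      else if j = 0 then (if i = k then 1 else 0)
      else if i = j then (if k = 0 then -1 else 0)
      else if oct_cycle i j k then 1
      else if oct_cycle j i k then -1
      else 0)"

definition oct_mult :: "octonion \<Rightarrow> octonion \<Rightarrow> octonion" where
  "oct_mult x y = (\<chi> k. \<Sum>i\<in>UNIV. \<Sum>j\<in>UNIV. oct_coeff i j k * x $ i * y $ j)"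

definition oct_cnj :: "octonion \<Rightarrow> octonion" where
  "oct_cnj x = (\<chi> i. if i = 0 then x $ i else - x $ i)"

definition oct_pure :: "octonion set" where
  "oct_pure = span {oct_unit i |i. i \<noteq> 0}"

definition oct_left :: "octonion \<Rightarrow> mat8" where
  "oct_left a = matrix (\<lambda>x. oct_mult a x)"

definition oct_right :: "octonion \<Rightarrow> mat8" where
  "oct_right a = matrix (\<lambda>x. oct_mult x a)"


section \<open>Lie algebras given by a carrier and a bracket\<close>

definition mat_bracket :: "real ^ 'n ^ 'n \<Rightarrow> real ^ 'n ^ 'n \<Rightarrow> real ^ 'n ^ 'n" where
  "mat_bracket A B = A ** B - B ** A"

definition lie_subalgebra ::
  "'a::real_vector set \<Rightarrow> 'a set \<Rightarrow> ('a \<Rightarrow> 'a \<Rightarrow> 'a) \<Rightarrow> bool" where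
  "lie_subalgebra S L br \<longleftrightarrow> subspace S \<and> S \<subseteq> L \<and> (\<forall>X\<in>S. \<forall>Y\<in>S. br X Y \<in> S)"

definition lie_iso ::
  "('a::real_vector \<Rightarrow> 'b::real_vector) \<Rightarrow> 'a set \<Rightarrow> ('a \<Rightarrow> 'a \<Rightarrow> 'a)
     \<Rightarrow> 'b set \<Rightarrow> ('b \<Rightarrow> 'b \<Rightarrow> 'b) \<Rightarrow> bool" where
  "lie_iso f L br L' br' \<longleftrightarrow>
     bij_betw f L L' \<and>
     (\<forall>X\<in>L. \<forall>Y\<in>L. f (X + Y) = f X + f Y) \<and>
     (\<forall>c. \<forall>X\<in>L. f (c *\<^sub>R X) = c *\<^sub>R f X) \<and>
     (\<forall>X\<in>L. \<forall>Y\<in>L. f (br X Y) = br' (f X) (f Y))"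

definition lie_isomorphic ::
  "'a::real_vector set \<Rightarrow> ('a \<Rightarrow> 'a \<Rightarrow> 'a)
     \<Rightarrow> 'b::real_vector set \<Rightarrow> ('b \<Rightarrow> 'b \<Rightarrow> 'b) \<Rightarrow> bool" where
  "lie_isomorphic L br L' br' \<longleftrightarrow> (\<exists>f. lie_iso f L br L' br')"

definition lie_ideal ::
  "'a::real_vector set \<Rightarrow> 'a set \<Rightarrow> ('a \<Rightarrow> 'a \<Rightarrow> 'a) \<Rightarrow> bool" where
  "lie_ideal I L br \<longleftrightarrow> subspace I \<and> I \<subseteq> L \<and> (\<forall>X\<in>L. \<forall>Y\<in>I. br X Y \<in> I)"

definition lie_simple :: "'a::real_vector set \<Rightarrow> ('a \<Rightarrow> 'a \<Rightarrow> 'a) \<Rightarrow> bool" where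
  "lie_simple L br \<longleftrightarrow>
     (\<exists>X\<in>L. \<exists>Y\<in>L. br X Y \<noteq> 0) \<and> (\<forall>I. lie_ideal I L br \<longrightarrow> I = {0} \<or> I = L)"


section \<open>Triality and the Lie algebra \<open>\<ee>\<^sub>8\<close>\<close>

definition so8 :: "mat8 set" where
  "so8 = {A. transpose A = - A}"

text \<open>\<open>x y\<^sup>t\<close>, which is also \<open>x \<otimes> y\<close> under the identification of
  the tensor square of the octonions with the \<open>8 \<times> 8\<close> matrices.\<close>

definition oct_tensor :: "octonion \<Rightarrow> octonion \<Rightarrow> mat8" where
  "oct_tensor x y = (\<chi> i j. x $ i * y $ j)"

definition oct_wedge :: "octonion \<Rightarrow> octonion \<Rightarrow> mat8" where
  "oct_wedge x y = oct_tensor x y - oct_tensor y x"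

text \<open>The last clause only fixes the irrelevant values outside \<open>so8\<close>, so that the function
  described is unique.\<close>

definition triality :: "mat8 \<Rightarrow> mat8" where
  "triality = (THE f.
     lie_iso f so8 mat_bracket so8 mat_bracket \<and>
     (\<forall>A\<in>so8. f (f (f A)) = A) \<and> (\<exists>A\<in>so8. f A \<noteq> A) \<and>
     (\<forall>a\<in>oct_pure. \<forall>b. a \<bullet> b = 0 \<longrightarrow>
        f (oct_wedge a b) = (1/2) *\<^sub>R (oct_left (oct_cnj b) ** oct_left (oct_cnj a))) \<and>
     (\<forall>A. A \<notin> so8 \<longrightarrow> f A = 0))"

definition triality2 :: "mat8 \<times> mat8 \<Rightarrow> mat8 \<times> mat8" where
  "triality2 A = (triality (fst A), triality (snd A))"

text \<open>The (bi)linear extensions of \<open>(a \<otimes> b) \<star> (c \<otimes> d) = ac \<otimes> bd\<close> and of the conjugation of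
  \<open>a \<otimes> b\<close>, using \<open>X = (\<Sum>i j. X $ i $ j *\<^sub>R (e\<^sub>i \<otimes> e\<^sub>j))\<close>.\<close>

definition oo_mult :: "mat8 \<Rightarrow> mat8 \<Rightarrow> mat8" where
  "oo_mult X Y = (\<Sum>i\<in>UNIV. \<Sum>j\<in>UNIV. \<Sum>k\<in>UNIV. \<Sum>l\<in>UNIV. (X $ i $ j * Y $ k $ l) *\<^sub>R
     oct_tensor (oct_mult (oct_unit i) (oct_unit k)) (oct_mult (oct_unit j) (oct_unit l)))"

definition oo_cnj :: "mat8 \<Rightarrow> mat8" where
  "oo_cnj X = (\<Sum>i\<in>UNIV. \<Sum>j\<in>UNIV. (X $ i $ j) *\<^sub>R
     oct_tensor (oct_cnj (oct_unit i)) (oct_cnj (oct_unit j)))"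

definition so_act :: "mat8 \<times> mat8 \<Rightarrow> mat8 \<Rightarrow> mat8" where
  "so_act A X = fst A ** X - X ** snd A"

definition oo_wedge :: "mat8 \<Rightarrow> mat8 \<Rightarrow> mat8 \<times> mat8" where
  "oo_wedge X Y =
     (X ** transpose Y - Y ** transpose X, transpose X ** Y - transpose Y ** X)"

definition so_bracket :: "mat8 \<times> mat8 \<Rightarrow> mat8 \<times> mat8 \<Rightarrow> mat8 \<times> mat8" where
  "so_bracket A B = (mat_bracket (fst A) (fst B), mat_bracket (snd A) (snd B))"

type_synonym e8_vec = "(mat8 \<times> mat8) \<times> mat8 \<times> mat8 \<times> mat8"

definition e8 :: "e8_vec set" where
  "e8 = (so8 \<times> so8) \<times> UNIV \<times> UNIV \<times> UNIV"

fun e8_bracket :: "e8_vec \<Rightarrow> e8_vec \<Rightarrow> e8_vec" where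
  "e8_bracket (A, u, v, w) (B, x, y, z) =
    (so_bracket A B - 4 *\<^sub>R oo_wedge u x - 4 *\<^sub>R triality2 (triality2 (oo_wedge v y))
       - 4 *\<^sub>R triality2 (oo_wedge w z),
     so_act A x - so_act B u + oo_cnj (oo_mult v z) - oo_cnj (oo_mult y w),
     so_act (triality2 A) y - so_act (triality2 B) v + oo_cnj (oo_mult w x) - oo_cnj (oo_mult z u),
     so_act (triality2 (triality2 A)) z - so_act (triality2 (triality2 B)) w
       + oo_cnj (oo_mult u y) - oo_cnj (oo_mult x v))"

definition torus2 :: "mat8 set" where
  "torus2 = span {oct_left (oct_unit 1), oct_right (oct_unit 1)}"

definition oct_complex :: "octonion set" where
  "oct_complex = span {oct_unit 0, oct_unit 1}"

definition oct_tensor_complex :: "mat8 set" where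
  "oct_tensor_complex = span {oct_tensor x y |x y. y \<in> oct_complex}"

definition e6 :: "e8_vec set" where
  "e6 = (so8 \<times> torus2) \<times> oct_tensor_complex \<times> oct_tensor_complex \<times> oct_tensor_complex"


section \<open>Root data of the Lie algebra of a compact group\<close>

definition lie_maximal_abelian ::
  "'a::real_vector set \<Rightarrow> 'a set \<Rightarrow> ('a \<Rightarrow> 'a \<Rightarrow> 'a) \<Rightarrow> bool" where
  "lie_maximal_abelian T L br \<longleftrightarrow>
     subspace T \<and> T \<subseteq> L \<and> (\<forall>H\<in>T. \<forall>K\<in>T. br H K = 0) \<and>
     (\<forall>X\<in>L. (\<forall>H\<in>T. br H X = 0) \<longrightarrow> X \<in> T)"

text \<open>The vector \<open>Z = X + \<i> Y\<close> of the complexification of \<open>L\<close> is nonzero and satisfies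
  \<open>[H, Z] = \<i> \<alpha>(H) Z\<close> for all \<open>H\<close> in \<open>T\<close>. The roots below are thus the real forms \<open>\<alpha>\<close> on \<open>T\<close>
  for which \<open>\<i> \<alpha>\<close> is a root of the complexification. They are represented by linear
  forms on the ambient space, of which only the restriction to \<open>T\<close> matters.\<close>

definition lie_root_vector ::
  "'a::real_vector set \<Rightarrow> ('a \<Rightarrow> 'a \<Rightarrow> 'a) \<Rightarrow> 'a set \<Rightarrow> ('a \<Rightarrow> real) \<Rightarrow> 'a \<Rightarrow> 'a \<Rightarrow> bool" where
  "lie_root_vector L br T \<alpha> X Y \<longleftrightarrow>
     X \<in> L \<and> Y \<in> L \<and> (X, Y) \<noteq> (0, 0) \<and>
     (\<forall>H\<in>T. br H X = - (\<alpha> H *\<^sub>R Y) \<and> br H Y = \<alpha> H *\<^sub>R X)"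

definition lie_root ::
  "'a::real_vector set \<Rightarrow> ('a \<Rightarrow> 'a \<Rightarrow> 'a) \<Rightarrow> 'a set \<Rightarrow> ('a \<Rightarrow> real) \<Rightarrow> bool" where
  "lie_root L br T \<alpha> \<longleftrightarrow>
     linear \<alpha> \<and> (\<exists>H\<in>T. \<alpha> H \<noteq> 0) \<and> (\<exists>X Y. lie_root_vector L br T \<alpha> X Y)"

text \<open>If \<open>Z = X + \<i> Y\<close> is a root vector for \<open>\<i> \<alpha>\<close>, then \<open>X - \<i> Y\<close> is one for \<open>- \<i> \<alpha>\<close> and their
  bracket is \<open>- 2 \<i> [X, Y]\<close>. Hence the usual coroot, the element of
  \<open>[\<gg>\<^sub>\<alpha>, \<gg>\<^sub>-\<^sub>\<alpha>]\<close> on which the root takes the value \<open>2\<close>, is \<open>- \<i> h\<close> with \<open>h\<close> as below, and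
  the Cartan integers are \<open>\<beta>(h)\<close>.\<close>

definition lie_coroot ::
  "'a::real_vector set \<Rightarrow> ('a \<Rightarrow> 'a \<Rightarrow> 'a) \<Rightarrow> 'a set \<Rightarrow> ('a \<Rightarrow> real) \<Rightarrow> 'a \<Rightarrow> bool" where
  "lie_coroot L br T \<alpha> h \<longleftrightarrow>
     h \<in> T \<and> \<alpha> h = 2 \<and> (\<exists>X Y c. lie_root_vector L br T \<alpha> X Y \<and> h = c *\<^sub>R br X Y)"

definition lie_root_base ::
  "'a::real_vector set \<Rightarrow> ('a \<Rightarrow> 'a \<Rightarrow> 'a) \<Rightarrow> 'a set \<Rightarrow> nat \<Rightarrow> (nat \<Rightarrow> 'a \<Rightarrow> real) \<Rightarrow> bool" where
  "lie_root_base L br T n \<alpha> \<longleftrightarrow>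
     (\<forall>i\<in>{1..n}. lie_root L br T (\<alpha> i)) \<and>
     (\<forall>c. (\<forall>H\<in>T. (\<Sum>i=1..n. c i * \<alpha> i H) = 0) \<longrightarrow> (\<forall>i\<in>{1..n}. c i = 0)) \<and>
     (\<forall>\<beta>. lie_root L br T \<beta> \<longrightarrow>
        (\<exists>m :: nat \<Rightarrow> nat.
           (\<forall>H\<in>T. \<beta> H = (\<Sum>i=1..n. real (m i) * \<alpha> i H)) \<or>
           (\<forall>H\<in>T. \<beta> H = - (\<Sum>i=1..n. real (m i) * \<alpha> i H))))"

definition lie_has_cartan_matrix ::
  "'a::real_vector set \<Rightarrow> ('a \<Rightarrow> 'a \<Rightarrow> 'a) \<Rightarrow> nat \<Rightarrow> (nat \<Rightarrow> nat \<Rightarrow> int) \<Rightarrow> bool" where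
  "lie_has_cartan_matrix L br n C \<longleftrightarrow>
     (\<exists>T \<alpha> h. lie_maximal_abelian T L br \<and> lie_root_base L br T n \<alpha> \<and>
        (\<forall>i\<in>{1..n}. lie_coroot L br T (\<alpha> i) (h i)) \<and>
        (\<forall>i\<in>{1..n}. \<forall>j\<in>{1..n}. \<alpha> j (h i) = of_int (C i j)))"

text \<open>Bourbaki's numbering: the chain 1 - 3 - 4 - 5 - 6 with 2 attached to 4.\<close>

definition cartan_E6 :: "nat \<Rightarrow> nat \<Rightarrow> int" where
  "cartan_E6 i j =
     (if i = j then 2
      else if {i, j} \<in> {{1,3}, {3,4}, {4,5}, {5,6}, {2,4}} then -1 else 0)"


section \<open>Compact simple Lie groups\<close>

text \<open>Every compact Lie group is isomorphic to a compact subgroup of some \<open>GL(n, \<real>)\<close>, and every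
  compact subgroup of \<open>GL(n, \<real>)\<close> is a Lie group.\<close>

definition matrix_group :: "(real ^ 'n ^ 'n) set \<Rightarrow> bool" where
  "matrix_group G \<longleftrightarrow>
     mat 1 \<in> G \<and> (\<forall>A\<in>G. \<forall>B\<in>G. A ** B \<in> G) \<and>
     (\<forall>A\<in>G. \<exists>B\<in>G. A ** B = mat 1 \<and> B ** A = mat 1)"

text \<open>The velocities at the identity of the one-parameter subgroups of \<open>G\<close>.\<close>

definition lie_algebra_of :: "(real ^ 'n ^ 'n) set \<Rightarrow> (real ^ 'n ^ 'n) set" where
  "lie_algebra_of G = {X. \<exists>\<gamma> :: real \<Rightarrow> real ^ 'n ^ 'n.
     (\<forall>t. \<gamma> t \<in> G) \<and> (\<forall>s t. \<gamma> (s + t) = \<gamma> s ** \<gamma> t) \<and> (\<gamma> has_vector_derivative X) (at 0)}"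

definition compact_simple_lie_group :: "(real ^ 'n ^ 'n) set \<Rightarrow> bool" where
  "compact_simple_lie_group G \<longleftrightarrow>
     matrix_group G \<and> compact G \<and> connected G \<and> lie_simple (lie_algebra_of G) mat_bracket"

definition compact_simple_lie_group_E6 :: "(real ^ 'n ^ 'n) set \<Rightarrow> bool" where
  "compact_simple_lie_group_E6 G \<longleftrightarrow>
     compact_simple_lie_group G \<and>
     lie_has_cartan_matrix (lie_algebra_of G) mat_bracket 6 cartan_E6"

end

theory Submission
  imports Defs
begin

text \<open>
  Two facts have to be combined: \<open>\<ee>\<^sub>6\<close> with the bracket of \<open>\<ee>\<^sub>8\<close> is a compact Lie algebra with an
  explicit root system of type \<open>E\<^sub>6\<close>, and every such algebra is the Lie algebra of a compact
  connected group.

  \<^bold>\<open>The group.\<close> Let a centreless Lie bracket on \<open>\<real>\<^sup>n\<close> make the standard inner product invariant. The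
  orthogonal automorphisms form a closed subgroup of \<open>O(n)\<close>, hence a compact group, and the
  component of its identity is the group looked for. Differentiating a one-parameter subgroup
  gives a derivation, and orthogonal projection onto the inner derivations shows that every
  derivation is inner (\<open>derivation_inner\<close>); conversely the exponential of \<open>ad x\<close> is an orthogonal
  automorphism. So the Lie algebra of the group is the image of \<open>ad\<close> (\<open>lie_algebra_of_Aut0\<close>).

  \<^bold>\<open>Roots.\<close> If an abelian subalgebra \<open>T\<close> and finitely many planes span the algebra, and \<open>T\<close> rotates
  each plane with a speed given by the inner product with a vector of \<open>T\<close>, then up to sign these
  vectors are the roots, and their Gram matrix determines the Cartan matrix. A nonzero ideal
  contains one of the planes, hence its root, hence every plane whose root is not orthogonal to
  that one; if the Dynkin diagram is connected, the ideal is everything (\<open>simple\<close>).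

  \<^bold>\<open>Triality.\<close> All properties of \<open>\<ee>\<^sub>8\<close> come from the linearized composition law
  \<open>cnj a (b p) + cnj b (a p) = 2 \<langle>a, b\<rangle> p\<close>. It shows that
  \<open>4 \<lambda>(a \<and> b) p = cnj a (b p) - cnj b (a p)\<close> and its mirror image
  \<open>4 \<lambda>\<^sup>2(a \<and> b) p = (p b) cnj a - (p a) cnj b\<close> fit together in
  \<open>P (cnj (x y)) = cnj (\<lambda>(P) x \<cdot> y) + cnj (x \<cdot> \<lambda>\<^sup>2(P) y)\<close>. As \<open>P\<close> determines the other two maps in
  this equation, and as the equation is cyclic, \<open>\<lambda>\<close> is an automorphism of order three
  (\<open>triality_eq\<close>). The Jacobi identity of \<open>\<ee>\<^sub>8\<close> then splits into a few multilinear identities,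
  which are checked on tensors \<open>x \<otimes> y\<close>. The rotation of the three summands by triality leaves only
  two of the four components to check (\<open>e8_jacobi\<close>).

  \<^bold>\<open>The root system.\<close> The rotations of the four coordinate planes \<open>e\<^sub>2\<^sub>a, e\<^sub>2\<^sub>a\<^sub>+\<^sub>1\<close> span a maximal torus
  of \<open>so(8)\<close>, which \<open>\<lambda>\<close> preserves. Together with \<open>torus2\<close> it gives a torus of dimension 6, which
  rotates \<open>12\<close> planes in \<open>so(8)\<close> with speeds \<open>\<theta>\<^sub>a \<plusminus> \<theta>\<^sub>b\<close> and \<open>8\<close> planes in each of the three copies
  of \<open>\<O> \<otimes> \<C>\<close> with speeds \<open>\<theta>\<^sub>a \<plusminus> \<phi>\<close>, twisted by \<open>\<lambda>\<close> and \<open>\<lambda>\<^sup>2\<close>. Six of these \<open>36\<close> speeds have the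
  Cartan matrix of \<open>E\<^sub>6\<close>, and the others are combinations of the six with integral coefficients of
  one sign, listed in \<open>root_elt_table\<close>. The form \<open>e8_form\<close> is invariant and positive definite, and
  the dimension is \<open>28 + 2 + 3 \<cdot> 16 = 78\<close>, so \<open>\<ee>\<^sub>6\<close> can be identified isometrically with \<open>\<real>\<^sup>7\<^sup>8\<close>,
  where the first two parts apply.
\<close>

section \<open>Exponentials of real matrices\<close>

lemmas bilinear_rules =
  bounded_bilinear.add_left bounded_bilinear.add_right bounded_bilinear.diff_left
  bounded_bilinear.diff_right bounded_bilinear.minus_left bounded_bilinear.minus_right
  bounded_bilinear.scaleR_left bounded_bilinear.scaleR_right bounded_bilinear.zero_left
  bounded_bilinear.zero_right

lemma bounded_bilinear_linearI:
  fixes f :: "'a::euclidean_space \<Rightarrow> 'b::euclidean_space \<Rightarrow> 'c::real_normed_vector"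
  assumes "\<And>x. linear (f x)" "\<And>y. linear (\<lambda>x. f x y)"
  shows "bounded_bilinear f"
  using assms by (simp add: bilinear_conv_bounded_bilinear [symmetric] bilinear_def)

lemmas linear_rules = linear_add linear_diff linear_neg linear_scale linear_0

lemma bounded_bilinear_matrix_mult:
  "bounded_bilinear ((**) :: real ^ 'n ^ 'm \<Rightarrow> real ^ 'k ^ 'n \<Rightarrow> real ^ 'k ^ 'm)"
  by (auto intro!: bounded_bilinear_linearI linearI simp: vec_eq_iff matrix_matrix_mult_def
      sum_distrib_left mult_ac
      algebra_simps sum.distrib)

lemmas matrix_mult_linear = bilinear_rules [OF bounded_bilinear_matrix_mult]

lemma bounded_linear_matrix_apply: "bounded_linear (\<lambda>A :: real ^ 'n ^ 'm. A *v x)"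
  unfolding linear_conv_bounded_linear [symmetric]
  by (auto intro!: linearI simp: vec_eq_iff matrix_vector_mult_def sum_distrib_left mult_ac
      algebra_simps sum.distrib)

text \<open>The coefficient \<open>D\<^sup>k / k!\<close> of the exponential series.\<close>

primrec exp_coeff :: "real ^ 'n ^ 'n \<Rightarrow> nat \<Rightarrow> real ^ 'n ^ 'n" where
  "exp_coeff D 0 = mat 1"
| "exp_coeff D (Suc k) = (1 / real (Suc k)) *\<^sub>R (D ** exp_coeff D k)"

lemma exp_coeff_commute: "D ** exp_coeff D k = exp_coeff D k ** D"
  by (induction k)
    (simp_all add: matrix_mul_assoc matrix_mult_linear)

lemma exp_coeff_bound:
  fixes D :: "real ^ 'n ^ 'n"
  shows "\<bar>exp_coeff D k $ i $ j\<bar> \<le> (\<Sum>i\<in>UNIV. \<Sum>j\<in>UNIV. \<bar>D $ i $ j\<bar>) ^ k / fact k"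
proof (induction k arbitrary: i j)
  case 0
  then show ?case by (simp add: mat_def)
next
  case (Suc k)
  let ?M = "\<Sum>i\<in>UNIV. \<Sum>j\<in>UNIV. \<bar>D $ i $ j\<bar>"
  have "\<bar>(D ** exp_coeff D k) $ i $ j\<bar> \<le> (\<Sum>l\<in>UNIV. \<bar>D $ i $ l * exp_coeff D k $ l $ j\<bar>)"
    by (simp add: matrix_matrix_mult_def)
  also have "\<dots> \<le> (\<Sum>l\<in>UNIV. \<bar>D $ i $ l\<bar> * (?M ^ k / fact k))"
    unfolding abs_mult by (intro sum_mono mult_left_mono Suc) auto
  also have "\<dots> = (\<Sum>l\<in>UNIV. \<bar>D $ i $ l\<bar>) * (?M ^ k / fact k)"
    by (rule sum_distrib_right [symmetric])
  also have "\<dots> \<le> ?M * (?M ^ k / fact k)"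
    by (intro mult_right_mono member_le_sum[where f="\<lambda>i. \<Sum>l\<in>UNIV. \<bar>D $ i $ l\<bar>"])
      (auto intro!: sum_nonneg zero_le_power divide_nonneg_nonneg)
  finally show ?case
    by (simp add: abs_mult divide_simps mult_ac del: of_nat_Suc)
qed

definition matrix_exp :: "real ^ 'n ^ 'n \<Rightarrow> real \<Rightarrow> real ^ 'n ^ 'n" where
  "matrix_exp D t = (\<chi> i j. \<Sum>k. exp_coeff D k $ i $ j * t ^ k)"

lemma matrix_exp_summable: "summable (\<lambda>k. exp_coeff D k $ i $ j * t ^ k)"
proof (rule summable_comparison_test)
  let ?M = "\<Sum>i\<in>UNIV. \<Sum>j\<in>UNIV. \<bar>D $ i $ j\<bar>"
  have "\<bar>exp_coeff D k $ i $ j\<bar> * \<bar>t\<bar> ^ k \<le> ?M ^ k / fact k * \<bar>t\<bar> ^ k" for k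
    by (intro mult_right_mono exp_coeff_bound) auto
  then show "\<exists>N. \<forall>k\<ge>N. norm (exp_coeff D k $ i $ j * t ^ k) \<le> inverse (fact k) * (?M * \<bar>t\<bar>) ^ k"
    by (auto simp: abs_mult power_mult_distrib power_abs field_simps)
  show "summable (\<lambda>k. inverse (fact k) * (?M * \<bar>t\<bar>) ^ k)"
    using summable_exp[of "?M * \<bar>t\<bar>"] by simp
qed

lemma matrix_exp_0 [simp]: "matrix_exp D 0 = mat 1"
  by (simp add: matrix_exp_def vec_eq_iff powser_zero del: exp_coeff.simps(2))

text \<open>A fixed matrix can be multiplied into the series, so that commutation and
  differentiation of the exponential reduce to statements about the coefficients.\<close>

lemma matrix_exp_mult_entry:
  "(A ** matrix_exp D t) $ i $ j = (\<Sum>k. (A ** exp_coeff D k) $ i $ j * t ^ k)"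
  "(matrix_exp D t ** A) $ i $ j = (\<Sum>k. (exp_coeff D k ** A) $ i $ j * t ^ k)"
proof -
  have "(A ** matrix_exp D t) $ i $ j = (\<Sum>l\<in>UNIV. \<Sum>k. A $ i $ l * (exp_coeff D k $ l $ j * t ^ k))"
    by (simp add: matrix_matrix_mult_def matrix_exp_def suminf_mult matrix_exp_summable)
  also have "\<dots> = (\<Sum>k. \<Sum>l\<in>UNIV. A $ i $ l * (exp_coeff D k $ l $ j * t ^ k))"
    by (intro suminf_sum [symmetric] summable_mult matrix_exp_summable)
  finally show "(A ** matrix_exp D t) $ i $ j = (\<Sum>k. (A ** exp_coeff D k) $ i $ j * t ^ k)"
    by (simp add: matrix_matrix_mult_def sum_distrib_left mult_ac)
  have "(matrix_exp D t ** A) $ i $ j = (\<Sum>l\<in>UNIV. \<Sum>k. (exp_coeff D k $ i $ l * t ^ k) * A $ l $ j)"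
    by (simp add: matrix_matrix_mult_def matrix_exp_def suminf_mult2 matrix_exp_summable)
  also have "\<dots> = (\<Sum>k. \<Sum>l\<in>UNIV. (exp_coeff D k $ i $ l * t ^ k) * A $ l $ j)"
    by (intro suminf_sum [symmetric] summable_mult2 matrix_exp_summable)
  finally show "(matrix_exp D t ** A) $ i $ j = (\<Sum>k. (exp_coeff D k ** A) $ i $ j * t ^ k)"
    by (simp add: matrix_matrix_mult_def sum_distrib_left mult_ac)
qed

lemma matrix_exp_commute: "D ** matrix_exp D t = matrix_exp D t ** D"
  by (simp add: vec_eq_iff matrix_exp_mult_entry exp_coeff_commute)

lemma has_vector_derivative_matrix:
  fixes f :: "real \<Rightarrow> real ^ 'n ^ 'm"
  assumes "\<And>i j. ((\<lambda>t. f t $ i $ j) has_real_derivative f' $ i $ j) (at t)"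
  shows "(f has_vector_derivative f') (at t)"
proof -
  have "((\<lambda>t. f t $ i) has_vector_derivative f' $ i) (at t)" for i
    unfolding has_vector_derivative_def
    using assms
    by (subst has_derivative_componentwise_within)
      (auto simp: Basis_vec_def inner_axis has_field_derivative_def mult_commute_abs)
  then show ?thesis
    unfolding has_vector_derivative_def using assms
    by (subst has_derivative_componentwise_within)
      (auto simp: Basis_vec_def inner_axis has_field_derivative_def mult_commute_abs)
qed

lemma matrix_exp_has_derivative:
  "(matrix_exp D has_vector_derivative D ** matrix_exp D t) (at t)"
proof (rule has_vector_derivative_matrix)
  fix i j
  have "((\<lambda>t. \<Sum>k. exp_coeff D k $ i $ j * t ^ k) has_real_derivative
      (\<Sum>k. diffs (\<lambda>k. exp_coeff D k $ i $ j) k * t ^ k)) (at t)"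
    by (rule termdiffs_strong_converges_everywhere) (rule matrix_exp_summable)
  moreover have "diffs (\<lambda>k. exp_coeff D k $ i $ j) k = (D ** exp_coeff D k) $ i $ j" for k
    by (simp add: diffs_def del: of_nat_Suc)
  ultimately show "((\<lambda>t. matrix_exp D t $ i $ j) has_real_derivative (D ** matrix_exp D t) $ i $
      j) (at t)"
    by (simp add: matrix_exp_mult_entry) (simp add: matrix_exp_def)
qed

text \<open>Because \<open>D\<close> commutes with its exponential, \<open>exp (- r D) exp ((r + s) D)\<close> has derivative
  zero in \<open>r\<close>.\<close>

lemma matrix_exp_add: "matrix_exp D (s + t) = matrix_exp D s ** matrix_exp D t"
proof -
  have const: "matrix_exp D (- r) ** matrix_exp D (r + s) = matrix_exp D s" for r s
  proof -
    let ?f = "\<lambda>r. matrix_exp D (- r) ** matrix_exp D (r + s)"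
    have "(?f has_vector_derivative 0) (at r)" for r
    proof -
      have neg: "((\<lambda>r::real. - r) has_vector_derivative - 1) (at r)"
        and shift: "((\<lambda>r::real. r + s) has_vector_derivative 1) (at r)"
        by (auto intro!: derivative_eq_intros)
      note 1 = vector_diff_chain_at[OF neg matrix_exp_has_derivative[of D], unfolded o_def]
      note 2 = vector_diff_chain_at[OF shift matrix_exp_has_derivative[of D], unfolded o_def]
      have "(?f has_vector_derivative (matrix_exp D (- r) ** (1 *\<^sub>R (D ** matrix_exp D (r + s)))
            + ((- 1) *\<^sub>R (D ** matrix_exp D (- r))) ** matrix_exp D (r + s))) (at r)"
        by (rule bounded_bilinear.has_vector_derivative[OF bounded_bilinear_matrix_mult 1 2])
      moreover have "(- (D ** matrix_exp D (- r))) ** matrix_exp D (r + s) =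
          - (matrix_exp D (- r) ** (D ** matrix_exp D (r + s)))"
        by (subst matrix_exp_commute)
          (simp add: matrix_mul_assoc matrix_mult_linear)
      ultimately show ?thesis by simp
    qed
    then obtain c where "\<And>r. ?f r = c"
      using has_vector_derivative_zero_constant[of UNIV ?f] by auto
    from this[of r] this[of 0] have "?f r = ?f 0" by (rule trans [OF _ sym])
    then show ?thesis by simp
  qed
  have inv: "matrix_exp D s ** matrix_exp D (- s) = mat 1" for s
    using const[of "- s" 0] by simp
  have "matrix_exp D s ** matrix_exp D t = matrix_exp D s ** (matrix_exp D (- s) ** matrix_exp D
      (s + t))"
    by (simp add: const)
  then show ?thesis by (simp add: matrix_mul_assoc inv)
qed

section \<open>Lie brackets with an invariant inner product\<close>

text \<open>Invariance of the given inner product says that the maps \<open>br x\<close> are skew-symmetric; this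
  is what puts the adjoint group into a compact orthogonal group.\<close>

locale invariant_lie_bracket =
  fixes br :: "'a::euclidean_space \<Rightarrow> 'a \<Rightarrow> 'a"
  assumes bilinear: "bilinear br"
    and self: "br x x = 0"
    and jacobi: "br x (br y z) + br y (br z x) + br z (br x y) = 0"
    and invariant: "br x y \<bullet> z = x \<bullet> br y z"
begin

lemma bounded_bilinear: "bounded_bilinear br"
  using bilinear by (simp add: bilinear_conv_bounded_bilinear)

lemmas add_left = bounded_bilinear.add_left [OF bounded_bilinear]
  and add_right = bounded_bilinear.add_right [OF bounded_bilinear]
  and diff_left = bounded_bilinear.diff_left [OF bounded_bilinear]
  and diff_right = bounded_bilinear.diff_right [OF bounded_bilinear]
  and minus_left = bounded_bilinear.minus_left [OF bounded_bilinear]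
  and minus_right = bounded_bilinear.minus_right [OF bounded_bilinear]
  and scaleR_left = bounded_bilinear.scaleR_left [OF bounded_bilinear]
  and scaleR_right = bounded_bilinear.scaleR_right [OF bounded_bilinear]

lemma linear_right: "linear (br x)"
  by (rule linearI) (simp_all add: add_right scaleR_right)

lemma antisym: "br y x = - br x y"
proof -
  have "br (x + y) (x + y) = br x y + br y x"
    by (simp only: add_left add_right) (simp add: self)
  then have "br x y + br y x = 0" by (metis self)
  then show ?thesis by (simp add: eq_neg_iff_add_eq_0 add.commute)
qed

lemma derivation: "br x (br y z) = br (br x y) z + br y (br x z)"
proof -
  have "br y (br x z) = - br y (br z x)" by (subst antisym[of x z]) (rule minus_right)
  moreover have "br (br x y) z = - br z (br x y)" by (rule antisym)
  moreover have "br x (br y z) = - (br y (br z x) + br z (br x y))"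
    using jacobi[of x y z] by (simp only: eq_neg_iff_add_eq_0 add.assoc)
  ultimately show ?thesis by simp
qed

lemma skew: "br x y \<bullet> z = - (y \<bullet> br x z)"
  using invariant[of y x z] antisym[of x y] by simp

end

lemma transpose_inner_left:
  fixes A :: "real ^ 'n ^ 'm"
  shows "(A *v x) \<bullet> y = x \<bullet> (transpose A *v y)"
  by (metis dot_lmul_matrix vector_transpose_matrix inner_commute transpose_transpose)

lemma matrix_minus_apply: "(- A) *v x = - (A *v x)" for A :: "real ^ 'n ^ 'm"
  using linear_neg[OF bounded_linear.linear[OF bounded_linear_matrix_apply]] .

lemma matrix_inner_alt: "(A :: real ^ 'n ^ 'm) \<bullet> B = (\<Sum>i\<in>UNIV. \<Sum>j\<in>UNIV. A $ i $ j * B $ i $ j)"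
  by (simp add: inner_vec_def)

text \<open>The inner product of matrices is the trace form \<open>tr (A\<^sup>t B)\<close>, so multiplications are
  moved across it by transposition.\<close>

lemma matrix_inner_mult_left:
  fixes A :: "real ^ 'n ^ 'm" and B :: "real ^ 'k ^ 'n"
  shows "(A ** B) \<bullet> C = B \<bullet> (transpose A ** C)"
proof -
  have "(A ** B) \<bullet> C = (\<Sum>i\<in>UNIV. \<Sum>j\<in>UNIV. \<Sum>k\<in>UNIV. A $ i $ k * B $ k $ j * C $ i $ j)"
    by (simp add: matrix_inner_alt matrix_matrix_mult_def sum_distrib_right)
  also have "\<dots> = (\<Sum>k\<in>UNIV. \<Sum>j\<in>UNIV. \<Sum>i\<in>UNIV. A $ i $ k * B $ k $ j * C $ i $ j)"
    by (subst sum.swap, subst (2) sum.swap, subst sum.swap) (rule refl)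
  also have "\<dots> = B \<bullet> (transpose A ** C)"
    by (simp add: matrix_inner_alt matrix_matrix_mult_def sum_distrib_left transpose_def mult_ac)
  finally show ?thesis .
qed

lemma matrix_inner_transpose: "transpose A \<bullet> transpose B = (A :: real ^ 'n ^ 'm) \<bullet> B"
  unfolding matrix_inner_alt transpose_def by (subst sum.swap) simp

lemma matrix_inner_mult_right:
  fixes A :: "real ^ 'n ^ 'm" and B :: "real ^ 'k ^ 'n"
  shows "(A ** B) \<bullet> C = A \<bullet> (C ** transpose B)"
  using matrix_inner_mult_left[of "transpose B" "transpose A" "transpose C"]
  by (metis matrix_inner_transpose matrix_transpose_mul transpose_transpose)

lemma transpose_skew_iff:
  fixes D :: "real ^ 'n ^ 'n"
  shows "transpose D = - D \<longleftrightarrow> (\<forall>x y. (D *v x) \<bullet> y = - (x \<bullet> (D *v y)))"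
proof
  assume "transpose D = - D"
  then show "\<forall>x y. (D *v x) \<bullet> y = - (x \<bullet> (D *v y))"
    by (metis transpose_inner_left matrix_minus_apply inner_minus_right)
next
  assume *: "\<forall>x y. (D *v x) \<bullet> y = - (x \<bullet> (D *v y))"
  have "x \<bullet> (transpose D *v y) = x \<bullet> ((- D) *v y)" for x y
    using * by (simp add: transpose_inner_left[symmetric] matrix_minus_apply del:
        transpose_matrix_vector)
  then have "transpose D *v y = (- D) *v y" for y using vector_eq_ldot by blast
  then show "transpose D = - D" unfolding matrix_eq by blast
qed

section \<open>The adjoint group\<close>

locale centerless_lie_bracket = invariant_lie_bracket br
  for br :: "real ^ 'n \<Rightarrow> real ^ 'n \<Rightarrow> real ^ 'n" +
  assumes center: "(\<And>y. br x y = 0) \<Longrightarrow> x = 0"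
begin

definition adj :: "real ^ 'n \<Rightarrow> real ^ 'n ^ 'n" where
  "adj x = matrix (br x)"

lemma adj_apply [simp]: "adj x *v y = br x y"
  by (simp add: adj_def matrix_works linear_right)

lemma linear_adj: "linear adj"
  by (rule linearI) (simp_all add: matrix_eq adj_apply add_left scaleR_left
      matrix_vector_mult_add_rdistrib scaleR_matrix_vector_assoc [symmetric])

lemma inj_adj: "inj adj"
proof (rule injI)
  fix x y assume "adj x = adj y"
  then have "br (x - y) z = 0" for z
    by (metis adj_apply diff_left eq_iff_diff_eq_0)
  then show "x = y" using center by fastforce
qed

lemma adj_bracket: "adj (br x y) = mat_bracket (adj x) (adj y)"
  by (simp add: matrix_eq mat_bracket_def matrix_vector_mult_diff_rdistrib
      derivation[of x y] flip: matrix_vector_mul_assoc)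

lemma transpose_adj: "transpose (adj x) = - adj x"
  by (simp add: transpose_skew_iff skew)

text \<open>Write \<open>D = ad y + E\<close> with \<open>E\<close> orthogonal to all inner derivations. Then \<open>E\<close> is a
  derivation too, so \<open>[E, ad x] = ad (E x)\<close>. On the other hand
  \<open>\<langle>[E, ad x], ad z\<rangle> = \<langle>E, ad [x, z]\<rangle> = 0\<close>, because the maps \<open>ad x\<close> are skew-symmetric. Hence
  \<open>ad (E x)\<close> is orthogonal to itself, and \<open>E x\<close> lies in the centre.\<close>

lemma derivation_inner:
  fixes D :: "real ^ 'n ^ 'n"
  assumes deriv: "\<And>x y. D *v br x y = br (D *v x) y + br x (D *v y)"
  shows "D \<in> range adj"
proof -
  have sub: "subspace (range adj)"
    using linear_adj linear_subspace_image subspace_UNIV by blast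
  obtain Y E where Y: "Y \<in> range adj" and E: "\<And>w. w \<in> range adj \<Longrightarrow> orthogonal E w" and D: "D = Y + E"
    using orthogonal_subspace_decomp_exists[of "range adj" D] sub by (metis span_eq_iff)
  obtain y where y: "Y = adj y" using Y by blast
  have Ederiv: "E *v br x z = br (E *v x) z + br x (E *v z)" for x z
  proof -
    have "E = D - adj y" using D y by simp
    then show ?thesis
      using deriv[of x z] derivation[of y x z]
      by (simp add: matrix_vector_mult_diff_rdistrib diff_left diff_right)
  qed
  have "E *v x = 0" for x
  proof -
    have comm: "adj (E *v x) = E ** adj x - adj x ** E"
      by (simp add: matrix_eq matrix_vector_mult_diff_rdistrib Ederiv flip: matrix_vector_mul_assoc)
    have "adj (E *v x) \<bullet> adj z = 0" for z
    proof -
      have "adj (E *v x) \<bullet> adj z = E \<bullet> (adj z ** transpose (adj x)) - E \<bullet> (transpose (adj x) **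
          adj z)"
        unfolding comm inner_diff_left
        by (simp only: matrix_inner_mult_left[of "adj x" E] matrix_inner_mult_right[of E "adj x"])
      also have "\<dots> = E \<bullet> adj (br x z)"
        by (simp add: transpose_adj adj_bracket mat_bracket_def inner_diff_right
            matrix_mult_linear)
      also have "\<dots> = 0" using E[of "adj (br x z)"] by (simp add: orthogonal_def)
      finally show ?thesis .
    qed
    from this[of "E *v x"] have "adj (E *v x) = adj 0"
      using linear_adj by (simp add: linear_0)
    then show ?thesis using inj_adj by (auto dest: injD)
  qed
  then have "E = 0" by (simp add: matrix_eq)
  then show ?thesis using D Y by simp
qed

definition Aut :: "(real ^ 'n ^ 'n) set" where
  "Aut = {A. orthogonal_matrix A \<and> (\<forall>x y. A *v br x y = br (A *v x) (A *v y))}"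

definition Aut0 :: "(real ^ 'n ^ 'n) set" where
  "Aut0 = connected_component_set Aut (mat 1)"

lemma one_in_Aut: "mat 1 \<in> Aut"
  by (simp add: Aut_def orthogonal_matrix_id)

lemma Aut_mult: "A \<in> Aut \<Longrightarrow> B \<in> Aut \<Longrightarrow> A ** B \<in> Aut"
  by (auto simp: Aut_def orthogonal_matrix_mul simp flip: matrix_vector_mul_assoc)

lemma Aut_transpose:
  assumes "A \<in> Aut" shows "transpose A \<in> Aut"
proof -
  have inv: "transpose A ** A = mat 1" "A ** transpose A = mat 1"
    using assms by (auto simp: Aut_def orthogonal_matrix_def)
  have "transpose A *v br x y = br (transpose A *v x) (transpose A *v y)" for x y
  proof -
    have "br x y = A *v br (transpose A *v x) (transpose A *v y)"
      using assms by (simp add: Aut_def matrix_vector_mul_assoc inv del: transpose_matrix_vector)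
    then show ?thesis by (simp add: matrix_vector_mul_assoc inv del: transpose_matrix_vector)
  qed
  then show ?thesis using assms by (simp add: Aut_def)
qed

lemma compact_Aut: "compact Aut"
proof -
  have "closed Aut"
  proof -
    have *: "Aut = {A. transpose A ** A = mat 1} \<inter> (\<Inter>x. \<Inter>y. {A. A *v br x y = br (A *v x) (A *v
        y)})"
      by (auto simp: Aut_def orthogonal_matrix)
    have cont: "continuous_on UNIV (\<lambda>A :: real ^ 'n ^ 'n. A *v x)" for x
      by (rule linear_continuous_on) (rule bounded_linear_matrix_apply)
    have tr: "continuous_on UNIV (transpose :: real ^ 'n ^ 'n \<Rightarrow> _)"
      by (intro linear_continuous_on linear_conv_bounded_linear[THEN iffD1] linearI)
        (auto simp: transpose_def vec_eq_iff)
    show ?thesis unfolding *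
      by (intro closed_Int closed_INT ballI closed_Collect_eq cont
          bounded_bilinear.continuous_on[OF bounded_bilinear]
          bounded_bilinear.continuous_on[OF bounded_bilinear_matrix_mult] tr continuous_on_id
              continuous_on_const)
  qed
  moreover have "norm A = sqrt (real CARD('n))" if "A \<in> Aut" for A
  proof -
    have "A \<bullet> A = mat 1 \<bullet> (transpose A ** A)"
      using matrix_inner_mult_left[of A "mat 1" A] by simp
    also have "\<dots> = (mat 1 :: real ^ 'n ^ 'n) \<bullet> mat 1"
      using that by (simp add: Aut_def orthogonal_matrix)
    also have "\<dots> = real CARD('n)"
      by (simp add: matrix_inner_alt mat_def if_distrib cong: if_cong)
    finally show ?thesis by (simp add: norm_eq_sqrt_inner)
  qed
  then have "bounded Aut" unfolding bounded_iff by (metis order_refl)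
  ultimately show ?thesis by (simp add: compact_eq_bounded_closed)
qed

text \<open>Membership in the identity component is always shown by exhibiting a connected set of
  automorphisms that meets it.\<close>

lemma Aut0_maximal:
  assumes "connected S" "S \<subseteq> Aut" "A \<in> S" "A \<in> Aut0" shows "S \<subseteq> Aut0"
proof -
  have "connected_component_set Aut A = Aut0"
    using assms(4) connected_component_eq unfolding Aut0_def by fastforce
  then show ?thesis using connected_component_maximal[OF assms(3,1,2)] by simp
qed

lemma Aut0_subset: "Aut0 \<subseteq> Aut"
  unfolding Aut0_def by (rule connected_component_subset)

lemma one_in_Aut0: "mat 1 \<in> Aut0"
  by (simp add: Aut0_def one_in_Aut)

lemma Aut0_translate:
  assumes "A \<in> Aut" shows "connected ((**) A ` Aut0)" "(**) A ` Aut0 \<subseteq> Aut"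
proof -
  have "continuous_on Aut0 ((**) A)"
    by (intro linear_continuous_on bounded_bilinear.bounded_linear_right[OF
        bounded_bilinear_matrix_mult])
  then show "connected ((**) A ` Aut0)"
    by (rule connected_continuous_image) (simp add: Aut0_def)
  show "(**) A ` Aut0 \<subseteq> Aut" using assms Aut0_subset Aut_mult by blast
qed

text \<open>The translates of the identity component by an element \<open>A\<close> of it and by the inverse of
  \<open>A\<close> are connected and meet the component, in \<open>A\<close> and in \<open>1\<close>.\<close>

lemma matrix_group_Aut0: "matrix_group Aut0"
  unfolding matrix_group_def
proof (intro conjI ballI)
  show "mat 1 \<in> Aut0" by (rule one_in_Aut0)
next
  fix A B assume A: "A \<in> Aut0" and B: "B \<in> Aut0"
  have "(**) A ` Aut0 \<subseteq> Aut0"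
  proof (rule Aut0_maximal)
    show "A \<in> (**) A ` Aut0" by (rule image_eqI[OF _ one_in_Aut0]) simp
  qed (use A Aut0_subset in \<open>auto intro!: Aut0_translate simp: Aut_mult subset_iff\<close>)
  then show "A ** B \<in> Aut0" using B by auto
next
  fix A assume A: "A \<in> Aut0"
  then have "A \<in> Aut" using Aut0_subset by auto
  then have inv: "transpose A ** A = mat 1" "A ** transpose A = mat 1"
    by (auto simp: Aut_def orthogonal_matrix_def)
  have "(**) (transpose A) ` Aut0 \<subseteq> Aut0"
  proof (rule Aut0_maximal)
    show "mat 1 \<in> (**) (transpose A) ` Aut0" by (rule image_eqI[OF _ A]) (simp add: inv)
  qed (use \<open>A \<in> Aut\<close> Aut_transpose Aut0_translate one_in_Aut0 in auto)
  then have "transpose A \<in> Aut0" using image_subset_iff one_in_Aut0 by force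
  then show "\<exists>B\<in>Aut0. A ** B = mat 1 \<and> B ** A = mat 1" using inv by auto
qed

lemma compact_Aut0: "compact Aut0"
  unfolding Aut0_def using compact_Aut closed_connected_component connected_component_subset
  by (metis compact_Int_closed compact_imp_closed inf.absorb_iff2)

lemma connected_Aut0: "connected Aut0"
  by (simp add: Aut0_def)

text \<open>With \<open>E\<^sub>t = exp (t ad a)\<close>, both \<open>\<langle>E\<^sub>t x, E\<^sub>t y\<rangle>\<close> and \<open>E\<^sub>-\<^sub>t [E\<^sub>t x, E\<^sub>t y]\<close> have derivative
  zero in \<open>t\<close>, the former because \<open>ad a\<close> is skew-symmetric, the latter because it is a derivation.\<close>

lemma matrix_exp_adj: "matrix_exp (adj a) t \<in> Aut"
proof -
  let ?E = "matrix_exp (adj a)"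
  have dE: "((\<lambda>t. ?E t *v x) has_vector_derivative br a (?E t *v x)) (at t)" for x t
    using bounded_linear.has_vector_derivative[OF bounded_linear_matrix_apply[of x]
        matrix_exp_has_derivative[of "adj a" t]]
    by (simp flip: matrix_vector_mul_assoc)
  have inv: "?E (- t) ** ?E t = mat 1" for t
    using matrix_exp_add[of "adj a" "- t" t] by simp
  have inner: "(?E t *v x) \<bullet> (?E t *v y) = x \<bullet> y" for x y
  proof -
    let ?f = "\<lambda>t. (?E t *v x) \<bullet> (?E t *v y)"
    have "(?f has_vector_derivative 0) (at t)" for t
      using bounded_bilinear.has_vector_derivative[OF bounded_bilinear_inner dE[of x t] dE[of y t]]
        skew[of a "?E t *v x" "?E t *v y"] by (simp add: add.commute)
    then obtain c where "\<And>r. ?f r = c"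
      using has_vector_derivative_zero_constant[of UNIV ?f] by auto
    from this[of t] this[of 0] show ?thesis by simp
  qed
  have "?E t *v br x y = br (?E t *v x) (?E t *v y)" for x y
  proof -
    have dE': "((\<lambda>t. ?E (- t)) has_vector_derivative - (?E (- t) ** adj a)) (at t)" for t
    proof -
      have neg: "((\<lambda>r::real. - r) has_vector_derivative - 1) (at t)"
        by (auto intro!: derivative_eq_intros)
      show ?thesis
        using vector_diff_chain_at[OF neg matrix_exp_has_derivative[of "adj a"]]
        by (simp add: o_def matrix_exp_commute)
    qed
    let ?f = "\<lambda>t. ?E (- t) *v br (?E t *v x) (?E t *v y)"
    have bb: "bounded_bilinear ((*v) :: real ^ 'n ^ 'n \<Rightarrow> _)"
      unfolding bilinear_conv_bounded_bilinear [symmetric] bilinear_def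
      using bounded_linear_matrix_apply by (auto simp: linear_linear)
    have "(?f has_vector_derivative 0) (at t)" for t
    proof -
      note * = bounded_bilinear.has_vector_derivative[OF bb dE'[of t]
        bounded_bilinear.has_vector_derivative[OF bounded_bilinear dE[of x t] dE[of y t]]]
      show ?thesis
        using *
        by (simp add: bounded_bilinear.minus_left[OF bb] derivation[of a "?E t *v x"] add.commute
          flip: matrix_vector_mul_assoc)
    qed
    then obtain c where "\<And>r. ?f r = c"
      using has_vector_derivative_zero_constant[of UNIV ?f] by auto
    from this[of t] this[of 0] have "?f t = br x y" by simp
    then have "?E t *v br x y = (?E t ** ?E (- t)) *v br (?E t *v x) (?E t *v y)"
      by (simp flip: matrix_vector_mul_assoc)
    then show ?thesis using inv[of "- t"] by simp
  qed
  moreover have "orthogonal_matrix (?E t)"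
  proof -
    have "x \<bullet> ((transpose (?E t) ** ?E t) *v y) = x \<bullet> (mat 1 *v y)" for x y
      by (metis inner transpose_inner_left matrix_vector_mul_assoc matrix_vector_mul_lid)
    then show ?thesis unfolding orthogonal_matrix matrix_eq using vector_eq_ldot by blast
  qed
  ultimately show ?thesis by (simp add: Aut_def)
qed

text \<open>The velocity of a one-parameter group of automorphisms is a derivation, hence inner.
  Conversely, the exponentials of an inner derivation form a connected set through the identity.\<close>

lemma lie_algebra_of_Aut0: "lie_algebra_of Aut0 = range adj"
proof
  show "range adj \<subseteq> lie_algebra_of Aut0"
  proof
    fix X assume "X \<in> range adj"
    then obtain a where a: "X = adj a" by blast
    have d: "(matrix_exp X has_vector_derivative X ** matrix_exp X t) (at t)" for t
      by (rule matrix_exp_has_derivative)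
    have "continuous_on UNIV (matrix_exp X)"
      using d by (meson continuous_at_imp_continuous_on has_vector_derivative_continuous)
    then have "range (matrix_exp X) \<subseteq> Aut0"
      by (intro Aut0_maximal[of _ "mat 1"] connected_continuous_image one_in_Aut0)
        (auto simp: a matrix_exp_adj intro!: range_eqI[of _ _ 0])
    moreover have "(matrix_exp X has_vector_derivative X) (at 0)"
      using d[of 0] by simp
    ultimately show "X \<in> lie_algebra_of Aut0"
      unfolding lie_algebra_of_def using matrix_exp_add by blast
  qed
  show "lie_algebra_of Aut0 \<subseteq> range adj"
  proof
    fix X assume "X \<in> lie_algebra_of Aut0"
    then obtain \<gamma> where \<gamma>: "\<And>t. \<gamma> t \<in> Aut0" "\<And>s t. \<gamma> (s + t) = \<gamma> s ** \<gamma> t"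
        and d: "(\<gamma> has_vector_derivative X) (at 0)"
      unfolding lie_algebra_of_def by blast
    have Aut: "\<gamma> t \<in> Aut" for t using \<gamma>(1) Aut0_subset by blast
    have one: "\<gamma> 0 = mat 1"
    proof -
      have "transpose (\<gamma> 0) ** \<gamma> 0 = mat 1" using Aut[of 0] by (simp add: Aut_def orthogonal_matrix)
      moreover have "\<gamma> 0 ** \<gamma> 0 = \<gamma> 0" using \<gamma>(2)[of 0 0] by simp
      ultimately show ?thesis by (metis matrix_mul_assoc matrix_mul_lid)
    qed
    have dx: "((\<lambda>t. \<gamma> t *v x) has_vector_derivative X *v x) (at 0)" for x
      by (rule bounded_linear.has_vector_derivative[OF bounded_linear_matrix_apply d])
    have "X *v br x y = br (X *v x) y + br x (X *v y)" for x y
    proof -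
      have "((\<lambda>t. br (\<gamma> t *v x) (\<gamma> t *v y)) has_vector_derivative br x (X *v y) + br (X *v x) y)
          (at 0)"
        using bounded_bilinear.has_vector_derivative[OF bounded_bilinear dx dx, of x y]
            by (simp add: one)
      moreover have "(\<lambda>t. br (\<gamma> t *v x) (\<gamma> t *v y)) = (\<lambda>t. \<gamma> t *v br x y)"
        using Aut by (auto simp: Aut_def)
      ultimately show ?thesis
        using dx[of "br x y"] by (metis add.commute vector_derivative_unique_at)
    qed
    then show "X \<in> range adj" by (rule derivation_inner)
  qed
qed

end

section \<open>Root planes, Cartan matrices and simplicity\<close>

text \<open>A root space decomposition in real form: \<open>H\<close> rotates the plane of \<open>X k\<close> and \<open>Y k\<close> with
  speed \<open>d k \<bullet> H\<close>, so that the vector \<open>d k\<close> represents the root of this plane. The element \<open>H0\<close> is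
  regular in the strong sense that the eigenvalues \<open>- (d k \<bullet> H0)\<^sup>2\<close> of \<open>(ad H0)\<^sup>2\<close> on the planes are
  distinct and not zero. Orthogonality of the planes, and with it uniqueness of the decomposition,
  follows.\<close>

locale lie_root_planes = invariant_lie_bracket br
  for br :: "'a::euclidean_space \<Rightarrow> 'a \<Rightarrow> 'a" +
  fixes T :: "'a set" and K :: "'k set" and d X Y :: "'k \<Rightarrow> 'a" and H0 :: 'a
  assumes subspace_T: "subspace T"
    and abelian: "H \<in> T \<Longrightarrow> H' \<in> T \<Longrightarrow> br H H' = 0"
    and finite_K: "finite K"
    and d_in_T: "k \<in> K \<Longrightarrow> d k \<in> T"
    and X_nonzero: "k \<in> K \<Longrightarrow> X k \<noteq> 0"
    and weight_X: "k \<in> K \<Longrightarrow> H \<in> T \<Longrightarrow> br H (X k) = - ((d k \<bullet> H) *\<^sub>R Y k)"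
    and weight_Y: "k \<in> K \<Longrightarrow> H \<in> T \<Longrightarrow> br H (Y k) = (d k \<bullet> H) *\<^sub>R X k"
    and H0_in_T: "H0 \<in> T"
    and regular: "k \<in> K \<Longrightarrow> d k \<bullet> H0 \<noteq> 0" "inj_on (\<lambda>k. (d k \<bullet> H0)\<^sup>2) K"
    and spanning: "span (T \<union> X ` K \<union> Y ` K) = UNIV"
begin

lemma T_perp: assumes "k \<in> K" "H \<in> T" shows "H \<bullet> X k = 0" "H \<bullet> Y k = 0"
proof -
  have "br H0 H = 0" using abelian assms H0_in_T by blast
  then have "(d k \<bullet> H0) * (H \<bullet> Y k) = 0" "(d k \<bullet> H0) * (H \<bullet> X k) = 0"
    using skew[of H0 H "X k"] skew[of H0 H "Y k"] weight_X[OF assms(1) H0_in_T] weight_Y[OF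
        assms(1) H0_in_T]
    by simp_all
  then show "H \<bullet> X k = 0" "H \<bullet> Y k = 0" using regular assms by simp_all
qed

lemma XY_perp: assumes k: "k \<in> K" shows "X k \<bullet> Y k = 0" and "Y k \<bullet> Y k = X k \<bullet> X k"
proof -
  have "(d k \<bullet> H0) * (X k \<bullet> Y k) = 0"
    using skew[of H0 "X k" "X k"] weight_X[OF k H0_in_T] by (simp add: inner_commute)
  then show "X k \<bullet> Y k = 0" using regular(1)[OF k] by simp
  have "(d k \<bullet> H0) * (Y k \<bullet> Y k) = (d k \<bullet> H0) * (X k \<bullet> X k)"
    using skew[of H0 "X k" "Y k"] weight_X[OF k H0_in_T] weight_Y[OF k H0_in_T] by simp
  then show "Y k \<bullet> Y k = X k \<bullet> X k" using regular(1)[OF k] by simp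
qed

lemma square_symmetric: "br H (br H u) \<bullet> v = u \<bullet> br H (br H v)"
  by (simp only: skew minus_minus)

lemma square_weight:
  assumes "k \<in> K" "H \<in> T"
  shows "br H (br H (X k)) = - ((d k \<bullet> H)\<^sup>2 *\<^sub>R X k)" "br H (br H (Y k)) = - ((d k \<bullet> H)\<^sup>2 *\<^sub>R Y k)"
  using assms by (simp_all add: weight_X weight_Y scaleR_right minus_right power2_eq_square)

text \<open>Eigenvectors of the symmetric map \<open>(ad H0)\<^sup>2\<close> for different eigenvalues are orthogonal.\<close>

lemma planes_perp:
  assumes jk: "j \<in> K" "k \<in> K" "j \<noteq> k" and u: "u \<in> {X j, Y j}" and v: "v \<in> {X k, Y k}"
  shows "u \<bullet> v = 0"
proof -
  have "br H0 (br H0 u) = - ((d j \<bullet> H0)\<^sup>2 *\<^sub>R u)" "br H0 (br H0 v) = - ((d k \<bullet> H0)\<^sup>2 *\<^sub>R v)"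
    using u v square_weight jk H0_in_T by auto
  then have "(d j \<bullet> H0)\<^sup>2 * (u \<bullet> v) = (d k \<bullet> H0)\<^sup>2 * (u \<bullet> v)"
    using square_symmetric[of H0 u v] by simp
  moreover have "(d j \<bullet> H0)\<^sup>2 \<noteq> (d k \<bullet> H0)\<^sup>2"
    using regular(2) jk by (auto dest: inj_onD)
  ultimately show ?thesis by simp
qed

lemma XX_pos: "k \<in> K \<Longrightarrow> X k \<bullet> X k > 0"
  using X_nonzero by simp

definition plane_proj :: "'k \<Rightarrow> 'a \<Rightarrow> 'a" where
  "plane_proj k z = ((z \<bullet> X k) / (X k \<bullet> X k)) *\<^sub>R X k + ((z \<bullet> Y k) / (X k \<bullet> X k)) *\<^sub>R Y k"

lemma linear_plane_proj: "linear (plane_proj k)"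
  by (rule linearI) (simp_all add: plane_proj_def inner_add_left algebra_simps add_divide_distrib)

lemma plane_proj_T: "k \<in> K \<Longrightarrow> H \<in> T \<Longrightarrow> plane_proj k H = 0"
  by (simp add: plane_proj_def T_perp)

lemma plane_proj_plane:
  assumes "j \<in> K" "k \<in> K" "u \<in> {X j, Y j}"
  shows "plane_proj k u = (if j = k then u else 0)"
proof (cases "j = k")
  case True
  then show ?thesis
    using assms XY_perp[of k] XX_pos[of k]
        by (auto simp: plane_proj_def inner_commute[of "Y k" "X k"])
next
  case False
  then have "u \<bullet> X k = 0" "u \<bullet> Y k = 0" using assms planes_perp[of j k u] by auto
  then show ?thesis using False by (simp add: plane_proj_def)
qed

text \<open>What remains of \<open>z\<close> after removing its plane components depends linearly on \<open>z\<close>, and it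
  lies in \<open>T\<close> for the vectors of the spanning set.\<close>

lemma decomposition: "z - (\<Sum>k\<in>K. plane_proj k z) \<in> T"
proof -
  let ?S = "{z. z - (\<Sum>k\<in>K. plane_proj k z) \<in> T}"
  have "subspace ?S"
  proof (rule subspaceI)
    show "0 \<in> ?S" using subspace_T by (simp add: linear_0[OF linear_plane_proj] subspace_0)
  next
    fix x y assume "x \<in> ?S" "y \<in> ?S"
    then have "(x - (\<Sum>k\<in>K. plane_proj k x)) + (y - (\<Sum>k\<in>K. plane_proj k y)) \<in> T"
      using subspace_T by (simp add: subspace_add)
    then show "x + y \<in> ?S"
      by (simp add: linear_add[OF linear_plane_proj] sum.distrib algebra_simps)
  next
    fix c x assume "x \<in> ?S"
    then have "c *\<^sub>R (x - (\<Sum>k\<in>K. plane_proj k x)) \<in> T"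
      using subspace_T by (simp add: subspace_scale)
    then show "c *\<^sub>R x \<in> ?S"
      by (simp add: linear_scale[OF linear_plane_proj] scaleR_sum_right algebra_simps)
  qed
  moreover have "T \<union> X ` K \<union> Y ` K \<subseteq> ?S"
    using finite_K subspace_0[OF subspace_T]
    by (auto simp: plane_proj_T plane_proj_plane[where j = k and u = "X k" for k]
        plane_proj_plane[where j = k and u = "Y k" for k])
  ultimately have "span (T \<union> X ` K \<union> Y ` K) \<subseteq> ?S" by (rule span_minimal[rotated])
  then show ?thesis using spanning by auto
qed

lemma in_T_I:
  assumes "\<And>k. k \<in> K \<Longrightarrow> z \<bullet> X k = 0" "\<And>k. k \<in> K \<Longrightarrow> z \<bullet> Y k = 0"
  shows "z \<in> T"
  using decomposition[of z] assms by (simp add: plane_proj_def)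

lemma bracket_coord:
  assumes "k \<in> K" "H \<in> T"
  shows "br H z \<bullet> X k = (d k \<bullet> H) * (z \<bullet> Y k)" "br H z \<bullet> Y k = - ((d k \<bullet> H) * (z \<bullet> X k))"
  using assms by (simp_all add: skew weight_X weight_Y)

lemma centralizer_T: "(\<And>H. H \<in> T \<Longrightarrow> br H z = 0) \<Longrightarrow> z \<in> T"
  using bracket_coord[OF _ H0_in_T, of _ z] H0_in_T regular(1) by (intro in_T_I) force+

lemma lie_maximal_abelian_T: "lie_maximal_abelian T UNIV br"
  unfolding lie_maximal_abelian_def using subspace_T abelian centralizer_T by blast

lemma root_vector_planes: "k \<in> K \<Longrightarrow> lie_root_vector UNIV br T (\<lambda>H. d k \<bullet> H) (X k) (Y k)"
  by (simp add: lie_root_vector_def X_nonzero weight_X weight_Y)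

lemma root_planes:
  assumes k: "k \<in> K" shows "lie_root UNIV br T (\<lambda>H. d k \<bullet> H)"
  unfolding lie_root_def
  using root_vector_planes[OF k] regular(1)[OF k] H0_in_T
      by (auto intro!: linearI simp: inner_add_right)

text \<open>Comparing the coordinates of both sides of \<open>[H, U] = - \<beta>(H) V\<close> and \<open>[H, V] = \<beta>(H) U\<close> in
  one plane gives four equations. They show that each of the four numbers \<open>U \<bullet> X k \<plusminus> V \<bullet> Y k\<close> and
  \<open>U \<bullet> Y k \<plusminus> V \<bullet> X k\<close> that is not zero forces \<open>\<beta> = d k\<close> or \<open>\<beta> = - d k\<close>, with a sign that is the
  same for all \<open>H\<close>.\<close>

lemma root_cases:
  assumes "lie_root UNIV br T \<beta>"
  obtains k where "k \<in> K" "\<And>H. H \<in> T \<Longrightarrow> \<beta> H = d k \<bullet> H"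
    | k where "k \<in> K" "\<And>H. H \<in> T \<Longrightarrow> \<beta> H = - (d k \<bullet> H)"
proof -
  obtain U V where UV: "lie_root_vector UNIV br T \<beta> U V" and nz: "\<exists>H\<in>T. \<beta> H \<noteq> 0"
    using assms by (auto simp: lie_root_def)
  have U: "br H U = - (\<beta> H *\<^sub>R V)" and V: "br H V = \<beta> H *\<^sub>R U" if "H \<in> T" for H
    using UV that by (auto simp: lie_root_vector_def)
  have "\<exists>k\<in>K. U \<bullet> X k \<noteq> 0 \<or> U \<bullet> Y k \<noteq> 0 \<or> V \<bullet> X k \<noteq> 0 \<or> V \<bullet> Y k \<noteq> 0"
  proof (rule ccontr)
    assume "\<not> ?thesis"
    then have "U \<in> T" "V \<in> T" by (auto intro!: in_T_I)
    then have "\<beta> H *\<^sub>R V = 0 \<and> \<beta> H *\<^sub>R U = 0" if "H \<in> T" for H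
      using abelian U V that by (metis neg_equal_0_iff_equal)
    then show False using nz UV by (auto simp: lie_root_vector_def)
  qed
  then obtain k where k: "k \<in> K"
    and ne: "U \<bullet> X k \<noteq> 0 \<or> U \<bullet> Y k \<noteq> 0 \<or> V \<bullet> X k \<noteq> 0 \<or> V \<bullet> Y k \<noteq> 0" by blast
  have eqs: "(d k \<bullet> H) * (U \<bullet> Y k) = - (\<beta> H * (V \<bullet> X k))" "(d k \<bullet> H) * (U \<bullet> X k) = \<beta> H * (V \<bullet> Y k)"
    "(d k \<bullet> H) * (V \<bullet> Y k) = \<beta> H * (U \<bullet> X k)" "(d k \<bullet> H) * (V \<bullet> X k) = - (\<beta> H * (U \<bullet> Y k))"
    if "H \<in> T" for H
    using bracket_coord[OF k that, of U] bracket_coord[OF k that, of V] U[OF that] V[OF that]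
        by simp_all
  have sum_eqs: "(\<beta> H - d k \<bullet> H) * (U \<bullet> X k + V \<bullet> Y k) = 0"
      "(\<beta> H + d k \<bullet> H) * (U \<bullet> X k - V \<bullet> Y k) = 0"
    "(\<beta> H - d k \<bullet> H) * (U \<bullet> Y k - V \<bullet> X k) = 0" "(\<beta> H + d k \<bullet> H) * (U \<bullet> Y k + V \<bullet> X k) = 0"
    if "H \<in> T" for H
    using eqs[OF that] by (simp_all add: algebra_simps)
  consider "U \<bullet> X k + V \<bullet> Y k \<noteq> 0 \<or> U \<bullet> Y k - V \<bullet> X k \<noteq> 0"
    | "U \<bullet> X k - V \<bullet> Y k \<noteq> 0 \<or> U \<bullet> Y k + V \<bullet> X k \<noteq> 0"
    using ne by fastforce
  then show thesis
  proof cases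
    case 1
    then show ?thesis using sum_eqs by (intro that(1)[OF k]) fastforce
  next
    case 2
    then show ?thesis using sum_eqs by (intro that(2)[OF k]) (metis add_eq_0_iff2 mult_eq_0_iff)
  qed
qed

text \<open>The bracket commutes with \<open>T\<close>, so it lies in \<open>T\<close>, and invariance gives its inner product
  with each element of \<open>T\<close>.\<close>

lemma bracket_XY:
  assumes k: "k \<in> K"
  shows "br (X k) (Y k) = - ((X k \<bullet> X k) *\<^sub>R d k)"
proof -
  let ?w = "br (X k) (Y k) + (X k \<bullet> X k) *\<^sub>R d k"
  have "br H (br (X k) (Y k)) = 0" if "H \<in> T" for H
    using derivation[of H "X k" "Y k"]
    by (simp add: weight_X weight_Y k that scaleR_left scaleR_right minus_left self)
  then have "br (X k) (Y k) \<in> T" by (rule centralizer_T)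
  then have w: "?w \<in> T" using subspace_T d_in_T[OF k] by (simp add: subspace_add subspace_scale)
  have "?w \<bullet> H = 0" if "H \<in> T" for H
  proof -
    have "br (X k) (Y k) \<bullet> H = - (X k \<bullet> br H (Y k))"
      using invariant[of "X k" "Y k" H] antisym[of H "Y k"] by simp
    then show ?thesis by (simp add: weight_Y k that inner_add_left)
  qed
  from this[OF w] have "?w = 0" by simp
  then show ?thesis by (simp add: eq_neg_iff_add_eq_0)
qed

lemma coroot_planes:
  assumes k: "k \<in> K"
  shows "lie_coroot UNIV br T (\<lambda>H. d k \<bullet> H) ((2 / (d k \<bullet> d k)) *\<^sub>R d k)"
proof -
  have "d k \<noteq> 0" using regular(1)[OF k] by auto
  then have two: "d k \<bullet> ((2 / (d k \<bullet> d k)) *\<^sub>R d k) = 2" by simp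
  have "(2 / (d k \<bullet> d k)) *\<^sub>R d k = (- 2 / ((d k \<bullet> d k) * (X k \<bullet> X k))) *\<^sub>R br (X k) (Y k)"
    using X_nonzero[OF k] by (simp add: bracket_XY[OF k])
  then show ?thesis
    unfolding lie_coroot_def
    using two root_vector_planes[OF k] subspace_scale[OF subspace_T d_in_T[OF k]] by blast
qed

end

text \<open>The roots \<open>d (b i)\<close> form a base. The last assumption says that the Dynkin diagram of \<open>C\<close>
  is connected: a nonempty set of nodes that contains all neighbours of its elements is the whole
  diagram.\<close>

locale lie_root_planes_base = lie_root_planes br T K d X Y H0
  for br :: "'a::euclidean_space \<Rightarrow> 'a \<Rightarrow> 'a" and T and K :: "'k set" and d X Y H0 +
  fixes n :: nat and b :: "nat \<Rightarrow> 'k" and C :: "nat \<Rightarrow> nat \<Rightarrow> int"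
  assumes b_in_K: "i \<in> {1..n} \<Longrightarrow> b i \<in> K"
    and n_pos: "n \<ge> 1"
    and base_span: "T \<subseteq> span ((\<lambda>i. d (b i)) ` {1..n})"
    and base_indep: "(\<Sum>i=1..n. c i *\<^sub>R d (b i)) = 0 \<Longrightarrow> i \<in> {1..n} \<Longrightarrow> c i = 0"
    and base_comb: "k \<in> K \<Longrightarrow> \<exists>m :: nat \<Rightarrow> nat.
        d k = (\<Sum>i=1..n. real (m i) *\<^sub>R d (b i)) \<or> d k = - (\<Sum>i=1..n. real (m i) *\<^sub>R d (b i))"
    and cartan: "i \<in> {1..n} \<Longrightarrow> j \<in> {1..n} \<Longrightarrow> 2 * (d (b j) \<bullet> d (b i)) / (d (b i) \<bullet> d (b i)) = C i j"
    and connected: "J \<subseteq> {1..n} \<Longrightarrow> J \<noteq> {} \<Longrightarrow> (\<And>i j. i \<in> J \<Longrightarrow> j \<in> {1..n} \<Longrightarrow> C i j \<noteq> 0 \<Longrightarrow> j \<in> J)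
        \<Longrightarrow> J = {1..n}"
begin

lemma perp_base_zero:
  assumes "H \<in> T" "\<And>i. i \<in> {1..n} \<Longrightarrow> d (b i) \<bullet> H = 0" shows "H = 0"
proof -
  have "H \<in> span ((\<lambda>i. d (b i)) ` {1..n})" using assms base_span by auto
  then have "orthogonal H H"
    using assms(2) by (elim orthogonal_to_span) (auto simp: orthogonal_def inner_commute)
  then show ?thesis by (simp add: orthogonal_def)
qed

lemma root_base: "lie_root_base UNIV br T n (\<lambda>i H. d (b i) \<bullet> H)"
  unfolding lie_root_base_def
proof (intro conjI ballI allI impI)
  fix i assume "i \<in> {1..n}"
  then show "lie_root UNIV br T (\<lambda>H. d (b i) \<bullet> H)" by (intro root_planes b_in_K)
next
  fix c :: "nat \<Rightarrow> real" and i
  assume *: "\<forall>H\<in>T. (\<Sum>i=1..n. c i * (d (b i) \<bullet> H)) = 0" and i: "i \<in> {1..n}"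
  let ?w = "\<Sum>i=1..n. c i *\<^sub>R d (b i)"
  have "?w \<in> T" using d_in_T b_in_K subspace_T by (intro subspace_sum subspace_scale) auto
  moreover have "?w \<bullet> H = (\<Sum>i=1..n. c i * (d (b i) \<bullet> H))" for H
    by (simp add: inner_sum_left)
  ultimately have "?w \<bullet> ?w = 0" using * by metis
  then have "?w = 0" by (simp only: inner_eq_zero_iff)
  then show "c i = 0" using base_indep i by simp
next
  fix \<beta> assume "lie_root UNIV br T \<beta>"
  then obtain k where k: "k \<in> K" and or: "(\<forall>H\<in>T. \<beta> H = d k \<bullet> H) \<or> (\<forall>H\<in>T. \<beta> H = - (d k \<bullet> H))"
    by (elim root_cases) blast+
  obtain m :: "nat \<Rightarrow> nat" where "d k = (\<Sum>i=1..n. real (m i) *\<^sub>R d (b i)) \<or> d k = - (\<Sum>i=1..n. real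
      (m i) *\<^sub>R d (b i))"
    using base_comb[OF k] by blast
  then have "(\<forall>H. d k \<bullet> H = (\<Sum>i=1..n. real (m i) * (d (b i) \<bullet> H))) \<or>
      (\<forall>H. d k \<bullet> H = - (\<Sum>i=1..n. real (m i) * (d (b i) \<bullet> H)))"
    by (auto simp: inner_sum_left)
  then show "\<exists>m :: nat \<Rightarrow> nat. (\<forall>H\<in>T. \<beta> H = (\<Sum>i=1..n. real (m i) * (d (b i) \<bullet> H))) \<or>
      (\<forall>H\<in>T. \<beta> H = - (\<Sum>i=1..n. real (m i) * (d (b i) \<bullet> H)))"
    using or by (intro exI[of _ m]) auto
qed

lemma has_cartan_matrix: "lie_has_cartan_matrix UNIV br n C"
  unfolding lie_has_cartan_matrix_def
  by (intro exI[of _ T] exI[of _ "\<lambda>i H. d (b i) \<bullet> H"]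
      exI[of _ "\<lambda>i. (2 / (d (b i) \<bullet> d (b i))) *\<^sub>R d (b i)"] conjI ballI
      lie_maximal_abelian_T root_base coroot_planes b_in_K)
    (use cartan in auto)

lemma centerless:
  assumes "\<And>y. br x y = 0" shows "x = 0"
proof (rule perp_base_zero)
  have "br H x = 0" for H using assms antisym[of H x] by simp
  then show "x \<in> T" by (intro centralizer_T)
  fix i assume "i \<in> {1..n}"
  then have "b i \<in> K" by (rule b_in_K)
  then show "d (b i) \<bullet> x = 0" using assms weight_Y[OF _ \<open>x \<in> T\<close>] X_nonzero by fastforce
qed

text \<open>Among the elements of a nonzero ideal that have a component in some plane, one with the
  least number of such components has only one, since \<open>(ad H0)\<^sup>2\<close> separates the planes. Applying
  \<open>(ad H0)\<^sup>2\<close> once more yields a nonzero vector of a single plane \<open>k\<close> in the ideal. Bracketing it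
  with its image under the quarter turn of the plane gives \<open>d k\<close>. An element of \<open>T\<close> in the ideal
  brings in every plane that it rotates, so the roots in the ideal spread along nonorthogonal
  pairs: first to the base, as no root is orthogonal to all simple roots, then along the Dynkin
  diagram. A base spans \<open>T\<close>, and the regular element finally brings in all planes.\<close>

lemma simple: "lie_simple UNIV br"
  unfolding lie_simple_def
proof (intro conjI allI impI)
  have b1: "b 1 \<in> K" using b_in_K n_pos by auto
  have "br H0 (Y (b 1)) \<noteq> 0" using weight_Y[OF b1 H0_in_T] regular(1)[OF b1] X_nonzero[OF b1]
      by simp
  then show "\<exists>X\<in>UNIV. \<exists>Y\<in>UNIV. br X Y \<noteq> 0" by blast
next
  fix I assume "lie_ideal I UNIV br"
  then have I: "subspace I" and ideal: "\<And>x y. y \<in> I \<Longrightarrow> br x y \<in> I" by (auto simp: lie_ideal_def)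
  have ideal': "br x y \<in> I" if "x \<in> I" for x y
    using ideal[OF that, of y] antisym[of x y] I by (simp add: subspace_neg)
  \<comment> \<open>A nonzero vector \<open>u\<close> of plane \<open>k\<close> in \<open>I\<close> brings in \<open>d k\<close>: the vector \<open>x Y - y X\<close> is \<open>u\<close>
      turned by a right angle.\<close>
  have d_I: "d k \<in> I" if "k \<in> K" "u \<in> I" "u = x *\<^sub>R X k + y *\<^sub>R Y k" "u \<noteq> 0" for k u x y
  proof -
    define s where "s = x\<^sup>2 + y\<^sup>2"
    have nz: "s \<noteq> 0" using that by (auto simp: s_def)
    have "br u (x *\<^sub>R Y k - y *\<^sub>R X k) \<in> I" by (rule ideal'[OF that(2)])
    also have "br u (x *\<^sub>R Y k - y *\<^sub>R X k) = s *\<^sub>R br (X k) (Y k)"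
      using antisym[of "X k" "Y k"]
      by (simp add: that(3) add_left diff_right scaleR_left scaleR_right self s_def
          power2_eq_square algebra_simps)
    finally have "(1 / s) *\<^sub>R (s *\<^sub>R br (X k) (Y k)) \<in> I" by (rule subspace_scale[OF I])
    then have "br (X k) (Y k) \<in> I" using nz by simp
    then have "(- 1 / (X k \<bullet> X k)) *\<^sub>R br (X k) (Y k) \<in> I" by (rule subspace_scale[OF I])
    then show ?thesis using X_nonzero[OF that(1)] by (simp add: bracket_XY[OF that(1)])
  qed
  have XY_I: "X k \<in> I \<and> Y k \<in> I" if k: "k \<in> K" and h: "h \<in> I" "h \<in> T" "d k \<bullet> h \<noteq> 0" for k h
  proof -
    have "(1 / (d k \<bullet> h)) *\<^sub>R br h (Y k) \<in> I" "(- 1 / (d k \<bullet> h)) *\<^sub>R br h (X k) \<in> I"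
      using ideal'[OF h(1)] by (auto intro!: subspace_scale[OF I] simp del: scaleR_minus_left)
    then show ?thesis using h by (simp add: weight_X[OF k] weight_Y[OF k])
  qed
  have next_I: "d l \<in> I" if "k \<in> K" "l \<in> K" "d k \<in> I" "d l \<bullet> d k \<noteq> 0" for k l
    using d_I[of l "X l" 1 0] XY_I[of l "d k"] that d_in_T X_nonzero by simp
  define J where "J = {i \<in> {1..n}. d (b i) \<in> I}"
  have d_nonperp: "\<exists>i\<in>{1..n}. d (b i) \<bullet> d k \<noteq> 0" if "k \<in> K" for k
    using perp_base_zero[OF d_in_T[OF that]] regular(1)[OF that] by (metis inner_zero_left)
  show "I = {0} \<or> I = UNIV"
  proof (cases "\<exists>k\<in>K. d k \<in> I")
    case True
    then obtain k where k: "k \<in> K" "d k \<in> I" by blast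
    obtain i where i: "i \<in> {1..n}" "d (b i) \<bullet> d k \<noteq> 0" using d_nonperp k by blast
    have "J = {1..n}"
    proof (rule connected)
      show "J \<noteq> {}" using next_I[OF k(1) b_in_K k(2)] i unfolding J_def by blast
    next
      fix i j assume ij: "i \<in> J" "j \<in> {1..n}" "C i j \<noteq> 0"
      then have "d (b j) \<bullet> d (b i) \<noteq> 0" using cartan[of i j] by (auto simp: J_def)
      then show "j \<in> J" using ij next_I[OF b_in_K[of i] b_in_K[of j]] unfolding J_def by blast
    qed (auto simp: J_def)
    then have base_I: "d (b i) \<in> I" if "i \<in> {1..n}" for i using that unfolding J_def by blast
    have "T \<subseteq> I"
      using base_span span_minimal[of "(\<lambda>i. d (b i)) ` {1..n}" I] base_I I by blast
    moreover have "X k \<in> I \<and> Y k \<in> I" if "k \<in> K" for k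
      using XY_I[of k H0] that H0_in_T regular(1) \<open>T \<subseteq> I\<close> by blast
    ultimately have "span (T \<union> X ` K \<union> Y ` K) \<subseteq> I" using I by (intro span_minimal) auto
    then show ?thesis using spanning by auto
  next
    case False
    define supp where "supp z = {k \<in> K. plane_proj k z \<noteq> 0}" for z
    have proj_br: "plane_proj k (br H0 (br H0 z)) = - ((d k \<bullet> H0)\<^sup>2 *\<^sub>R plane_proj k z)"
        if "k \<in> K" for k z
      using that H0_in_T by (simp add: plane_proj_def bracket_coord power2_eq_square algebra_simps)
    have fin: "finite (supp z)" for z using finite_K by (simp add: supp_def)
    have "I \<subseteq> {0}"
    proof (rule ccontr)
      assume "\<not> I \<subseteq> {0}"
      then obtain z where z: "z \<in> I" "z \<noteq> 0" by auto
      have "\<exists>z\<in>I. supp z \<noteq> {}"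
      proof (cases "supp z = {}")
        case True
        then have "z \<in> T" using decomposition[of z] by (simp add: supp_def)
        obtain i where "i \<in> {1..n}" "d (b i) \<bullet> z \<noteq> 0" using perp_base_zero[OF \<open>z \<in> T\<close>] z by blast
        then have "X (b i) \<in> I" "b i \<in> K" using XY_I[of "b i" z] b_in_K z \<open>z \<in> T\<close> by auto
        moreover have "plane_proj (b i) (X (b i)) \<noteq> 0"
          using plane_proj_plane[of "b i" "b i" "X (b i)"] X_nonzero \<open>b i \<in> K\<close> by simp
        ultimately show ?thesis by (auto simp: supp_def)
      qed (use z in auto)
      then obtain z where z: "z \<in> I" "supp z \<noteq> {}"
        and min: "\<And>y. y \<in> I \<Longrightarrow> supp y \<noteq> {} \<Longrightarrow> card (supp z) \<le> card (supp y)"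
        using ex_has_least_nat[of "\<lambda>z. z \<in> I \<and> supp z \<noteq> {}" _ "\<lambda>z. card (supp z)"]
            by (metis (no_types, lifting))
      obtain k where k: "k \<in> supp z" using z by blast
      have "supp z = {k}"
      proof (rule ccontr)
        assume "supp z \<noteq> {k}"
        then obtain j where j: "j \<in> supp z" "j \<noteq> k" using k by blast
        \<comment> \<open>This combination kills the component in plane \<open>j\<close> and multiplies the one in
            plane \<open>k\<close> by a nonzero number.\<close>
        let ?y = "br H0 (br H0 z) + (d j \<bullet> H0)\<^sup>2 *\<^sub>R z"
        have y: "?y \<in> I" using z ideal I by (intro subspace_add subspace_scale) auto
        have py: "plane_proj l ?y = ((d j \<bullet> H0)\<^sup>2 - (d l \<bullet> H0)\<^sup>2) *\<^sub>R plane_proj l z" if "l \<in> K" for l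
          by (simp add: linear_add[OF linear_plane_proj] linear_scale[OF linear_plane_proj]
              proj_br[OF that] algebra_simps)
        have jk: "j \<in> K" "k \<in> K" using j k by (auto simp: supp_def)
        have "(d j \<bullet> H0)\<^sup>2 \<noteq> (d k \<bullet> H0)\<^sup>2" using regular(2) jk j by (auto dest: inj_onD)
        then have "k \<in> supp ?y" using k jk py[of k] by (simp add: supp_def)
        moreover have "supp ?y \<subset> supp z"
        proof
          show "supp ?y \<subseteq> supp z" using py by (auto simp: supp_def)
          show "supp ?y \<noteq> supp z" using j jk py[of j] by (auto simp: supp_def)
        qed
        then have "card (supp ?y) < card (supp z)" by (rule psubset_card_mono[OF fin])
        ultimately show False using min[OF y] by auto
      qed
      let ?u = "br H0 (br H0 z)"
      have kK: "k \<in> K" using k by (auto simp: supp_def)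
      have "plane_proj l ?u = 0" if "l \<in> K" "l \<noteq> k" for l
        using proj_br[OF that(1)] \<open>supp z = {k}\<close> that by (auto simp: supp_def)
      then have sum: "(\<Sum>l\<in>K. plane_proj l ?u) = plane_proj k ?u"
        using kK finite_K by (subst sum.remove[of K k]) auto
      define w where "w = ?u - plane_proj k ?u"
      have w: "w \<in> T" using decomposition[of ?u] by (simp add: w_def sum)
      \<comment> \<open>The image of \<open>ad H0\<close> is orthogonal to \<open>T\<close>, so \<open>?u\<close> has no component in \<open>T\<close>.\<close>
      have "?u \<bullet> w = 0" using skew[of H0 "br H0 z" w] abelian[OF H0_in_T w] by simp
      moreover have "plane_proj k ?u \<bullet> w = 0"
        using T_perp[OF kK w] by (simp add: plane_proj_def inner_add_right inner_commute[of _ w])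
      ultimately have "w \<bullet> w = 0" by (simp add: w_def inner_diff_left)
      then have u: "?u = plane_proj k ?u" by (simp add: w_def)
      moreover have "plane_proj k ?u \<noteq> 0"
        using k kK proj_br[OF kK] regular(1)[OF kK] by (simp add: supp_def)
      moreover have "?u \<in> I" using z ideal by blast
      ultimately have "d k \<in> I"
        using d_I[OF kK, of ?u] unfolding plane_proj_def[of k ?u] by metis
      then show False using False kK by blast
    qed
    then show ?thesis using subspace_0[OF I] by blast
  qed
qed

end

section \<open>Transport of root data to the adjoint group\<close>

locale lie_embedding =
  fixes f :: "'a::real_vector \<Rightarrow> 'b::real_vector" and br :: "'a \<Rightarrow> 'a \<Rightarrow> 'a" and br' :: "'b \<Rightarrow> 'b \<Rightarrow> 'b"
  assumes linear: "linear f" and inj: "inj f"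
    and hom: "f (br x y) = br' (f x) (f y)"
begin

lemma lie_simple_image:
  assumes "lie_simple UNIV br" shows "lie_simple (range f) br'"
  unfolding lie_simple_def
proof (intro conjI allI impI)
  obtain X Y where "br X Y \<noteq> 0" using assms by (auto simp: lie_simple_def)
  then have "br' (f X) (f Y) \<noteq> 0" using hom inj linear by (metis injD linear_0)
  then show "\<exists>X\<in>range f. \<exists>Y\<in>range f. br' X Y \<noteq> 0" by blast
next
  fix I assume I: "lie_ideal I (range f) br'"
  have "lie_ideal (f -` I) UNIV br"
    using I linear by (auto simp: lie_ideal_def hom intro!: linear_subspace_vimage)
  then have "f -` I = {0} \<or> f -` I = UNIV" using assms by (auto simp: lie_simple_def)
  moreover have "I = f ` (f -` I)" using I by (auto simp: lie_ideal_def)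
  ultimately show "I = {0} \<or> I = range f" using linear_0[OF linear]
      by (metis image_empty image_insert)
qed

lemma lie_root_vector_image:
  "lie_root_vector (range f) br' (f ` T) \<alpha> (f X) (f Y) \<longleftrightarrow> lie_root_vector UNIV br T (\<alpha> \<circ> f) X Y"
  unfolding lie_root_vector_def
  by (auto simp: hom [symmetric] linear_scale[OF linear, symmetric] linear_neg[OF linear, symmetric]
      inj_eq[OF inj] linear_0[OF linear, symmetric] simp del: linear_0)

text \<open>Linear forms on the source are turned into linear forms on the target by a linear left
  inverse \<open>g\<close> of \<open>f\<close>.\<close>

lemma has_cartan_matrix_image:
  assumes "lie_has_cartan_matrix UNIV br n C"
  shows "lie_has_cartan_matrix (range f) br' n C"
proof -
  obtain T \<alpha> h where max: "lie_maximal_abelian T UNIV br" and base: "lie_root_base UNIV br T n \<alpha>"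
    and coroot: "\<forall>i\<in>{1..n}. lie_coroot UNIV br T (\<alpha> i) (h i)"
    and C: "\<forall>i\<in>{1..n}. \<forall>j\<in>{1..n}. \<alpha> j (h i) = of_int (C i j)"
    using assms unfolding lie_has_cartan_matrix_def by blast
  obtain g where g: "linear g" "g \<circ> f = id"
    using linear_injective_left_inverse[OF linear inj] by blast
  have gf: "g (f x) = x" for x using g(2) by (metis comp_apply id_apply)
  have comp: "(\<lambda>y. \<alpha> i (g y)) \<circ> f = \<alpha> i" for i by (auto simp: gf)
  have root: "lie_root (range f) br' (f ` T) \<beta> \<longleftrightarrow> lie_root UNIV br T (\<beta> \<circ> f)" if "linear \<beta>" for \<beta>
  proof -
    have "(\<exists>X Y. lie_root_vector (range f) br' (f ` T) \<beta> X Y) \<longleftrightarrow>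
        (\<exists>X Y. lie_root_vector (range f) br' (f ` T) \<beta> (f X) (f Y))"
    proof (intro iffI; elim exE)
      fix X Y assume *: "lie_root_vector (range f) br' (f ` T) \<beta> X Y"
      then obtain X' Y' where "X = f X'" "Y = f Y'" unfolding lie_root_vector_def by blast
      then show "\<exists>X Y. lie_root_vector (range f) br' (f ` T) \<beta> (f X) (f Y)" using * by blast
    qed blast
    then show ?thesis
      using that linear_compose[OF linear that] by (simp add: lie_root_def lie_root_vector_image)
  qed
  show ?thesis
    unfolding lie_has_cartan_matrix_def
  proof (intro exI[of _ "f ` T"] exI[of _ "\<lambda>i y. \<alpha> i (g y)"] exI[of _ "\<lambda>i. f (h i)"] conjI ballI)
    show "lie_maximal_abelian (f ` T) (range f) br'"
    proof -
      have zero: "f x = 0 \<longleftrightarrow> x = 0" for x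
        using inj_eq[OF inj, of x 0] by (simp add: linear_0[OF linear])
      have sub: "subspace T" and ab: "\<And>H K. H \<in> T \<Longrightarrow> K \<in> T \<Longrightarrow> br H K = 0"
        and cent: "\<And>X. (\<And>H. H \<in> T \<Longrightarrow> br H X = 0) \<Longrightarrow> X \<in> T"
        using max unfolding lie_maximal_abelian_def by blast+
      show ?thesis
        unfolding lie_maximal_abelian_def
      proof (intro conjI ballI impI)
        show "subspace (f ` T)"
          using sub by (rule linear_subspace_image[OF linear])
        show "f ` T \<subseteq> range f" by blast
        fix H K assume "H \<in> f ` T" "K \<in> f ` T"
        then show "br' H K = 0" using ab linear_0[OF linear] hom by (metis imageE)
      next
        fix X assume "X \<in> range f" and X: "\<forall>H\<in>f ` T. br' H X = 0"
        then obtain x where x: "X = f x" by blast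
        have "br H x = 0" if "H \<in> T" for H using X that zero hom x by (metis imageI)
        then show "X \<in> f ` T" using cent x by blast
      qed
    qed
    have lin: "linear (\<alpha> i)" if "i \<in> {1..n}" for i
      using base that by (auto simp: lie_root_base_def lie_root_def)
    have lin': "linear (\<lambda>y. \<alpha> i (g y))" if "i \<in> {1..n}" for i
      using linear_compose[OF g(1) lin[OF that]] by (simp add: o_def)
    show "lie_root_base (range f) br' (f ` T) n (\<lambda>i y. \<alpha> i (g y))"
      unfolding lie_root_base_def
    proof (intro conjI ballI allI impI)
      fix i assume "i \<in> {1..n}"
      then show "lie_root (range f) br' (f ` T) (\<lambda>y. \<alpha> i (g y))"
        using root[OF lin'] base by (auto simp: comp lie_root_base_def)
    next
      fix c i assume "\<forall>H\<in>f ` T. (\<Sum>i = 1..n. c i * \<alpha> i (g H)) = 0" "i \<in> {1..n}"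
      then show "c i = 0" using base by (auto simp: lie_root_base_def gf)
    next
      fix \<beta> assume "lie_root (range f) br' (f ` T) \<beta>"
      then have "lie_root UNIV br T (\<beta> \<circ> f)" using root[of \<beta>] unfolding lie_root_def by blast
      then obtain m :: "nat \<Rightarrow> nat" where "(\<forall>H\<in>T. (\<beta> \<circ> f) H = (\<Sum>i=1..n. real (m i) * \<alpha> i H)) \<or>
           (\<forall>H\<in>T. (\<beta> \<circ> f) H = - (\<Sum>i=1..n. real (m i) * \<alpha> i H))"
        using base unfolding lie_root_base_def by blast
      then show "\<exists>m :: nat \<Rightarrow> nat. (\<forall>H\<in>f ` T. \<beta> H = (\<Sum>i=1..n. real (m i) * \<alpha> i (g H))) \<or>
           (\<forall>H\<in>f ` T. \<beta> H = - (\<Sum>i=1..n. real (m i) * \<alpha> i (g H)))"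
        by (intro exI[of _ m]) (auto simp: gf)
    qed
    fix i assume i: "i \<in> {1..n}"
    obtain X Y c where *: "lie_root_vector UNIV br T (\<alpha> i) X Y" "h i = c *\<^sub>R br X Y" "h i \<in> T"
        "\<alpha> i (h i) = 2"
      using coroot i unfolding lie_coroot_def by blast
    have "lie_root_vector (range f) br' (f ` T) (\<lambda>y. \<alpha> i (g y)) (f X) (f Y)"
      using *(1) by (simp add: lie_root_vector_image comp)
    moreover have "f (h i) = c *\<^sub>R br' (f X) (f Y)"
      using *(2) by (simp add: hom linear_scale[OF linear])
    ultimately show "lie_coroot (range f) br' (f ` T) (\<lambda>y. \<alpha> i (g y)) (f (h i))"
      unfolding lie_coroot_def using *(3,4) gf imageI by metis
  next
    fix i j assume "i \<in> {1..n}" "j \<in> {1..n}"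
    then show "\<alpha> j (g (f (h i))) = of_int (C i j)" using C by (simp add: gf)
  qed
qed

end

lemma compact_group_of_root_planes:
  fixes br :: "real ^ 'n \<Rightarrow> real ^ 'n \<Rightarrow> real ^ 'n"
  assumes "lie_root_planes_base br T K d X Y H0 n b C"
  shows "\<exists>(G :: (real ^ 'n ^ 'n) set) f. compact_simple_lie_group G \<and>
     lie_has_cartan_matrix (lie_algebra_of G) mat_bracket n C \<and>
     lie_iso f UNIV br (lie_algebra_of G) mat_bracket"
proof -
  interpret lie_root_planes_base br T K d X Y H0 n b C by (rule assms)
  interpret centerless_lie_bracket br by standard (rule centerless)
  interpret embed: lie_embedding adj br mat_bracket
    by (rule lie_embedding.intro) (rule linear_adj inj_adj adj_bracket)+
  have "lie_iso adj UNIV br (range adj) mat_bracket"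
    unfolding lie_iso_def using inj_adj
    by (auto simp: bij_betw_def adj_bracket linear_add[OF linear_adj] linear_scale[OF linear_adj])
  then show ?thesis
    using matrix_group_Aut0 compact_Aut0 connected_Aut0 embed.lie_simple_image[OF simple]
      embed.has_cartan_matrix_image[OF has_cartan_matrix]
    unfolding compact_simple_lie_group_def lie_algebra_of_Aut0[symmetric] by blast
qed

lemma lie_iso_trans:
  assumes "lie_iso f L br L' br'" "lie_iso g L' br' L'' br''"
    and "subspace L" "\<And>X Y. X \<in> L \<Longrightarrow> Y \<in> L \<Longrightarrow> br X Y \<in> L"
  shows "lie_iso (g \<circ> f) L br L'' br''"
proof -
  have "f X \<in> L'" if "X \<in> L" for X using assms(1) that by (auto simp: lie_iso_def bij_betw_def)
  then show ?thesis
    using assms by (auto simp: lie_iso_def intro: bij_betw_trans)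
qed

section \<open>The octonions as a composition algebra\<close>

lemma exhaust_8:
  fixes x :: 8
  shows "x = 0 \<or> x = 1 \<or> x = 2 \<or> x = 3 \<or> x = 4 \<or> x = 5 \<or> x = 6 \<or> x = 7"
proof (induct x)
  case (of_int z)
  then have "z \<in> {0..<8}" by simp
  then have "z = 0 \<or> z = 1 \<or> z = 2 \<or> z = 3 \<or> z = 4 \<or> z = 5 \<or> z = 6 \<or> z = 7" by auto
  then show ?case by auto
qed

lemma UNIV_8: "UNIV = {0, 1, 2, 3, 4, 5, 6, 7 :: 8}"
  using exhaust_8 by auto

lemma forall_8: "(\<forall>i :: 8. P i) \<longleftrightarrow> P 0 \<and> P 1 \<and> P 2 \<and> P 3 \<and> P 4 \<and> P 5 \<and> P 6 \<and> P 7"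
  by (metis exhaust_8)

lemma sum_8: "sum f (UNIV :: 8 set) = f 0 + f 1 + f 2 + f 3 + f 4 + f 5 + f 6 + f 7"
  unfolding UNIV_8 by (simp add: ac_simps)

text \<open>Spelled out so that the multiplication table can be evaluated by rewriting alone.\<close>

lemma neq_8:
  "(0 :: 8) \<noteq> 1" "(0 :: 8) \<noteq> 2" "(0 :: 8) \<noteq> 3" "(0 :: 8) \<noteq> 4" "(0 :: 8) \<noteq> 5" "(0 :: 8) \<noteq> 6"
      "(0 :: 8) \<noteq> 7"
  "(1 :: 8) \<noteq> 0" "(1 :: 8) \<noteq> 2" "(1 :: 8) \<noteq> 3" "(1 :: 8) \<noteq> 4" "(1 :: 8) \<noteq> 5" "(1 :: 8) \<noteq> 6"
      "(1 :: 8) \<noteq> 7"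
  "(2 :: 8) \<noteq> 0" "(2 :: 8) \<noteq> 1" "(2 :: 8) \<noteq> 3" "(2 :: 8) \<noteq> 4" "(2 :: 8) \<noteq> 5" "(2 :: 8) \<noteq> 6"
      "(2 :: 8) \<noteq> 7"
  "(3 :: 8) \<noteq> 0" "(3 :: 8) \<noteq> 1" "(3 :: 8) \<noteq> 2" "(3 :: 8) \<noteq> 4" "(3 :: 8) \<noteq> 5" "(3 :: 8) \<noteq> 6"
      "(3 :: 8) \<noteq> 7"
  "(4 :: 8) \<noteq> 0" "(4 :: 8) \<noteq> 1" "(4 :: 8) \<noteq> 2" "(4 :: 8) \<noteq> 3" "(4 :: 8) \<noteq> 5" "(4 :: 8) \<noteq> 6"
      "(4 :: 8) \<noteq> 7"
  "(5 :: 8) \<noteq> 0" "(5 :: 8) \<noteq> 1" "(5 :: 8) \<noteq> 2" "(5 :: 8) \<noteq> 3" "(5 :: 8) \<noteq> 4" "(5 :: 8) \<noteq> 6"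
      "(5 :: 8) \<noteq> 7"
  "(6 :: 8) \<noteq> 0" "(6 :: 8) \<noteq> 1" "(6 :: 8) \<noteq> 2" "(6 :: 8) \<noteq> 3" "(6 :: 8) \<noteq> 4" "(6 :: 8) \<noteq> 5"
      "(6 :: 8) \<noteq> 7"
  "(7 :: 8) \<noteq> 0" "(7 :: 8) \<noteq> 1" "(7 :: 8) \<noteq> 2" "(7 :: 8) \<noteq> 3" "(7 :: 8) \<noteq> 4" "(7 :: 8) \<noteq> 5"
      "(7 :: 8) \<noteq> 6"
  by simp_all

text \<open>The multiplication table in coordinates, by which the composition law below becomes an
  identity of polynomials in the coordinates.\<close>

lemma oct_mult_nth:
  "oct_mult x y $ 0 = x $ 0 * y $ 0 - x $ 1 * y $ 1 - x $ 2 * y $ 2 - x $ 3 * y $ 3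
      - x $ 4 * y $ 4 - x $ 5 * y $ 5 - x $ 6 * y $ 6 - x $ 7 * y $ 7"
  "oct_mult x y $ 1 = x $ 0 * y $ 1 + x $ 1 * y $ 0 + x $ 2 * y $ 3 - x $ 3 * y $ 2
      + x $ 4 * y $ 5 - x $ 5 * y $ 4 - x $ 6 * y $ 7 + x $ 7 * y $ 6"
  "oct_mult x y $ 2 = x $ 0 * y $ 2 - x $ 1 * y $ 3 + x $ 2 * y $ 0 + x $ 3 * y $ 1
      + x $ 4 * y $ 6 + x $ 5 * y $ 7 - x $ 6 * y $ 4 - x $ 7 * y $ 5"
  "oct_mult x y $ 3 = x $ 0 * y $ 3 + x $ 1 * y $ 2 - x $ 2 * y $ 1 + x $ 3 * y $ 0
      + x $ 4 * y $ 7 - x $ 5 * y $ 6 + x $ 6 * y $ 5 - x $ 7 * y $ 4"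
  "oct_mult x y $ 4 = x $ 0 * y $ 4 - x $ 1 * y $ 5 - x $ 2 * y $ 6 - x $ 3 * y $ 7
      + x $ 4 * y $ 0 + x $ 5 * y $ 1 + x $ 6 * y $ 2 + x $ 7 * y $ 3"
  "oct_mult x y $ 5 = x $ 0 * y $ 5 + x $ 1 * y $ 4 - x $ 2 * y $ 7 + x $ 3 * y $ 6
      - x $ 4 * y $ 1 + x $ 5 * y $ 0 - x $ 6 * y $ 3 + x $ 7 * y $ 2"
  "oct_mult x y $ 6 = x $ 0 * y $ 6 + x $ 1 * y $ 7 + x $ 2 * y $ 4 - x $ 3 * y $ 5
      - x $ 4 * y $ 2 + x $ 5 * y $ 3 + x $ 6 * y $ 0 - x $ 7 * y $ 1"
  "oct_mult x y $ 7 = x $ 0 * y $ 7 - x $ 1 * y $ 6 + x $ 2 * y $ 5 + x $ 3 * y $ 4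
      - x $ 4 * y $ 3 - x $ 5 * y $ 2 + x $ 6 * y $ 1 + x $ 7 * y $ 0"
  by (simp_all only: oct_mult_def vec_lambda_beta sum_8 oct_coeff_def oct_cycle_def
      oct_triples_def neq_8
      insert_iff prod.inject empty_iff simp_thms if_True if_False)

lemma vec_eq_8: "(x :: 'a ^ 8) = y \<longleftrightarrow> x $ 0 = y $ 0 \<and> x $ 1 = y $ 1 \<and> x $ 2 = y $ 2 \<and> x $ 3 = y $ 3
    \<and> x $ 4 = y $ 4 \<and> x $ 5 = y $ 5 \<and> x $ 6 = y $ 6 \<and> x $ 7 = y $ 7"
  by (simp add: vec_eq_iff forall_8)

lemma inner_8: "(x :: real ^ 8) \<bullet> y = x $ 0 * y $ 0 + x $ 1 * y $ 1 + x $ 2 * y $ 2 + x $ 3 * y $ 3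
    + x $ 4 * y $ 4 + x $ 5 * y $ 5 + x $ 6 * y $ 6 + x $ 7 * y $ 7"
  by (simp add: inner_vec_def sum_8)

lemma oct_cnj_nth: "oct_cnj x $ i = (if i = 0 then x $ i else - x $ i)"
  by (simp add: oct_cnj_def)

lemma bounded_bilinear_oct_mult: "bounded_bilinear oct_mult"
  by (auto intro!: bounded_bilinear_linearI linearI
      simp: oct_mult_def vec_eq_iff sum_distrib_left sum.distrib algebra_simps)

lemmas oct_mult_linear = bilinear_rules [OF bounded_bilinear_oct_mult]

lemma linear_oct_cnj: "linear oct_cnj"
  by (rule linearI) (simp_all add: oct_cnj_def vec_eq_iff)

lemmas oct_cnj_linear = linear_rules [OF linear_oct_cnj]

lemma oct_cnj_cnj [simp]: "oct_cnj (oct_cnj x) = x"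
  by (simp add: oct_cnj_def vec_eq_iff)

lemma oct_cnj_inner: "oct_cnj x \<bullet> y = x \<bullet> oct_cnj y"
  by (simp add: inner_8 oct_cnj_nth)

lemma oct_cnj_mult: "oct_cnj (oct_mult x y) = oct_mult (oct_cnj y) (oct_cnj x)"
  by (simp add: vec_eq_8 oct_cnj_nth oct_mult_nth)

lemma oct_left_adjoint: "oct_mult a x \<bullet> y = x \<bullet> oct_mult (oct_cnj a) y"
  by (simp add: inner_8 oct_cnj_nth oct_mult_nth algebra_simps)

lemma oct_right_adjoint: "oct_mult x a \<bullet> y = x \<bullet> oct_mult y (oct_cnj a)"
  by (metis oct_cnj_cnj oct_cnj_inner oct_cnj_mult oct_left_adjoint)

lemma oct_cnj_mult_cancel: "oct_mult (oct_cnj a) (oct_mult a p) = (a \<bullet> a) *\<^sub>R p"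
  by (simp add: vec_eq_8 inner_8 oct_cnj_nth oct_mult_nth algebra_simps)

text \<open>The linearization of \<open>cnj a (a p) = \<langle>a, a\<rangle> p\<close>, which is the source of the triality
  identities below.\<close>

lemma oct_polar: "oct_mult (oct_cnj a) (oct_mult b p) + oct_mult (oct_cnj b) (oct_mult a p) = (2 *
    (a \<bullet> b)) *\<^sub>R p"
  using oct_cnj_mult_cancel[of "a + b" p]
  by (simp add: oct_cnj_linear oct_mult_linear oct_cnj_mult_cancel inner_add_left inner_add_right
      algebra_simps inner_commute[of b a])

lemma oct_polar_right: "oct_mult (oct_mult p b) (oct_cnj a) + oct_mult (oct_mult p a) (oct_cnj b)
    = (2 * (a \<bullet> b)) *\<^sub>R p"
  using arg_cong[OF oct_polar[of "oct_cnj a" "oct_cnj b" "oct_cnj p"], of oct_cnj]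
  by (simp add: oct_cnj_linear oct_cnj_mult oct_cnj_linear oct_cnj_inner)

lemma oct_unit_nth: "oct_unit i $ j = (if j = i then 1 else 0)"
  by (simp add: oct_unit_def axis_def)

lemma oct_one [simp]: "oct_mult (oct_unit 0) x = x" "oct_mult x (oct_unit 0) = x"
  by (simp_all add: vec_eq_8 oct_mult_nth oct_unit_nth)

lemma oct_cnj_one [simp]: "oct_cnj (oct_unit 0) = oct_unit 0"
  by (simp add: vec_eq_8 oct_cnj_nth oct_unit_nth)

lemma oct_left_apply [simp]: "oct_left a *v x = oct_mult a x"
proof -
  have "linear (oct_mult a)" by (auto intro!: linearI simp: oct_mult_linear)
  then show ?thesis by (simp add: oct_left_def matrix_works)
qed

lemma oct_right_apply [simp]: "oct_right a *v x = oct_mult x a"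
proof -
  have "linear (\<lambda>x. oct_mult x a)" by (auto intro!: linearI simp: oct_mult_linear)
  then show ?thesis by (simp add: oct_right_def matrix_works)
qed

section \<open>Tensors and skew-symmetric matrices\<close>

lemma bounded_bilinear_oct_tensor: "bounded_bilinear oct_tensor"
  by (auto intro!: bounded_bilinear_linearI linearI simp: oct_tensor_def vec_eq_iff algebra_simps)

lemmas tensor_linear = bilinear_rules [OF bounded_bilinear_oct_tensor]

lemma tensor_unit_nth: "oct_tensor (oct_unit i) (oct_unit j) $ k $ l = (if k = i \<and> l = j then 1
    else 0)"
  by (simp add: oct_tensor_def oct_unit_nth)

lemma vec_unit_sum: "(\<Sum>i\<in>UNIV. x $ i *\<^sub>R oct_unit i) = x"
  by (simp add: vec_eq_8 sum_8 oct_unit_nth)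

lemma matrix_unit_sum: "(\<Sum>i\<in>UNIV. \<Sum>j\<in>UNIV. X $ i $ j *\<^sub>R oct_tensor (oct_unit i) (oct_unit j)) = X"
proof -
  have "(\<Sum>i\<in>UNIV. \<Sum>j\<in>UNIV. X $ i $ j *\<^sub>R oct_tensor (oct_unit i) (oct_unit j)) $ k $ l = X $ k $ l"
      for k l
  proof -
    have "(\<Sum>j\<in>UNIV. X $ i $ j * (if k = i \<and> l = j then 1 else 0)) = (if k = i then X $ i $ l else
        0)" for i
      by (cases "k = i") (simp_all add: if_distrib cong: if_cong)
    then show ?thesis by (simp add: tensor_unit_nth)
  qed
  then show ?thesis by (simp add: vec_eq_iff)
qed

text \<open>Identities between linear maps on \<open>\<O> \<otimes> \<O>\<close> need only be checked on decomposable tensors.\<close>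

lemma tensor_ext:
  assumes "linear f" "linear g" "\<And>x y. f (oct_tensor x y) = g (oct_tensor x y)"
  shows "f X = g X"
proof -
  have "f (\<Sum>i\<in>UNIV. \<Sum>j\<in>UNIV. X $ i $ j *\<^sub>R oct_tensor (oct_unit i) (oct_unit j)) =
      g (\<Sum>i\<in>UNIV. \<Sum>j\<in>UNIV. X $ i $ j *\<^sub>R oct_tensor (oct_unit i) (oct_unit j))"
    using assms by (simp add: linear_sum linear_scale)
  then show ?thesis by (simp add: matrix_unit_sum)
qed

text \<open>The linear extension of a bilinear map to matrices, given by a double sum over the
  basis, has the expected values on decomposable tensors.\<close>

lemma bilinear_tensor_sum:
  assumes "bounded_bilinear f"
  shows "(\<Sum>i\<in>UNIV. \<Sum>j\<in>UNIV. oct_tensor a b $ i $ j *\<^sub>R f (oct_unit i) (oct_unit j)) = f a b"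
proof -
  have "f a b = f (\<Sum>i\<in>UNIV. a $ i *\<^sub>R oct_unit i) (\<Sum>j\<in>UNIV. b $ j *\<^sub>R oct_unit j)"
    by (simp add: vec_unit_sum)
  also have "\<dots> = (\<Sum>i\<in>UNIV. \<Sum>j\<in>UNIV. (a $ i * b $ j) *\<^sub>R f (oct_unit i) (oct_unit j))"
    by (simp add: bounded_bilinear.sum_left[OF assms] bounded_bilinear.sum_right[OF assms]
        bounded_bilinear.scaleR_left[OF assms] bounded_bilinear.scaleR_right[OF assms]
            mult.commute scaleR_sum_right)
      (rule sum.swap)
  finally show ?thesis by (simp add: oct_tensor_def)
qed

lemma transpose_tensor: "transpose (oct_tensor x y) = oct_tensor y x"
  by (simp add: transpose_def oct_tensor_def vec_eq_iff)

lemma tensor_apply: "oct_tensor x y *v z = (y \<bullet> z) *\<^sub>R x"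
  by (simp add: oct_tensor_def matrix_vector_mult_def vec_eq_iff inner_vec_def sum_distrib_left
      mult_ac)

lemma matrix_mult_tensor: "M ** oct_tensor x y = oct_tensor (M *v x) y"
  by (simp add: matrix_eq tensor_apply matrix_scaleR_vector_ac scaleR_matrix_vector_assoc
      flip: matrix_vector_mul_assoc)

lemma tensor_mult_matrix: "oct_tensor x y ** M = oct_tensor x (transpose M *v y)"
  by (metis matrix_mult_tensor matrix_transpose_mul transpose_tensor transpose_transpose)

lemma tensor_mult_tensor: "oct_tensor x y ** oct_tensor z w = (y \<bullet> z) *\<^sub>R oct_tensor x w"
  by (simp add: matrix_mult_tensor tensor_apply tensor_linear)

lemma inner_tensor: "M \<bullet> oct_tensor x y = (M *v y) \<bullet> x"
  by (simp add: matrix_inner_alt oct_tensor_def matrix_vector_mult_def inner_vec_def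
      sum_distrib_left mult_ac)

lemma wedge_apply: "oct_wedge a b *v z = (b \<bullet> z) *\<^sub>R a - (a \<bullet> z) *\<^sub>R b"
  by (simp add: oct_wedge_def matrix_vector_mult_diff_rdistrib tensor_apply)

lemma inner_wedge: "M \<bullet> oct_wedge x y = (M *v y) \<bullet> x - (M *v x) \<bullet> y"
  by (simp add: oct_wedge_def inner_diff_right inner_tensor)

lemma linear_transpose: "linear (transpose :: real ^ 'n ^ 'm \<Rightarrow> _)"
  by (rule linearI) (simp_all add: transpose_def vec_eq_iff)

lemmas transpose_linear = linear_rules [OF linear_transpose]

lemma subspace_so8: "subspace so8"
  unfolding so8_def
  by (rule subspaceI) (simp_all add: transpose_linear)

lemma wedge_in_so8: "oct_wedge a b \<in> so8"
  by (simp add: so8_def oct_wedge_def transpose_linear transpose_tensor)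

lemma so8_transpose: "P \<in> so8 \<Longrightarrow> transpose P = - P"
  by (simp add: so8_def)

lemma so8_wedge_sum:
  assumes "P \<in> so8"
  shows "P = (\<Sum>i\<in>UNIV. \<Sum>j\<in>UNIV. (P $ i $ j / 2) *\<^sub>R oct_wedge (oct_unit i) (oct_unit j))"
proof -
  have P: "(\<Sum>i\<in>UNIV. \<Sum>j\<in>UNIV. P $ i $ j *\<^sub>R oct_tensor (oct_unit j) (oct_unit i)) = - P"
  proof -
    have "transpose P $ i $ j = P $ j $ i" for i j by (simp add: transpose_def)
    then show ?thesis
      using matrix_unit_sum[of "transpose P"]
          by (subst sum.swap) (simp only: so8_transpose[OF assms])
  qed
  have "(\<Sum>i\<in>UNIV. \<Sum>j\<in>UNIV. (P $ i $ j / 2) *\<^sub>R oct_wedge (oct_unit i) (oct_unit j))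
    = (1/2) *\<^sub>R ((\<Sum>i\<in>UNIV. \<Sum>j\<in>UNIV. P $ i $ j *\<^sub>R oct_tensor (oct_unit i) (oct_unit j))
       - (\<Sum>i\<in>UNIV. \<Sum>j\<in>UNIV. P $ i $ j *\<^sub>R oct_tensor (oct_unit j) (oct_unit i)))"
    by (simp add: oct_wedge_def scaleR_sum_right scaleR_diff_right sum_subtractf)
  also have "\<dots> = P" unfolding P matrix_unit_sum by (simp flip: scaleR_2)
  finally show ?thesis ..
qed

text \<open>The maps are assumed to be linear on \<open>so8\<close> only, since a candidate for triality is known
  to be linear only there.\<close>

lemma so8_ext:
  assumes f: "\<And>A B. A \<in> so8 \<Longrightarrow> B \<in> so8 \<Longrightarrow> f (A + B) = f A + f B"
      "\<And>c A. A \<in> so8 \<Longrightarrow> f (c *\<^sub>R A) = c *\<^sub>R f A"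
    and g: "\<And>A B. A \<in> so8 \<Longrightarrow> B \<in> so8 \<Longrightarrow> g (A + B) = g A + g B" "\<And>c A. A \<in> so8 \<Longrightarrow> g (c *\<^sub>R A) = c *\<^sub>R g A"
    and fg: "\<And>i j. f (oct_wedge (oct_unit i) (oct_unit j)) = g (oct_wedge (oct_unit i) (oct_unit
        j))"
    and P: "P \<in> so8"
  shows "f P = (g P :: 'b::real_vector)"
proof -
  have sum: "h (sum u S) = (\<Sum>i\<in>S. h (u i))" if "finite S" "\<And>i. i \<in> S \<Longrightarrow> u i \<in> so8"
    and h: "\<And>A B. A \<in> so8 \<Longrightarrow> B \<in> so8 \<Longrightarrow> h (A + B) = h A + h B" "\<And>c A. A \<in> so8 \<Longrightarrow> h (c *\<^sub>R A) = c *\<^sub>R h A"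
    for h :: "mat8 \<Rightarrow> 'b" and u :: "8 \<Rightarrow> mat8" and S
    using that(1,2)
  proof (induction S rule: finite_induct)
    case empty
    then show ?case using h(2)[OF subspace_0[OF subspace_so8], of 0] by simp
  next
    case (insert x F)
    then show ?case using h(1)[of "u x" "sum u F"] subspace_sum[OF subspace_so8, of F u] by simp
  qed
  have *: "(P $ i $ j / 2) *\<^sub>R oct_wedge (oct_unit i) (oct_unit j) \<in> so8" for i j
    by (intro subspace_scale subspace_so8 wedge_in_so8)
  have **: "(\<Sum>j\<in>UNIV. (P $ i $ j / 2) *\<^sub>R oct_wedge (oct_unit i) (oct_unit j)) \<in> so8" for i
    using * by (intro subspace_sum subspace_so8)
  show ?thesis
    using f g fg * **
    by (subst (1 2) so8_wedge_sum[OF P]) (simp add: sum wedge_in_so8)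
qed

lemma so8_linear_ext:
  assumes "linear f" "linear g" "\<And>a b. f (oct_wedge a b) = g (oct_wedge a b)" "P \<in> so8"
  shows "f P = g P"
  by (rule so8_ext) (use assms in \<open>auto simp: linear_add linear_scale\<close>)

section \<open>Triality\<close>

text \<open>The linear extension of \<open>a \<otimes> b \<mapsto> L\<^bsub>cnj a\<^esub> L\<^sub>b / 4\<close>. On \<open>a \<and> b\<close> it is
  \<open>(L\<^bsub>cnj a\<^esub> L\<^sub>b - L\<^bsub>cnj b\<^esub> L\<^sub>a) / 4\<close>, which the composition law turns into \<open>L\<^bsub>cnj b\<^esub> L\<^bsub>cnj a\<^esub> / 2\<close> for
  orthogonal \<open>a, b\<close> with \<open>a\<close> pure. So this is \<open>\<lambda>\<close> on \<open>so8\<close>, extended to all matrices.\<close>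

definition triality_left :: "mat8 \<Rightarrow> mat8" where
  "triality_left P = (1/4) *\<^sub>R (\<Sum>i\<in>UNIV. \<Sum>j\<in>UNIV.
     P $ i $ j *\<^sub>R (oct_left (oct_cnj (oct_unit i)) ** oct_left (oct_unit j)))"

text \<open>The mirror image of \<open>triality_left\<close>; on \<open>so8\<close> it turns out to be \<open>\<lambda>\<^sup>2\<close>.\<close>

definition triality_right :: "mat8 \<Rightarrow> mat8" where
  "triality_right P = (1/4) *\<^sub>R (\<Sum>i\<in>UNIV. \<Sum>j\<in>UNIV.
     P $ i $ j *\<^sub>R (oct_right (oct_cnj (oct_unit i)) ** oct_right (oct_unit j)))"

lemma linear_triality_left: "linear triality_left"
  by (rule linearI) (simp_all add: triality_left_def scaleR_add_left sum.distrib scaleR_add_right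
      scaleR_sum_right mult_ac)

lemma linear_triality_right: "linear triality_right"
  by (rule linearI) (simp_all add: triality_right_def scaleR_add_left sum.distrib scaleR_add_right
      scaleR_sum_right mult_ac)

lemmas triality_linear = linear_rules [OF linear_triality_left] linear_rules [OF
    linear_triality_right]

lemma oct_left_linear:
  "oct_left (a + b) = oct_left a + oct_left b" "oct_left (c *\<^sub>R a) = c *\<^sub>R oct_left a"
  "oct_right (a + b) = oct_right a + oct_right b" "oct_right (c *\<^sub>R a) = c *\<^sub>R oct_right a"
  by (simp_all add: matrix_eq matrix_vector_mult_add_rdistrib oct_mult_linear
      scaleR_matrix_vector_assoc [symmetric])

lemma triality_left_tensor:
  "triality_left (oct_tensor a b) = (1/4) *\<^sub>R (oct_left (oct_cnj a) ** oct_left b)"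
proof -
  have "bounded_bilinear (\<lambda>a b. oct_left (oct_cnj a) ** oct_left b)"
    by (auto intro!: bounded_bilinear_linearI linearI simp: oct_cnj_linear oct_left_linear
      matrix_mult_linear)
  then show ?thesis unfolding triality_left_def by (subst bilinear_tensor_sum) auto
qed

lemma triality_right_tensor:
  "triality_right (oct_tensor a b) = (1/4) *\<^sub>R (oct_right (oct_cnj a) ** oct_right b)"
proof -
  have "bounded_bilinear (\<lambda>a b. oct_right (oct_cnj a) ** oct_right b)"
    by (auto intro!: bounded_bilinear_linearI linearI simp: oct_cnj_linear oct_left_linear
      matrix_mult_linear)
  then show ?thesis unfolding triality_right_def by (subst bilinear_tensor_sum) auto
qed

lemma triality_left_wedge_apply:
  "triality_left (oct_wedge a b) *v p =
     (1/4) *\<^sub>R (oct_mult (oct_cnj a) (oct_mult b p) - oct_mult (oct_cnj b) (oct_mult a p))"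
  by (simp add: oct_wedge_def triality_linear triality_left_tensor
      matrix_vector_mult_diff_rdistrib scaleR_matrix_vector_assoc[symmetric] scaleR_diff_right
      flip: matrix_vector_mul_assoc)

lemma triality_right_wedge_apply:
  "triality_right (oct_wedge a b) *v p =
     (1/4) *\<^sub>R (oct_mult (oct_mult p b) (oct_cnj a) - oct_mult (oct_mult p a) (oct_cnj b))"
  by (simp add: oct_wedge_def triality_linear triality_right_tensor
      matrix_vector_mult_diff_rdistrib scaleR_matrix_vector_assoc[symmetric] scaleR_diff_right
      flip: matrix_vector_mul_assoc)

text \<open>The real part of \<open>(x y) z\<close>.\<close>

definition oct_trilinear :: "octonion \<Rightarrow> octonion \<Rightarrow> octonion \<Rightarrow> real" where
  "oct_trilinear x y z = oct_mult x y \<bullet> oct_cnj z"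

lemma oct_trilinear_cyclic: "oct_trilinear x y z = oct_trilinear y z x"
proof -
  have "oct_mult x y \<bullet> oct_cnj z = y \<bullet> oct_mult (oct_cnj x) (oct_cnj z)" by (rule oct_left_adjoint)
  also have "\<dots> = oct_mult y z \<bullet> oct_cnj x"
    using oct_right_adjoint[of y z "oct_cnj x"] by simp
  finally show ?thesis by (simp add: oct_trilinear_def)
qed

lemmas oct_trilinear_simps = oct_trilinear_def oct_mult_linear oct_cnj_linear inner_add_left
    inner_add_right inner_diff_left inner_diff_right

text \<open>The infinitesimal form of the principle of triality: \<open>(P, Q, R)\<close> is tangent to the
  triples of rotations that preserve the trilinear form.\<close>

definition triality_triple :: "mat8 \<Rightarrow> mat8 \<Rightarrow> mat8 \<Rightarrow> bool" where
  "triality_triple P Q R \<longleftrightarrow> (\<forall>x y z.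
     oct_trilinear (P *v x) y z + oct_trilinear x (Q *v y) z + oct_trilinear x y (R *v z) = 0)"

lemma triality_triple_rotate: "triality_triple P Q R \<Longrightarrow> triality_triple Q R P"
  unfolding triality_triple_def
proof (intro allI)
  fix x y z
  assume "\<forall>x y z. oct_trilinear (P *v x) y z + oct_trilinear x (Q *v y) z + oct_trilinear x y (R
      *v z) = 0"
  from this[rule_format, of z x y]
  show "oct_trilinear (Q *v x) y z + oct_trilinear x (R *v y) z + oct_trilinear x y (P *v z) = 0"
    by (simp add: oct_trilinear_cyclic[of z] oct_trilinear_cyclic[of "P *v z"])
qed

text \<open>By two applications of the composition law, the product of \<open>x\<close> with \<open>cnj a (b y)\<close>
  becomes \<open>a (cnj b (x y))\<close> up to terms \<open>\<langle>x, a\<rangle> b y\<close> and \<open>\<langle>x, b\<rangle> a y\<close>. The latter are cancelled by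
  \<open>(a \<and> b) x\<close>, and what is left is cancelled by the third summand after passing to adjoints.\<close>

lemma triality_triple_wedge:
  "triality_triple (oct_wedge a b) (triality_left (oct_wedge a b)) (triality_right (oct_wedge a b))"
  unfolding triality_triple_def
proof (intro allI)
  fix x y z
  let ?w = "oct_cnj z"
  have swap: "oct_mult x (oct_mult (oct_cnj u) (oct_mult v y)) =
      (2 * (x \<bullet> u)) *\<^sub>R oct_mult v y - (2 * (v \<bullet> x)) *\<^sub>R oct_mult u y
      + oct_mult u (oct_mult (oct_cnj v) (oct_mult x y))" for u v
  proof -
    have "oct_mult x (oct_mult (oct_cnj u) (oct_mult v y)) =
       (2 * (x \<bullet> u)) *\<^sub>R oct_mult v y - oct_mult u (oct_mult (oct_cnj x) (oct_mult v y))"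
      using oct_polar[of "oct_cnj x" "oct_cnj u" "oct_mult v y"]
          by (simp add: oct_cnj_inner eq_diff_eq)
    moreover have "oct_mult (oct_cnj x) (oct_mult v y) = (2 * (v \<bullet> x)) *\<^sub>R y - oct_mult (oct_cnj v)
        (oct_mult x y)"
      using oct_polar[of x v y] by (simp add: eq_diff_eq inner_commute)
    ultimately show ?thesis by (simp add: oct_mult_linear)
  qed
  have "oct_mult x (triality_left (oct_wedge a b) *v y) =
     (x \<bullet> a) *\<^sub>R oct_mult b y - (x \<bullet> b) *\<^sub>R oct_mult a y
     + (1/4) *\<^sub>R (oct_mult a (oct_mult (oct_cnj b) (oct_mult x y)) - oct_mult b (oct_mult (oct_cnj
         a) (oct_mult x y)))"
    unfolding triality_left_wedge_apply oct_mult_linear swap[of a b] swap[of b a]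
    by (simp add: vec_eq_iff inner_commute field_simps)
  then have 2: "oct_trilinear x (triality_left (oct_wedge a b) *v y) z =
     (x \<bullet> a) * (oct_mult b y \<bullet> ?w) - (x \<bullet> b) * (oct_mult a y \<bullet> ?w)
     + (1/4) * (oct_mult a (oct_mult (oct_cnj b) (oct_mult x y)) \<bullet> ?w - oct_mult b (oct_mult
         (oct_cnj a) (oct_mult x y)) \<bullet> ?w)"
    by (simp add: oct_trilinear_def inner_add_left inner_diff_left)
  have 1: "oct_trilinear (oct_wedge a b *v x) y z = (b \<bullet> x) * (oct_mult a y \<bullet> ?w) - (a \<bullet> x) *
      (oct_mult b y \<bullet> ?w)"
    by (simp add: wedge_apply oct_trilinear_simps)
  have adj: "oct_mult u (oct_mult (oct_cnj v) (oct_mult x y)) \<bullet> ?w = oct_mult x y \<bullet> oct_mult v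
      (oct_mult (oct_cnj u) ?w)" for u v
    by (simp add: oct_left_adjoint)
  have 3: "oct_trilinear x y (triality_right (oct_wedge a b) *v z) =
    (1/4) * (oct_mult x y \<bullet> oct_mult a (oct_mult (oct_cnj b) ?w) - oct_mult x y \<bullet> oct_mult b
        (oct_mult (oct_cnj a) ?w))"
    by (simp add: triality_right_wedge_apply oct_trilinear_simps oct_cnj_mult)
  show "oct_trilinear (oct_wedge a b *v x) y z + oct_trilinear x (triality_left (oct_wedge a b) *v
      y) z +
       oct_trilinear x y (triality_right (oct_wedge a b) *v z) = 0"
    unfolding 1 2 3 adj by (simp add: inner_commute algebra_simps)
qed

lemma triality_triple_so8:
  assumes "P \<in> so8" shows "triality_triple P (triality_left P) (triality_right P)"
  unfolding triality_triple_def
proof (intro allI)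
  fix x y z
  let ?f = "\<lambda>P. oct_trilinear (P *v x) y z + oct_trilinear x (triality_left P *v y) z +
      oct_trilinear x y (triality_right P *v z)"
  have "linear ?f"
    by (rule linearI)
      (simp_all add: oct_trilinear_simps triality_linear
       matrix_vector_mult_add_rdistrib scaleR_matrix_vector_assoc[symmetric] algebra_simps)
  moreover have "linear (\<lambda>P :: mat8. 0 :: real)" by (rule linearI) auto
  ultimately show "?f P = 0"
    by (rule so8_linear_ext[OF _ _ _ assms])
      (use triality_triple_wedge in \<open>simp add: triality_triple_def\<close>)
qed

lemma so8_iff_skew: "P \<in> so8 \<longleftrightarrow> (\<forall>x y. (P *v x) \<bullet> y = - (x \<bullet> (P *v y)))"
  by (simp add: so8_def transpose_skew_iff)

lemma so8_skew: "P \<in> so8 \<Longrightarrow> (P *v x) \<bullet> y = - (x \<bullet> (P *v y))"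
  by (simp add: so8_iff_skew)

lemma triality_left_inner:
  "(triality_left (oct_wedge a b) *v p) \<bullet> q = (1/4) * (oct_mult b p \<bullet> oct_mult a q - oct_mult a p
      \<bullet> oct_mult b q)"
  by (simp add: triality_left_wedge_apply inner_diff_left oct_left_adjoint[of "oct_cnj _",
      simplified])

lemma triality_right_inner:
  "(triality_right (oct_wedge a b) *v p) \<bullet> q = (1/4) * (oct_mult p b \<bullet> oct_mult q a - oct_mult p a
      \<bullet> oct_mult q b)"
  by (simp add: triality_right_wedge_apply inner_diff_left oct_right_adjoint[of _ "oct_cnj _",
      simplified])

lemma triality_left_so8: assumes "P \<in> so8" shows "triality_left P \<in> so8"
proof -
  have "transpose (triality_left P) = - triality_left P"
  proof (rule so8_linear_ext[OF _ _ _ assms])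
    fix a b
    have "triality_left (oct_wedge a b) \<in> so8"
      unfolding so8_iff_skew
    proof (intro allI)
      fix x y
      show "(triality_left (oct_wedge a b) *v x) \<bullet> y = - (x \<bullet> (triality_left (oct_wedge a b) *v y))"
        unfolding inner_commute[of x] triality_left_inner
          inner_commute[of "oct_mult b x" "oct_mult a y"] inner_commute[of "oct_mult a x"
              "oct_mult b y"]
        by (simp add: field_simps)
    qed
    then show "transpose (triality_left (oct_wedge a b)) = - triality_left (oct_wedge a b)"
        by (simp add: so8_def)
  qed (auto intro!: linearI simp: triality_linear transpose_def vec_eq_iff)
  then show ?thesis by (simp add: so8_def)
qed

lemma triality_right_so8: assumes "P \<in> so8" shows "triality_right P \<in> so8"
proof -
  have "transpose (triality_right P) = - triality_right P"
  proof (rule so8_linear_ext[OF _ _ _ assms])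
    fix a b
    have "triality_right (oct_wedge a b) \<in> so8"
      unfolding so8_iff_skew
    proof (intro allI)
      fix x y
      show "(triality_right (oct_wedge a b) *v x) \<bullet> y = - (x \<bullet> (triality_right (oct_wedge a b) *v
          y))"
        unfolding inner_commute[of x] triality_right_inner
          inner_commute[of "oct_mult x b" "oct_mult y a"] inner_commute[of "oct_mult x a"
              "oct_mult y b"]
        by (simp add: field_simps)
    qed
    then show "transpose (triality_right (oct_wedge a b)) = - triality_right (oct_wedge a b)"
        by (simp add: so8_def)
  qed (auto intro!: linearI simp: triality_linear transpose_def vec_eq_iff)
  then show ?thesis by (simp add: so8_def)
qed

text \<open>An octonion that associates with all pairs is real. Each coordinate \<open>c\<^sub>k\<close> with \<open>k \<noteq> 0\<close> is
  seen to vanish from one coordinate of the equation for a suitable pair of units.\<close>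

lemma oct_nucleus:
  assumes "\<And>x y. oct_mult x (oct_mult y c) = oct_mult (oct_mult x y) c"
  shows "c = (c $ 0) *\<^sub>R oct_unit 0"
proof -
  have c1: "c $ 1 = 0"
    and c2: "c $ 2 = 0"
    and c3: "c $ 3 = 0"
    and c4: "c $ 4 = 0"
    and c5: "c $ 5 = 0"
    and c6: "c $ 6 = 0"
    and c7: "c $ 7 = 0"
    using arg_cong[OF assms[of "oct_unit 2" "oct_unit 4"], of "\<lambda>v. v $ 7"]
      arg_cong[OF assms[of "oct_unit 1" "oct_unit 4"], of "\<lambda>v. v $ 7"]
      arg_cong[OF assms[of "oct_unit 1" "oct_unit 4"], of "\<lambda>v. v $ 6"]
      arg_cong[OF assms[of "oct_unit 1" "oct_unit 2"], of "\<lambda>v. v $ 7"]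
      arg_cong[OF assms[of "oct_unit 1" "oct_unit 2"], of "\<lambda>v. v $ 6"]
      arg_cong[OF assms[of "oct_unit 1" "oct_unit 2"], of "\<lambda>v. v $ 5"]
      arg_cong[OF assms[of "oct_unit 1" "oct_unit 2"], of "\<lambda>v. v $ 4"]
    by (simp_all add: oct_mult_nth oct_unit_nth neq_8)
  then show ?thesis by (simp add: vec_eq_8 oct_unit_nth)
qed

text \<open>If \<open>P = 0\<close>, the identity says that \<open>Q\<close> commutes with all left multiplications, so
  \<open>Q x = x c\<close> with \<open>c = Q 1\<close>, and \<open>c\<close> associates with all pairs. So \<open>c\<close> is real, and it is
  orthogonal to \<open>1\<close> because \<open>Q\<close> is skew-symmetric.\<close>

lemma triality_triple_zero:
  assumes triple: "triality_triple 0 Q R" and Q: "Q \<in> so8"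
  shows "Q = 0" "R = 0"
proof -
  have *: "oct_mult x (Q *v y) \<bullet> w = - (oct_mult x y \<bullet> oct_cnj (R *v oct_cnj w))" for x y w
    using triple[unfolded triality_triple_def, rule_format, of x y "oct_cnj w"]
        by (simp add: oct_trilinear_def oct_mult_def[of 0] zero_vec_def[symmetric])
  have "oct_mult x (Q *v y) \<bullet> w = (Q *v oct_mult x y) \<bullet> w" for x y w
    using *[of x y w] *[of "oct_unit 0" "oct_mult x y" w] by simp
  then have Qmult: "oct_mult x (Q *v y) = Q *v oct_mult x y" for x y using vector_eq_rdot by blast
  define c where "c = Q *v oct_unit 0"
  have Qc: "Q *v x = oct_mult x c" for x using Qmult[of x "oct_unit 0"] by (simp add: c_def)
  have "c = (c $ 0) *\<^sub>R oct_unit 0"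
    using Qmult by (intro oct_nucleus) (simp add: Qc)
  moreover have "c $ 0 = 0"
    using so8_skew[OF Q, of "oct_unit 0" "oct_unit 0"] unfolding c_def
    by (simp add: inner_commute) (simp add: oct_unit_def inner_axis inner_axis')
  ultimately have "c = 0" by simp
  then show Q0: "Q = 0" by (simp add: matrix_eq Qc oct_mult_linear)
  have "x \<bullet> oct_cnj (R *v oct_cnj w) = 0" for x w
    using *[of "oct_unit 0" x w] by (simp add: Q0)
  then have "oct_cnj (R *v oct_cnj w) = 0" for w
      using vector_eq_ldot[of "oct_cnj (R *v oct_cnj w)" 0] by simp
  then have "R *v z = 0" for z by (metis oct_cnj_cnj linear_0 linear_oct_cnj)
  then show "R = 0" by (simp add: matrix_eq)
qed

lemma triality_triple_diff:
  "triality_triple P Q R \<Longrightarrow> triality_triple P' Q' R' \<Longrightarrow> triality_triple (P - P') (Q - Q') (R - R')"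
  unfolding triality_triple_def
proof (intro allI)
  fix x y z
  assume "\<forall>x y z. oct_trilinear (P *v x) y z + oct_trilinear x (Q *v y) z + oct_trilinear x y (R
      *v z) = 0"
    and "\<forall>x y z. oct_trilinear (P' *v x) y z + oct_trilinear x (Q' *v y) z + oct_trilinear x y (R'
        *v z) = 0"
  from this[rule_format, of x y z]
  show "oct_trilinear ((P - P') *v x) y z + oct_trilinear x ((Q - Q') *v y) z + oct_trilinear x y
      ((R - R') *v z) = 0"
    by (simp add: oct_trilinear_simps matrix_vector_mult_diff_rdistrib)
qed

lemma triality_triple_unique:
  assumes "triality_triple P Q R" "P \<in> so8" "Q \<in> so8"
  shows "Q = triality_left P" "R = triality_right P"
  using triality_triple_zero[of "Q - triality_left P" "R - triality_right P"]
    triality_triple_diff[OF assms(1) triality_triple_so8[OF assms(2)]]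
    subspace_diff[OF subspace_so8 assms(3) triality_left_so8[OF assms(2)]] by auto

text \<open>As for any trilinear form, the triples that annihilate it are closed under componentwise
  commutators. Uniqueness of triples turns this into the homomorphism property of \<open>\<lambda>\<close>.\<close>

lemma triality_triple_bracket:
  assumes "triality_triple P Q R" "triality_triple P' Q' R'"
  shows "triality_triple (mat_bracket P P') (mat_bracket Q Q') (mat_bracket R R')"
  unfolding triality_triple_def
proof (intro allI)
  fix x y z
  note * = assms(1)[unfolded triality_triple_def, rule_format] assms(2)[unfolded
      triality_triple_def, rule_format]
  have lin: "oct_trilinear (mat_bracket A B *v x) y z = oct_trilinear (A *v (B *v x)) y z -
      oct_trilinear (B *v (A *v x)) y z"
     "oct_trilinear x (mat_bracket A B *v y) z = oct_trilinear x (A *v (B *v y)) z - oct_trilinear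
         x (B *v (A *v y)) z"
     "oct_trilinear x y (mat_bracket A B *v z) = oct_trilinear x y (A *v (B *v z)) - oct_trilinear
         x y (B *v (A *v z))" for A B
    by (simp_all add: mat_bracket_def matrix_vector_mult_diff_rdistrib oct_trilinear_simps flip:
        matrix_vector_mul_assoc)
  show "oct_trilinear (mat_bracket P P' *v x) y z + oct_trilinear x (mat_bracket Q Q' *v y) z
     + oct_trilinear x y (mat_bracket R R' *v z) = 0"
    unfolding lin
    using *(1)[of "P' *v x" y z] *(1)[of x "Q' *v y" z] *(1)[of x y "R' *v z"]
      *(2)[of "P *v x" y z] *(2)[of x "Q *v y" z] *(2)[of x y "R *v z"] by linarith
qed

lemma so8_bracket: "P \<in> so8 \<Longrightarrow> Q \<in> so8 \<Longrightarrow> mat_bracket P Q \<in> so8"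
  by (simp add: so8_def mat_bracket_def) (simp add: matrix_transpose_mul transpose_linear
      matrix_mult_linear)

lemma triality_left_bracket:
  assumes "P \<in> so8" "Q \<in> so8"
  shows "triality_left (mat_bracket P Q) = mat_bracket (triality_left P) (triality_left Q)"
  using triality_triple_unique(1)[OF triality_triple_bracket[OF triality_triple_so8
      triality_triple_so8, OF assms]
    so8_bracket[OF assms] so8_bracket[OF triality_left_so8 triality_left_so8, OF assms]] by simp

text \<open>A cyclic rotation of the triple \<open>(P, \<lambda>(P), \<lambda>\<^sup>2(P))\<close> is a triple again, and it is
  determined by its first entry.\<close>

lemma triality_cycle:
  assumes P: "P \<in> so8"
  shows "triality_left (triality_left P) = triality_right P" "triality_left (triality_right P) = P"
    "triality_right (triality_left P) = P" "triality_right (triality_right P) = triality_left P"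
proof -
  note 1 = triality_triple_rotate[OF triality_triple_so8[OF P]]
  note 2 = triality_triple_rotate[OF 1]
  show "triality_left (triality_left P) = triality_right P" "triality_right (triality_left P) = P"
    using triality_triple_unique[OF 1] triality_left_so8[OF P] triality_right_so8[OF P] by simp_all
  show "triality_left (triality_right P) = P" "triality_right (triality_right P) = triality_left P"
    using triality_triple_unique[OF 2] P triality_right_so8[OF P] by simp_all
qed

text \<open>On wedges, both sides are \<open>(\<langle>b d, a c\<rangle> - \<langle>a d, b c\<rangle>) / 2\<close>. Hence \<open>\<lambda>\<close> is orthogonal.\<close>

lemma triality_left_adjoint:
  assumes "P \<in> so8" "Q \<in> so8"
  shows "triality_left P \<bullet> Q = P \<bullet> triality_right Q"
proof -
  have "triality_left (oct_wedge a b) \<bullet> Q = oct_wedge a b \<bullet> triality_right Q" for a b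
  proof (rule so8_linear_ext[OF _ _ _ assms(2)])
    fix c d
    show "triality_left (oct_wedge a b) \<bullet> oct_wedge c d = oct_wedge a b \<bullet> triality_right
        (oct_wedge c d)"
      unfolding inner_commute[of "oct_wedge a b"] inner_wedge triality_left_inner
          triality_right_inner
        inner_commute[of "oct_mult b c" "oct_mult a d"] inner_commute[of "oct_mult b d"
            "oct_mult a c"]
      by (simp add: field_simps)
  qed (auto intro!: linearI simp: triality_linear inner_add_right)
  then show ?thesis
    by (rule so8_linear_ext[OF _ _ _ assms(1), rotated 2])
      (auto intro!: linearI simp: triality_linear inner_add_left)
qed

lemma oct_pure_cnj: "a \<in> oct_pure \<Longrightarrow> oct_cnj a = - a"
proof -
  assume "a \<in> oct_pure"
  then have "a $ 0 = 0"
    unfolding oct_pure_def by (induction rule: span_induct) (auto simp: subspace_def oct_unit_nth)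
  then show ?thesis by (simp add: oct_cnj_def vec_eq_iff)
qed

lemma triality_left_pure:
  assumes "a \<in> oct_pure" "a \<bullet> b = 0"
  shows "triality_left (oct_wedge a b) = (1/2) *\<^sub>R (oct_left (oct_cnj b) ** oct_left (oct_cnj a))"
proof -
  have "triality_left (oct_wedge a b) *v p = ((1/2) *\<^sub>R (oct_left (oct_cnj b) ** oct_left (oct_cnj
      a))) *v p" for p
  proof -
    have "oct_mult (oct_cnj a) (oct_mult b p) = - oct_mult (oct_cnj b) (oct_mult a p)"
      using oct_polar[of a b p] assms(2) by (simp add: eq_neg_iff_add_eq_0)
    then have "triality_left (oct_wedge a b) *v p = - (1/4) *\<^sub>R (2 *\<^sub>R oct_mult (oct_cnj b)
        (oct_mult a p))"
      unfolding triality_left_wedge_apply by (simp add: scaleR_2 algebra_simps)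
    also have "\<dots> = (1/2) *\<^sub>R oct_mult (oct_cnj b) (oct_mult (oct_cnj a) p)"
      by (simp add: oct_pure_cnj[OF assms(1)] oct_mult_linear)
    finally show ?thesis
      by (simp add: scaleR_matrix_vector_assoc[symmetric] flip: matrix_vector_mul_assoc)
  qed
  then show ?thesis by (simp add: matrix_eq)
qed

lemma unit_pure: "i \<noteq> 0 \<Longrightarrow> oct_unit i \<in> oct_pure"
  unfolding oct_pure_def by (auto intro: span_base)

lemma unit_inner: "oct_unit i \<bullet> oct_unit j = (if i = j then 1 else 0)"
  by (simp add: oct_unit_def inner_axis_axis)

lemma wedge_swap: "oct_wedge a b = - oct_wedge b a"
  by (simp add: oct_wedge_def)

lemma wedge_self [simp]: "oct_wedge a a = 0"
  by (simp add: oct_wedge_def)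

text \<open>For uniqueness, note that \<open>so8\<close> is spanned by the \<open>e\<^sub>i \<and> e\<^sub>j\<close> with \<open>i \<noteq> j\<close>, where one of
  the two units is pure, so that the prescribed values determine the map.\<close>

lemma triality_eq: "triality = (\<lambda>A. if A \<in> so8 then triality_left A else 0)" (is "_ = ?f")
  unfolding triality_def
proof (rule the_equality)
  have bij: "bij_betw ?f so8 so8"
    by (rule bij_betw_byWitness[where f' = triality_right])
      (auto simp: triality_cycle triality_left_so8 triality_right_so8)
  have nontriv: "triality_left (oct_wedge (oct_unit 1) (oct_unit 0)) \<noteq> oct_wedge (oct_unit 1)
      (oct_unit 0)"
  proof
    assume "triality_left (oct_wedge (oct_unit 1) (oct_unit 0)) = oct_wedge (oct_unit 1) (oct_unit
        0)"
    then have "(triality_left (oct_wedge (oct_unit 1) (oct_unit 0)) *v oct_unit 2) $ 3 =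
        (oct_wedge (oct_unit 1) (oct_unit 0) *v oct_unit 2) $ 3" by simp
    then show False
      by (simp add: triality_left_wedge_apply wedge_apply unit_inner oct_mult_nth oct_unit_nth
          oct_cnj_nth)
  qed
  show "lie_iso ?f so8 mat_bracket so8 mat_bracket \<and>
     (\<forall>A\<in>so8. ?f (?f (?f A)) = A) \<and> (\<exists>A\<in>so8. ?f A \<noteq> A) \<and>
     (\<forall>a\<in>oct_pure. \<forall>b. a \<bullet> b = 0 \<longrightarrow>
        ?f (oct_wedge a b) = (1/2) *\<^sub>R (oct_left (oct_cnj b) ** oct_left (oct_cnj a))) \<and>
     (\<forall>A. A \<notin> so8 \<longrightarrow> ?f A = 0)"
    unfolding lie_iso_def
  proof (intro conjI ballI allI impI)
    show "\<exists>A\<in>so8. ?f A \<noteq> A"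
      using nontriv wedge_in_so8 by (intro bexI[of _ "oct_wedge (oct_unit 1) (oct_unit 0)"]) auto
  qed (use bij in \<open>auto simp: subspace_add subspace_scale subspace_so8 so8_bracket
      triality_left_bracket
      triality_cycle triality_left_so8 triality_right_so8 wedge_in_so8 triality_left_pure
      triality_linear\<close>)
next
  fix f
  assume "lie_iso f so8 mat_bracket so8 mat_bracket \<and>
     (\<forall>A\<in>so8. f (f (f A)) = A) \<and> (\<exists>A\<in>so8. f A \<noteq> A) \<and>
     (\<forall>a\<in>oct_pure. \<forall>b. a \<bullet> b = 0 \<longrightarrow>
        f (oct_wedge a b) = (1/2) *\<^sub>R (oct_left (oct_cnj b) ** oct_left (oct_cnj a))) \<and>
     (\<forall>A. A \<notin> so8 \<longrightarrow> f A = 0)"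
  then have add: "\<And>A B. A \<in> so8 \<Longrightarrow> B \<in> so8 \<Longrightarrow> f (A + B) = f A + f B"
    and scale: "\<And>c A. A \<in> so8 \<Longrightarrow> f (c *\<^sub>R A) = c *\<^sub>R f A"
    and pure: "\<And>a b. a \<in> oct_pure \<Longrightarrow> a \<bullet> b = 0 \<Longrightarrow> f (oct_wedge a b) = triality_left (oct_wedge a b)"
    and outside: "\<And>A. A \<notin> so8 \<Longrightarrow> f A = 0"
    by (auto simp: lie_iso_def triality_left_pure)
  have neg: "f (- A) = - f A" if "A \<in> so8" for A using scale[OF that, of "-1"] by simp
  have zero: "f 0 = 0" using scale[OF subspace_0[OF subspace_so8], of 0] by simp
  have unit: "f (oct_wedge (oct_unit i) (oct_unit j)) = triality_left (oct_wedge (oct_unit i)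
      (oct_unit j))" for i j
  proof -
    consider "i = j" | "i \<noteq> j" "i \<noteq> 0" | "i \<noteq> j" "j \<noteq> 0" by blast
    then show ?thesis
    proof cases
      case 1
      then show ?thesis by (simp add: zero triality_linear)
    next
      case 2
      then show ?thesis by (intro pure unit_pure) (auto simp: unit_inner)
    next
      case 3
      then have "f (oct_wedge (oct_unit j) (oct_unit i)) = triality_left (oct_wedge (oct_unit j)
          (oct_unit i))"
        by (intro pure unit_pure) (auto simp: unit_inner)
      then show ?thesis
        unfolding wedge_swap[of "oct_unit i"] by (simp add: neg wedge_in_so8 triality_linear)
    qed
  qed
  show "f = ?f"
  proof
    fix A
    show "f A = ?f A"
    proof (cases "A \<in> so8")
      case True
      have "f A = triality_left A"
        by (rule so8_ext[OF add scale _ _ unit True])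
          (auto simp: triality_linear)
      then show ?thesis using True by simp
    qed (simp add: outside)
  qed
qed

lemma triality_so8 [simp]: "A \<in> so8 \<Longrightarrow> triality A = triality_left A"
  by (simp add: triality_eq)

section \<open>The building blocks of the bracket\<close>

text \<open>The product through which \<open>v \<star> z\<close> and its conjugation enter the bracket. It is the
  tensor square of \<open>(a, b) \<mapsto> cnj (a b)\<close>, whose equivariance is the principle of triality.\<close>

definition oo_prod :: "mat8 \<Rightarrow> mat8 \<Rightarrow> mat8" where
  "oo_prod X Y = oo_cnj (oo_mult X Y)"

text \<open>\<open>\<Lambda>\<close> and \<open>\<Lambda>\<^sup>2 = \<Lambda>\<^sup>-\<^sup>1\<close>, linear on all pairs of matrices.\<close>

definition Lambda :: "mat8 \<times> mat8 \<Rightarrow> mat8 \<times> mat8" where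
  "Lambda A = (triality_left (fst A), triality_left (snd A))"

definition Lambda_inv :: "mat8 \<times> mat8 \<Rightarrow> mat8 \<times> mat8" where
  "Lambda_inv A = (triality_right (fst A), triality_right (snd A))"

lemma linear_Lambda: "linear Lambda"
  by (rule linearI) (simp_all add: Lambda_def triality_linear)

lemma linear_Lambda_inv: "linear Lambda_inv"
  by (rule linearI) (simp_all add: Lambda_inv_def triality_linear)

lemma Lambda_so8:
  assumes "A \<in> so8 \<times> so8"
  shows "Lambda A \<in> so8 \<times> so8" "Lambda_inv A \<in> so8 \<times> so8"
    "Lambda (Lambda A) = Lambda_inv A" "Lambda (Lambda_inv A) = A" "Lambda_inv (Lambda A) = A"
        "Lambda_inv (Lambda_inv A) = Lambda A"
  using assms by (auto simp: Lambda_def Lambda_inv_def triality_left_so8 triality_right_so8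
      triality_cycle)

lemma triality2_so8: "A \<in> so8 \<times> so8 \<Longrightarrow> triality2 A = Lambda A"
  by (auto simp: triality2_def Lambda_def)

lemma subspace_so8_so8: "subspace (so8 \<times> so8)"
  by (intro subspace_Times subspace_so8)

lemma oo_mult_linear: "linear (\<lambda>X. oo_mult X Y)" "linear (\<lambda>Y. oo_mult X Y)"
  unfolding oo_mult_def
  by (auto intro!: linearI simp: algebra_simps sum.distrib scaleR_sum_right)

lemma linear_oo_cnj: "linear oo_cnj"
  unfolding oo_cnj_def
  by (auto intro!: linearI simp: algebra_simps sum.distrib scaleR_sum_right)

lemma bounded_bilinear_oo_prod: "bounded_bilinear oo_prod"
  unfolding bilinear_conv_bounded_bilinear [symmetric] bilinear_def oo_prod_def
  using linear_compose[OF oo_mult_linear(1) linear_oo_cnj] linear_compose[OF oo_mult_linear(2)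
      linear_oo_cnj]
  by (simp add: o_def)

lemma bounded_bilinear_so_act: "bounded_bilinear so_act"
  unfolding bilinear_conv_bounded_bilinear [symmetric] bilinear_def so_act_def
  by (auto intro!: linearI simp: matrix_mult_linear algebra_simps)

lemma bounded_bilinear_oo_wedge: "bounded_bilinear oo_wedge"
  unfolding bilinear_conv_bounded_bilinear [symmetric] bilinear_def oo_wedge_def
  by (auto intro!: linearI simp: matrix_mult_linear transpose_linear algebra_simps)

lemma bounded_bilinear_so_bracket: "bounded_bilinear so_bracket"
  unfolding bilinear_conv_bounded_bilinear [symmetric] bilinear_def so_bracket_def mat_bracket_def
  by (auto intro!: linearI simp: matrix_mult_linear algebra_simps)

lemmas prod_linear = bilinear_rules [OF bounded_bilinear_oo_prod]
  and act_linear = bilinear_rules [OF bounded_bilinear_so_act]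
  and wedge_linear = bilinear_rules [OF bounded_bilinear_oo_wedge]
  and bracket_linear = bilinear_rules [OF bounded_bilinear_so_bracket]
  and Lambda_linear = linear_rules [OF linear_Lambda] linear_rules [OF linear_Lambda_inv]

lemmas oo_linear = prod_linear act_linear wedge_linear bracket_linear Lambda_linear

lemma oo_mult_tensor: "oo_mult (oct_tensor a c) (oct_tensor b d) = oct_tensor (oct_mult a b)
    (oct_mult c d)"
proof -
  let ?e = oct_unit
  have bb: "bounded_bilinear (\<lambda>x y. oct_tensor (oct_mult x u) (oct_mult y v))" for u v
    by (auto intro!: bounded_bilinear_linearI linearI simp: oct_mult_linear tensor_linear)
  have bb': "bounded_bilinear (\<lambda>u v. oct_tensor (oct_mult x u) (oct_mult y v))" for x y
    by (auto intro!: bounded_bilinear_linearI linearI simp: oct_mult_linear tensor_linear)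
  have "oo_mult (oct_tensor a c) (oct_tensor b d) = (\<Sum>i\<in>UNIV. \<Sum>j\<in>UNIV. oct_tensor a c $ i $ j *\<^sub>R
     (\<Sum>k\<in>UNIV. \<Sum>l\<in>UNIV. oct_tensor b d $ k $ l *\<^sub>R oct_tensor (oct_mult (?e i) (?e k)) (oct_mult
         (?e j) (?e l))))"
    by (simp add: oo_mult_def scaleR_sum_right)
  also have "\<dots> = (\<Sum>i\<in>UNIV. \<Sum>j\<in>UNIV. oct_tensor a c $ i $ j *\<^sub>R oct_tensor (oct_mult (?e i) b)
      (oct_mult (?e j) d))"
    by (simp only: bilinear_tensor_sum[OF bb'])
  also have "\<dots> = oct_tensor (oct_mult a b) (oct_mult c d)"
    by (rule bilinear_tensor_sum[OF bb])
  finally show ?thesis .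
qed

lemma oo_cnj_tensor: "oo_cnj (oct_tensor a c) = oct_tensor (oct_cnj a) (oct_cnj c)"
proof -
  have "bounded_bilinear (\<lambda>x y. oct_tensor (oct_cnj x) (oct_cnj y))"
    by (auto intro!: bounded_bilinear_linearI linearI simp: oct_cnj_linear tensor_linear)
  then show ?thesis unfolding oo_cnj_def by (rule bilinear_tensor_sum)
qed

lemma oo_prod_tensor:
  "oo_prod (oct_tensor a c) (oct_tensor b d) = oct_tensor (oct_cnj (oct_mult a b)) (oct_cnj
      (oct_mult c d))"
  by (simp add: oo_prod_def oo_mult_tensor oo_cnj_tensor)

lemma so_act_tensor:
  assumes "A \<in> so8 \<times> so8"
  shows "so_act A (oct_tensor x y) = oct_tensor (fst A *v x) y + oct_tensor x (snd A *v y)"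
proof -
  have "transpose (snd A) = - snd A" using assms so8_transpose by auto
  then show ?thesis
    by (simp add: so_act_def matrix_mult_tensor tensor_mult_matrix matrix_minus_apply
        tensor_linear del: transpose_matrix_vector)
qed

lemma oo_wedge_tensor:
  "oo_wedge (oct_tensor a c) (oct_tensor b d) = ((c \<bullet> d) *\<^sub>R oct_wedge a b, (a \<bullet> b) *\<^sub>R oct_wedge c
      d)"
  by (simp add: oo_wedge_def transpose_tensor tensor_mult_tensor oct_wedge_def scaleR_diff_right
      inner_commute)

lemma oo_wedge_so8: "oo_wedge X Y \<in> so8 \<times> so8"
  by (simp add: oo_wedge_def so8_def transpose_linear matrix_transpose_mul)

lemma oo_wedge_swap: "oo_wedge X Y = - oo_wedge Y X"
  by (simp add: oo_wedge_def)

lemma oo_wedge_self: "oo_wedge X X = 0"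
  by (simp add: oo_wedge_def zero_prod_def)

lemma tensor_ext3:
  assumes "\<And>Y Z. linear (\<lambda>X. f X Y Z)" "\<And>X Z. linear (\<lambda>Y. f X Y Z)" "\<And>X Y. linear (\<lambda>Z. f X Y Z)"
    and "\<And>Y Z. linear (\<lambda>X. g X Y Z)" "\<And>X Z. linear (\<lambda>Y. g X Y Z)" "\<And>X Y. linear (\<lambda>Z. g X Y Z)"
    and "\<And>a b c d p q. f (oct_tensor a b) (oct_tensor c d) (oct_tensor p q) = g (oct_tensor a b)
        (oct_tensor c d) (oct_tensor p q)"
  shows "f X Y Z = g X Y Z"
proof -
  have "f (oct_tensor a b) (oct_tensor c d) Z = g (oct_tensor a b) (oct_tensor c d) Z" for a b c d
    by (rule tensor_ext[OF assms(3,6,7)])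
  then have "f (oct_tensor a b) Y Z = g (oct_tensor a b) Y Z" for a b
    by (rule tensor_ext[OF assms(2,5)])
  then show ?thesis by (rule tensor_ext[OF assms(1,4)])
qed

lemma tensor_ext2:
  assumes "\<And>Y. linear (\<lambda>X. f X Y)" "\<And>X. linear (\<lambda>Y. f X Y)"
    and "\<And>Y. linear (\<lambda>X. g X Y)" "\<And>X. linear (\<lambda>Y. g X Y)"
    and "\<And>a b c d. f (oct_tensor a b) (oct_tensor c d) = g (oct_tensor a b) (oct_tensor c d)"
  shows "f X Y = g X Y"
proof -
  have "f (oct_tensor a b) Y = g (oct_tensor a b) Y" for a b
    by (rule tensor_ext[OF assms(2,4,5)])
  then show ?thesis by (rule tensor_ext[OF assms(1,3)])
qed

lemma so_act_wedge_cyclic: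
  "so_act (oo_wedge X Y) Z + so_act (oo_wedge Y Z) X + so_act (oo_wedge Z X) Y = 0"
  by (simp add: so_act_def oo_wedge_def matrix_mul_assoc matrix_mult_linear)

lemma so_act_bracket: "so_act (so_bracket A B) X = so_act A (so_act B X) - so_act B (so_act A X)"
  by (simp add: so_act_def so_bracket_def mat_bracket_def matrix_mul_assoc matrix_mult_linear)

lemma so_bracket_wedge:
  assumes "A \<in> so8 \<times> so8"
  shows "so_bracket A (oo_wedge X Y) = oo_wedge (so_act A X) Y + oo_wedge X (so_act A Y)"
proof -
  have "transpose (fst A) = - fst A" "transpose (snd A) = - snd A" using assms so8_transpose by auto
  then show ?thesis
    by (simp add: so_bracket_def mat_bracket_def oo_wedge_def so_act_def transpose_linear
        matrix_transpose_mul
      matrix_mul_assoc matrix_mult_linear)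
qed

lemma so_bracket_jacobi:
  "so_bracket A (so_bracket B D) + so_bracket B (so_bracket D A) + so_bracket D (so_bracket A B) =
      0"
  by (simp add: so_bracket_def mat_bracket_def matrix_mul_assoc matrix_mult_linear zero_prod_def)

lemma triality_product:
  assumes "P \<in> so8"
  shows "P *v oct_cnj (oct_mult a b) =
    oct_cnj (oct_mult (triality_left P *v a) b) + oct_cnj (oct_mult a (triality_right P *v b))"
proof -
  have "(P *v oct_cnj (oct_mult a b)) \<bullet> z =
    (oct_cnj (oct_mult (triality_left P *v a) b) + oct_cnj (oct_mult a (triality_right P *v b)))
        \<bullet> z" for z
    using triality_triple_rotate[OF triality_triple_so8[OF assms], unfolded triality_triple_def,
        rule_format, of a b z]
    by (simp add: so8_skew[OF assms] oct_trilinear_def oct_cnj_inner inner_add_left)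
  then show ?thesis using vector_eq_rdot by blast
qed

text \<open>On tensors this is the product rule \<open>triality_product\<close> in each of the two factors.\<close>

lemma so_act_prod:
  assumes A: "A \<in> so8 \<times> so8"
  shows "so_act A (oo_prod X Y) = oo_prod (so_act (Lambda A) X) Y + oo_prod X (so_act (Lambda_inv
      A) Y)"
proof (rule tensor_ext2[where f = "\<lambda>X Y. so_act A (oo_prod X Y)"
      and g = "\<lambda>X Y. oo_prod (so_act (Lambda A) X) Y + oo_prod X (so_act (Lambda_inv A) Y)"])
  have so: "fst A \<in> so8" "snd A \<in> so8" using A by auto
  fix a b c d
  show "so_act A (oo_prod (oct_tensor a b) (oct_tensor c d)) =
     oo_prod (so_act (Lambda A) (oct_tensor a b)) (oct_tensor c d) + oo_prod (oct_tensor a b)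
         (so_act (Lambda_inv A) (oct_tensor c d))"
    using Lambda_so8[OF A] A
    by (simp add: oo_prod_tensor so_act_tensor prod_linear triality_product so tensor_linear)
      (simp add: Lambda_def Lambda_inv_def)
qed (auto intro!: linearI simp: oo_linear algebra_simps)

text \<open>How a difference of tensor products of composition laws splits into the two summands of
  the action of \<open>\<Lambda>(V \<and> W)\<close> or \<open>\<Lambda>\<^sup>2(V \<and> W)\<close>; the products \<open>\<alpha> \<beta> p \<otimes> q\<close> and \<open>4 k \<otimes> l\<close> cancel.\<close>

lemma tensor_difference:
  assumes "x = \<alpha> *\<^sub>R p + 2 *\<^sub>R k" "x' = \<alpha> *\<^sub>R p - 2 *\<^sub>R k" "y = \<beta> *\<^sub>R q + 2 *\<^sub>R l" "y' = \<beta> *\<^sub>R q - 2 *\<^sub>R l"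
  shows "oct_tensor x y - oct_tensor x' y' = 4 *\<^sub>R (\<beta> *\<^sub>R oct_tensor k q + \<alpha> *\<^sub>R oct_tensor p l)"
  unfolding assms
  by (simp add: oct_tensor_def vec_eq_iff algebra_simps)

lemma triality_right_wedge_split:
  "oct_mult (oct_mult p b) (oct_cnj a) = (a \<bullet> b) *\<^sub>R p + 2 *\<^sub>R (triality_right (oct_wedge a b) *v p)"
  "oct_mult (oct_mult p a) (oct_cnj b) = (a \<bullet> b) *\<^sub>R p - 2 *\<^sub>R (triality_right (oct_wedge a b) *v p)"
proof -
  have V: "oct_mult (oct_mult p a) (oct_cnj b) = (2 * (a \<bullet> b)) *\<^sub>R p - oct_mult (oct_mult p b)
      (oct_cnj a)"
    using oct_polar_right[of p b a] by (simp add: eq_diff_eq add.commute)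
  show "oct_mult (oct_mult p b) (oct_cnj a) = (a \<bullet> b) *\<^sub>R p + 2 *\<^sub>R (triality_right (oct_wedge a b)
      *v p)"
    "oct_mult (oct_mult p a) (oct_cnj b) = (a \<bullet> b) *\<^sub>R p - 2 *\<^sub>R (triality_right (oct_wedge a b) *v
        p)"
    unfolding triality_right_wedge_apply V by (simp_all add: vec_eq_iff field_simps)
qed

lemma triality_left_wedge_split:
  "oct_mult (oct_cnj a) (oct_mult b p) = (a \<bullet> b) *\<^sub>R p + 2 *\<^sub>R (triality_left (oct_wedge a b) *v p)"
  "oct_mult (oct_cnj b) (oct_mult a p) = (a \<bullet> b) *\<^sub>R p - 2 *\<^sub>R (triality_left (oct_wedge a b) *v p)"
proof -
  have V: "oct_mult (oct_cnj b) (oct_mult a p) = (2 * (a \<bullet> b)) *\<^sub>R p - oct_mult (oct_cnj a)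
      (oct_mult b p)"
    using oct_polar[of a b p] by (simp add: eq_diff_eq add.commute)
  show "oct_mult (oct_cnj a) (oct_mult b p) = (a \<bullet> b) *\<^sub>R p + 2 *\<^sub>R (triality_left (oct_wedge a b)
      *v p)"
    "oct_mult (oct_cnj b) (oct_mult a p) = (a \<bullet> b) *\<^sub>R p - 2 *\<^sub>R (triality_left (oct_wedge a b) *v p)"
    unfolding triality_left_wedge_apply V by (simp_all add: vec_eq_iff field_simps)
qed

text \<open>For \<open>V = a \<otimes> b\<close>, \<open>W = c \<otimes> d\<close> and \<open>U = p \<otimes> q\<close> the right-hand side is
  \<open>(p c) cnj a \<otimes> (q d) cnj b - (p a) cnj c \<otimes> (q b) cnj d\<close>, a difference as in \<open>tensor_difference\<close>.\<close>

lemma so_act_right_wedge: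
  "4 *\<^sub>R so_act (Lambda_inv (oo_wedge V W)) U = oo_prod V (oo_prod U W) - oo_prod W (oo_prod U V)"
proof (rule tensor_ext3[where f = "\<lambda>V W U. 4 *\<^sub>R so_act (Lambda_inv (oo_wedge V W)) U"
      and g = "\<lambda>V W U. oo_prod V (oo_prod U W) - oo_prod W (oo_prod U V)"])
  fix a b c d p q
  have "Lambda_inv (oo_wedge (oct_tensor a b) (oct_tensor c d)) \<in> so8 \<times> so8"
    by (intro Lambda_so8 oo_wedge_so8)
  then show "4 *\<^sub>R so_act (Lambda_inv (oo_wedge (oct_tensor a b) (oct_tensor c d))) (oct_tensor p
      q) =
    oo_prod (oct_tensor a b) (oo_prod (oct_tensor p q) (oct_tensor c d)) - oo_prod (oct_tensor c
        d) (oo_prod (oct_tensor p q) (oct_tensor a b))"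
    by (simp only: so_act_tensor oo_prod_tensor oct_cnj_mult[of _ "oct_cnj _"] oct_cnj_cnj
      tensor_difference[OF triality_right_wedge_split[where p = p and a = a and b = c]
          triality_right_wedge_split[where p = q and a = b and b = d]])
     (simp add: oo_wedge_tensor Lambda_inv_def triality_linear tensor_linear
       flip: scaleR_matrix_vector_assoc)
qed (auto intro!: linearI simp: oo_linear algebra_simps)

lemma so_act_left_wedge:
  "4 *\<^sub>R so_act (Lambda (oo_wedge V W)) U = oo_prod (oo_prod W U) V - oo_prod (oo_prod V U) W"
proof (rule tensor_ext3[where f = "\<lambda>V W U. 4 *\<^sub>R so_act (Lambda (oo_wedge V W)) U"
      and g = "\<lambda>V W U. oo_prod (oo_prod W U) V - oo_prod (oo_prod V U) W"])
  fix a b c d p q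
  have "Lambda (oo_wedge (oct_tensor a b) (oct_tensor c d)) \<in> so8 \<times> so8"
    by (intro Lambda_so8 oo_wedge_so8)
  then show "4 *\<^sub>R so_act (Lambda (oo_wedge (oct_tensor a b) (oct_tensor c d))) (oct_tensor p q) =
    oo_prod (oo_prod (oct_tensor c d) (oct_tensor p q)) (oct_tensor a b) - oo_prod (oo_prod
        (oct_tensor a b) (oct_tensor p q)) (oct_tensor c d)"
    by (simp only: so_act_tensor oo_prod_tensor oct_cnj_mult[of "oct_cnj _"] oct_cnj_cnj
      tensor_difference[OF triality_left_wedge_split[where p = p and a = a and b = c]
          triality_left_wedge_split[where p = q and a = b and b = d]])
     (simp add: oo_wedge_tensor Lambda_def triality_linear tensor_linear
       flip: scaleR_matrix_vector_assoc)
qed (auto intro!: linearI simp: oo_linear algebra_simps)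

lemma oo_prod_cyclic: "oo_prod X Y \<bullet> Z = oo_prod Y Z \<bullet> X"
proof -
  have tt: "oct_tensor a b \<bullet> oct_tensor c d = (a \<bullet> c) * (b \<bullet> d)" for a b c d
    by (simp add: inner_tensor tensor_apply)
  have cyc: "oct_cnj (oct_mult x y) \<bullet> z = oct_cnj (oct_mult y z) \<bullet> x" for x y z
    using oct_trilinear_cyclic[of x y z] by (simp add: oct_trilinear_def oct_cnj_inner)
  show ?thesis
    by (rule tensor_ext3[where f = "\<lambda>X Y Z. oo_prod X Y \<bullet> Z" and g = "\<lambda>X Y Z. oo_prod Y Z \<bullet> X"])
      (auto intro!: linearI simp: oo_linear inner_add_left inner_add_right oo_prod_tensor tt
        cyc[of _ _ "_ :: octonion"] , metis cyc)
qed

lemma so_act_skew: assumes "A \<in> so8 \<times> so8" shows "so_act A X \<bullet> Y = - (X \<bullet> so_act A Y)"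
proof -
  have "transpose (fst A) = - fst A" "transpose (snd A) = - snd A" using assms so8_transpose by auto
  then show ?thesis
    by (simp add: so_act_def inner_diff_left inner_diff_right matrix_inner_mult_left[of "fst A"]
        matrix_inner_mult_right[of X "snd A"]
      matrix_mult_linear)
qed

lemma inner_oo_wedge:
  assumes A: "A \<in> so8 \<times> so8" shows "A \<bullet> oo_wedge X Y = - 2 * (so_act A X \<bullet> Y)"
proof (rule tensor_ext2[where f = "\<lambda>X Y. A \<bullet> oo_wedge X Y" and g = "\<lambda>X Y. - 2 * (so_act A X \<bullet> Y)"])
  have tt: "oct_tensor a b \<bullet> oct_tensor c d = (a \<bullet> c) * (b \<bullet> d)" for a b c d
    by (simp add: inner_tensor tensor_apply)
  have so: "fst A \<in> so8" "snd A \<in> so8" using A by auto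
  have w: "P \<bullet> oct_wedge x y = - 2 * ((P *v x) \<bullet> y)" if "P \<in> so8" for P x y
    using so8_skew[OF that, of y x] by (simp add: inner_wedge inner_commute)
  fix a b c d
  show "A \<bullet> oo_wedge (oct_tensor a b) (oct_tensor c d) = - 2 * (so_act A (oct_tensor a b) \<bullet>
      oct_tensor c d)"
    by (simp add: oo_wedge_tensor so_act_tensor[OF A] inner_prod_def w so inner_add_left tt
        algebra_simps)
qed (auto intro!: linearI simp: oo_linear inner_add_left inner_add_right algebra_simps)

lemma Lambda_adjoint:
  assumes "A \<in> so8 \<times> so8" "B \<in> so8 \<times> so8"
  shows "A \<bullet> Lambda B = Lambda_inv A \<bullet> B" "A \<bullet> Lambda_inv B = Lambda A \<bullet> B"
  using assms by (auto simp: inner_prod_def Lambda_def Lambda_inv_def triality_left_adjoint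
      inner_commute[of _ "triality_left _"]
     inner_commute[of "triality_right _"] )

text \<open>The equivariance \<open>so_act_prod\<close> in dual form: the inner product of the sum with any \<open>A\<close>
  in \<open>so8 \<times> so8\<close> is the derivative of the trilinear form \<open>\<langle>U, oo_prod V W\<rangle>\<close> along \<open>A\<close>, up to a
  factor.\<close>

lemma oo_wedge_prod:
  "oo_wedge U (oo_prod V W) + Lambda_inv (oo_wedge V (oo_prod W U)) + Lambda (oo_wedge W (oo_prod
      U V)) = 0" (is "?S = 0")
proof -
  have S: "?S \<in> so8 \<times> so8"
    by (intro subspace_add[OF subspace_so8_so8] Lambda_so8 oo_wedge_so8)
  have "A \<bullet> ?S = 0" if A: "A \<in> so8 \<times> so8" for A
  proof -
    note l = Lambda_so8(1)[OF A] and r = Lambda_so8(2)[OF A]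
    have 1: "so_act A U \<bullet> oo_prod V W = - (so_act A (oo_prod V W) \<bullet> U)"
      using so_act_skew[OF A, of U "oo_prod V W"] by (simp add: inner_commute)
    have 2: "so_act (Lambda A) V \<bullet> oo_prod W U = oo_prod (so_act (Lambda A) V) W \<bullet> U"
      using oo_prod_cyclic[of "so_act (Lambda A) V" W U] by (simp add: inner_commute)
    have 3: "so_act (Lambda_inv A) W \<bullet> oo_prod U V = oo_prod V (so_act (Lambda_inv A) W) \<bullet> U"
      using oo_prod_cyclic[of U V "so_act (Lambda_inv A) W"] by (simp add: inner_commute)
    show ?thesis
      by (simp add: inner_add_right Lambda_adjoint A oo_wedge_so8 inner_oo_wedge l r 1 2 3
          so_act_prod[OF A] inner_add_left)
  qed
  from this[OF S] show ?thesis by simp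
qed

section \<open>The Jacobi identity and an invariant form\<close>

text \<open>The bracket with \<open>\<Lambda>\<close> and \<open>\<Lambda>\<^sup>2\<close> extended linearly, which makes it bilinear on the whole
  ambient space. It agrees with the given bracket on \<open>e8\<close>.\<close>

fun e8_br :: "e8_vec \<Rightarrow> e8_vec \<Rightarrow> e8_vec" where
  "e8_br (A, u, v, w) (B, x, y, z) =
    (so_bracket A B - 4 *\<^sub>R oo_wedge u x - 4 *\<^sub>R Lambda_inv (oo_wedge v y) - 4 *\<^sub>R Lambda (oo_wedge w
        z),
     so_act A x - so_act B u + oo_prod v z - oo_prod y w,
     so_act (Lambda A) y - so_act (Lambda B) v + oo_prod w x - oo_prod z u,
     so_act (Lambda_inv A) z - so_act (Lambda_inv B) w + oo_prod u y - oo_prod x v)"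

lemma e8_bracket_eq: "X \<in> e8 \<Longrightarrow> Y \<in> e8 \<Longrightarrow> e8_bracket X Y = e8_br X Y"
  by (cases X; cases Y)
    (auto simp: e8_def triality2_so8 Lambda_so8[simplified] oo_wedge_so8 oo_prod_def simp del:
        mem_Times_iff)

lemma so_bracket_so8: "A \<in> so8 \<times> so8 \<Longrightarrow> B \<in> so8 \<times> so8 \<Longrightarrow> so_bracket A B \<in> so8 \<times> so8"
  by (auto simp: so_bracket_def so8_bracket)

lemma e8_mem: "(A, u, v, w) \<in> e8 \<longleftrightarrow> A \<in> so8 \<times> so8"
  by (auto simp: e8_def)

lemma e8_br_closed: assumes "X \<in> e8" "Y \<in> e8" shows "e8_br X Y \<in> e8"
proof -
  obtain A u v w B x y z where XY: "X = (A, u, v, w)" "Y = (B, x, y, z)" by (metis prod.exhaust)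
  then have "A \<in> so8 \<times> so8" "B \<in> so8 \<times> so8" using assms by (auto simp only: e8_mem)
  then show ?thesis unfolding XY e8_br.simps e8_mem
    by (intro subspace_diff[OF subspace_so8_so8] subspace_scale[OF subspace_so8_so8]
        so_bracket_so8 Lambda_so8 oo_wedge_so8)
qed

lemma bounded_bilinear_e8_br: "bounded_bilinear e8_br"
  unfolding bilinear_conv_bounded_bilinear [symmetric] bilinear_def
proof (intro conjI allI linearI)
  fix X Y Z :: e8_vec and c :: real
  show "e8_br X (Y + Z) = e8_br X Y + e8_br X Z" "e8_br (Y + Z) X = e8_br Y X + e8_br Z X"
    by (cases X rule: prod_cases4; cases Y rule: prod_cases4; cases Z rule: prod_cases4;
        simp add: oo_linear algebra_simps)+
  show "e8_br X (c *\<^sub>R Y) = c *\<^sub>R e8_br X Y" "e8_br (c *\<^sub>R Y) X = c *\<^sub>R e8_br Y X"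
    by (cases X rule: prod_cases4; cases Y rule: prod_cases4; simp add: oo_linear algebra_simps)+
qed

lemma e8_br_self: "e8_br X X = 0"
proof (cases X rule: prod_cases4)
  case (fields A u v w)
  have "so_bracket A A = 0" by (simp add: so_bracket_def mat_bracket_def zero_prod_def)
  then have "e8_br X X = (0, 0, 0, 0)"
    by (simp add: fields oo_wedge_self Lambda_linear)
  then show ?thesis by (simp add: zero_prod_def)
qed

text \<open>This symmetry of order three permutes the last three components, so that statements
  about them reduce to the first of the three.\<close>

fun e8_rot :: "e8_vec \<Rightarrow> e8_vec" where
  "e8_rot (A, u, v, w) = (Lambda A, v, w, u)"

lemma Lambda_bracket:
  assumes "A \<in> so8 \<times> so8" "B \<in> so8 \<times> so8"
  shows "Lambda (so_bracket A B) = so_bracket (Lambda A) (Lambda B)"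
    "Lambda_inv (so_bracket A B) = so_bracket (Lambda_inv A) (Lambda_inv B)"
proof -
  have *: "Lambda (so_bracket A B) = so_bracket (Lambda A) (Lambda B)"
      if "A \<in> so8 \<times> so8" "B \<in> so8 \<times> so8" for A B
    using that by (auto simp: Lambda_def so_bracket_def triality_left_bracket)
  show "Lambda (so_bracket A B) = so_bracket (Lambda A) (Lambda B)" by (rule *[OF assms])
  show "Lambda_inv (so_bracket A B) = so_bracket (Lambda_inv A) (Lambda_inv B)"
    using *[OF assms] *[of "Lambda A" "Lambda B"] assms by (metis so_bracket_so8 Lambda_so8(1,3))
qed

lemma e8_rot_mem: "X \<in> e8 \<Longrightarrow> e8_rot X \<in> e8"
  by (cases X) (simp only: e8_rot.simps e8_mem Lambda_so8)

lemma linear_e8_rot: "linear e8_rot"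
proof (rule linearI)
  fix X Y :: e8_vec and c :: real
  show "e8_rot (X + Y) = e8_rot X + e8_rot Y" "e8_rot (c *\<^sub>R X) = c *\<^sub>R e8_rot X"
    by (cases X rule: prod_cases4; cases Y rule: prod_cases4; simp add: Lambda_linear)+
qed

lemma e8_rot_br:
  assumes "X \<in> e8" "Y \<in> e8"
  shows "e8_rot (e8_br X Y) = e8_br (e8_rot X) (e8_rot Y)"
proof -
  obtain A u v w B x y z where XY: "X = (A, u, v, w)" "Y = (B, x, y, z)" by (metis prod.exhaust)
  then have AB: "A \<in> so8 \<times> so8" "B \<in> so8 \<times> so8" using assms by (auto simp only: e8_mem)
  show ?thesis unfolding XY
    by (simp add: Lambda_linear Lambda_bracket AB Lambda_so8[OF AB(1)] Lambda_so8[OF AB(2)]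
        Lambda_so8[OF oo_wedge_so8] algebra_simps)
qed

definition e8_jac :: "e8_vec \<Rightarrow> e8_vec \<Rightarrow> e8_vec \<Rightarrow> e8_vec" where
  "e8_jac X Y Z = e8_br X (e8_br Y Z) + e8_br Y (e8_br Z X) + e8_br Z (e8_br X Y)"

text \<open>Besides the Jacobi identity of \<open>so8\<close>: equivariance of the wedge moves every \<open>A\<close> into one
  of its arguments, where the terms cancel in pairs; the terms with three tensors cancel by
  \<open>oo_wedge_prod\<close>.\<close>

lemma e8_jac_so:
  assumes "X \<in> e8" "Y \<in> e8" "Z \<in> e8"
  shows "fst (e8_jac X Y Z) = 0"
proof -
  obtain A u v w B x y z D p q s where XYZ: "X = (A, u, v, w)" "Y = (B, x, y, z)" "Z = (D, p, q, s)"
    by (metis prod.exhaust)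
  then have so: "A \<in> so8 \<times> so8" "B \<in> so8 \<times> so8" "D \<in> so8 \<times> so8" using assms
      by (auto simp only: e8_mem)
  have r: "so_bracket A (Lambda_inv (oo_wedge v w)) =
     Lambda_inv (oo_wedge (so_act (Lambda A) v) w) + Lambda_inv (oo_wedge v (so_act (Lambda A)
         w))" if "A \<in> so8 \<times> so8" for A v w
  proof -
    have "so_bracket A (Lambda_inv (oo_wedge v w)) = Lambda_inv (so_bracket (Lambda A) (oo_wedge v
        w))"
      using that by (simp only: Lambda_bracket oo_wedge_so8 Lambda_so8)
    then show ?thesis using that by (simp add: so_bracket_wedge Lambda_so8 Lambda_linear)
  qed
  have l: "so_bracket A (Lambda (oo_wedge v w)) =
     Lambda (oo_wedge (so_act (Lambda_inv A) v) w) + Lambda (oo_wedge v (so_act (Lambda_inv A)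
         w))" if "A \<in> so8 \<times> so8" for A v w
  proof -
    have "so_bracket A (Lambda (oo_wedge v w)) = Lambda (so_bracket (Lambda_inv A) (oo_wedge v w))"
      using that by (simp only: Lambda_bracket oo_wedge_so8 Lambda_so8)
    then show ?thesis using that by (simp add: so_bracket_wedge Lambda_so8 Lambda_linear)
  qed
  have E: "Lambda (oo_wedge w (oo_prod u v)) = - oo_wedge u (oo_prod v w) - Lambda_inv (oo_wedge v
      (oo_prod w u))" for u v w
    using oo_wedge_prod[of u v w] by (simp add: eq_neg_iff_add_eq_0 algebra_simps)
  have J: "so_bracket A (so_bracket B D) = - so_bracket B (so_bracket D A) - so_bracket D
      (so_bracket A B)"
    using so_bracket_jacobi[of A B D] by (simp add: eq_neg_iff_add_eq_0 algebra_simps)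
  show ?thesis unfolding XYZ e8_jac_def
    by (simp add: oo_linear so_bracket_wedge so r l E J, simp add: oo_wedge_swap[of "so_act _ _"]
        Lambda_linear,
        simp add: algebra_simps)
qed

text \<open>The terms are sorted by the summands in which their three arguments lie: two arguments
  in the \<open>so8\<close> part are settled by \<open>so_act_bracket\<close>, one by \<open>so_act_prod\<close>, three in the first
  tensor summand by the cyclic identity \<open>so_act_wedge_cyclic\<close>, two in the second or third one by
  \<open>so_act_right_wedge\<close> and \<open>so_act_left_wedge\<close>.\<close>

lemma e8_jac_first:
  assumes "X \<in> e8" "Y \<in> e8" "Z \<in> e8"
  shows "fst (snd (e8_jac X Y Z)) = 0"
proof -
  obtain A u v w B x y z D p q s where XYZ: "X = (A, u, v, w)" "Y = (B, x, y, z)" "Z = (D, p, q, s)"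
    by (metis prod.exhaust)
  then have so: "A \<in> so8 \<times> so8" "B \<in> so8 \<times> so8" "D \<in> so8 \<times> so8" using assms
      by (auto simp only: e8_mem)
  have W: "so_act (oo_wedge x p) u = - so_act (oo_wedge p u) x - so_act (oo_wedge u x) p"
    using so_act_wedge_cyclic[of x p u] by (simp add: eq_neg_iff_add_eq_0 algebra_simps)
  show ?thesis unfolding XYZ e8_jac_def
    by (simp add: oo_linear so_act_bracket so_act_prod so so_act_right_wedge so_act_left_wedge W)
        (simp add: algebra_simps)
qed

lemma e8_jac_rot:
  assumes "X \<in> e8" "Y \<in> e8" "Z \<in> e8"
  shows "e8_rot (e8_jac X Y Z) = e8_jac (e8_rot X) (e8_rot Y) (e8_rot Z)"
  using assms by (simp add: e8_jac_def linear_add[OF linear_e8_rot] e8_rot_br e8_br_closed)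

lemma e8_jacobi:
  assumes "X \<in> e8" "Y \<in> e8" "Z \<in> e8"
  shows "e8_br X (e8_br Y Z) + e8_br Y (e8_br Z X) + e8_br Z (e8_br X Y) = 0"
proof -
  obtain C r s t where J: "e8_jac X Y Z = (C, r, s, t)" by (metis prod.exhaust)
  have rot: "e8_rot X \<in> e8" "e8_rot Y \<in> e8" "e8_rot Z \<in> e8" using assms e8_rot_mem by auto
  have "C = 0" "r = 0" using e8_jac_so[OF assms] e8_jac_first[OF assms] by (simp_all add: J)
  moreover have "s = 0" using e8_jac_first[OF rot] by (simp add: J e8_jac_rot[OF assms, symmetric])
  moreover have "t = 0" using e8_jac_first[OF rot[THEN e8_rot_mem]]
    by (simp add: J e8_jac_rot[OF assms, symmetric] e8_jac_rot[OF rot, symmetric])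
  ultimately show ?thesis using J by (simp add: e8_jac_def zero_prod_def)
qed

text \<open>The weight \<open>1/8\<close> balances the factor \<open>4\<close> of the bracket against the factor \<open>2\<close> in
  \<open>inner_oo_wedge\<close>.\<close>

fun e8_form :: "e8_vec \<Rightarrow> e8_vec \<Rightarrow> real" where
  "e8_form (A, u, v, w) (B, x, y, z) = (A \<bullet> B) / 8 + u \<bullet> x + v \<bullet> y + w \<bullet> z"

lemma so_bracket_invariant:
  assumes "A \<in> so8 \<times> so8" "B \<in> so8 \<times> so8" "D \<in> so8 \<times> so8"
  shows "so_bracket A B \<bullet> D = A \<bullet> so_bracket B D"
proof -
  have "mat_bracket P Q \<bullet> R = P \<bullet> mat_bracket Q R" if "P \<in> so8" "Q \<in> so8" "R \<in> so8" for P Q R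
    using that so8_transpose[of Q]
    by (simp add: mat_bracket_def inner_diff_left inner_diff_right matrix_inner_mult_left[of Q P]
        matrix_inner_mult_right[of P Q]
       matrix_mult_linear)
  then show ?thesis using assms by (auto simp: inner_prod_def so_bracket_def)
qed

lemma e8_form_invariant:
  assumes "X \<in> e8" "Y \<in> e8" "Z \<in> e8"
  shows "e8_form (e8_br X Y) Z = e8_form X (e8_br Y Z)"
proof -
  obtain A u v w B x y z D p q s where XYZ: "X = (A, u, v, w)" "Y = (B, x, y, z)" "Z = (D, p, q, s)"
    by (metis prod.exhaust)
  then have so: "A \<in> so8 \<times> so8" "B \<in> so8 \<times> so8" "D \<in> so8 \<times> so8" using assms
      by (auto simp only: e8_mem)
  have wD: "oo_wedge u x \<bullet> D = - 2 * (so_act D u \<bullet> x)" "Lambda_inv (oo_wedge u x) \<bullet> D = - 2 *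
      (so_act (Lambda D) u \<bullet> x)"
     "Lambda (oo_wedge u x) \<bullet> D = - 2 * (so_act (Lambda_inv D) u \<bullet> x)" for u x
    using so Lambda_so8[OF so(3)]
    by (simp_all add: inner_commute[of _ D] Lambda_adjoint oo_wedge_so8 inner_oo_wedge)
  have wA: "A \<bullet> oo_wedge u x = - 2 * (so_act A u \<bullet> x)" "A \<bullet> Lambda_inv (oo_wedge u x) = - 2 *
      (so_act (Lambda A) u \<bullet> x)"
     "A \<bullet> Lambda (oo_wedge u x) = - 2 * (so_act (Lambda_inv A) u \<bullet> x)" for u x
    using so Lambda_so8[OF so(1)]
    by (simp_all add: Lambda_adjoint oo_wedge_so8 inner_oo_wedge)
  have sk: "u \<bullet> so_act B p = - (so_act B u \<bullet> p)" "u \<bullet> so_act D x = - (so_act D u \<bullet> x)"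
    "v \<bullet> so_act (Lambda B) q = - (so_act (Lambda B) v \<bullet> q)"
        "v \<bullet> so_act (Lambda D) y = - (so_act (Lambda D) v \<bullet> y)"
    "w \<bullet> so_act (Lambda_inv B) s = - (so_act (Lambda_inv B) w \<bullet> s)"
        "w \<bullet> so_act (Lambda_inv D) z = - (so_act (Lambda_inv D) w \<bullet> z)"
    using so_act_skew[OF so(2), of u p] so_act_skew[OF so(3), of u x]
      so_act_skew[OF Lambda_so8(1)[OF so(2)], of v q] so_act_skew[OF Lambda_so8(1)[OF so(3)], of v
          y]
      so_act_skew[OF Lambda_so8(2)[OF so(2)], of w s] so_act_skew[OF Lambda_so8(2)[OF so(3)], of w
          z] by simp_all
  have pr: "u \<bullet> oo_prod y s = oo_prod s u \<bullet> y"  "u \<bullet> oo_prod q z = oo_prod z u \<bullet> q"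
     "v \<bullet> oo_prod z p = oo_prod v z \<bullet> p"  "v \<bullet> oo_prod s x = oo_prod x v \<bullet> s"
     "w \<bullet> oo_prod x q = oo_prod w x \<bullet> q" "w \<bullet> oo_prod p y = oo_prod y w \<bullet> p"
     "oo_prod s u \<bullet> y = oo_prod u y \<bullet> s"
    by (metis oo_prod_cyclic inner_commute)+
  show ?thesis unfolding XYZ e8_br.simps e8_form.simps
    by (simp only: inner_diff_left inner_diff_right inner_add_left inner_add_right
        inner_scaleR_left inner_scaleR_right
        so_bracket_invariant[OF so] wD wA sk pr) (simp add: field_simps)
qed

section \<open>The torus\<close>

text \<open>Octonions are grouped into the four planes spanned by \<open>e\<^sub>2\<^sub>a\<close> and \<open>e\<^sub>2\<^sub>a\<^sub>+\<^sub>1\<close>. This grouping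
  fits the multiplication table: products of units of two planes lie in a single plane, so \<open>\<lambda>\<close>
  maps combinations of the rotations of these planes to such combinations again.\<close>

definition re_unit :: "nat \<Rightarrow> octonion" where "re_unit a = oct_unit (of_nat (2 * a))"
definition im_unit :: "nat \<Rightarrow> octonion" where "im_unit a = oct_unit (of_nat (2 * a + 1))"
definition rotation :: "nat \<Rightarrow> mat8" where "rotation a = oct_wedge (im_unit a) (re_unit a)"

text \<open>The maximal torus of \<open>so8\<close> that rotates these four planes.\<close>

definition torus4 :: "real \<Rightarrow> real \<Rightarrow> real \<Rightarrow> real \<Rightarrow> mat8" where
  "torus4 a b c d = a *\<^sub>R rotation 0 + b *\<^sub>R rotation 1 + c *\<^sub>R rotation 2 + d *\<^sub>R rotation 3"

lemma inner_unit: "x \<bullet> oct_unit i = x $ i" "oct_unit i \<bullet> x = x $ i"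
  by (simp_all add: oct_unit_def inner_axis inner_axis')

lemma torus4_nth:
  "(torus4 a b c d *v x) $ 0 = - (a * x $ 1)" "(torus4 a b c d *v x) $ 1 = a * x $ 0"
  "(torus4 a b c d *v x) $ 2 = - (b * x $ 3)" "(torus4 a b c d *v x) $ 3 = b * x $ 2"
  "(torus4 a b c d *v x) $ 4 = - (c * x $ 5)" "(torus4 a b c d *v x) $ 5 = c * x $ 4"
  "(torus4 a b c d *v x) $ 6 = - (d * x $ 7)" "(torus4 a b c d *v x) $ 7 = d * x $ 6"
  by (simp_all add: torus4_def rotation_def re_unit_def im_unit_def matrix_vector_mult_add_rdistrib
      scaleR_matrix_vector_assoc[symmetric] wedge_apply inner_unit oct_unit_nth neq_8)

lemma torus4_add: "torus4 a b c d + torus4 a' b' c' d' = torus4 (a + a') (b + b') (c + c') (d + d')"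
  by (simp add: torus4_def algebra_simps)

lemma torus4_scale: "r *\<^sub>R torus4 a b c d = torus4 (r * a) (r * b) (r * c) (r * d)"
  by (simp add: torus4_def algebra_simps)

lemma torus4_zero: "torus4 0 0 0 0 = 0"
  by (simp add: torus4_def)

lemma torus4_so8: "torus4 a b c d \<in> so8"
  unfolding torus4_def rotation_def
  by (intro subspace_add subspace_scale subspace_so8 wedge_in_so8)

lemma rotation_torus4:
  "rotation 0 = torus4 1 0 0 0" "rotation 1 = torus4 0 1 0 0" "rotation (Suc 0) = torus4 0 1 0 0"
  "rotation 2 = torus4 0 0 1 0" "rotation 3 = torus4 0 0 0 1"
  by (simp_all add: torus4_def)

lemma torus4_inner: "torus4 a b c d \<bullet> torus4 a' b' c' d' = 2 * (a * a' + b * b' + c * c' + d * d')"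
proof -
  have "torus4 a b c d \<bullet> rotation 0 = 2 * a" "torus4 a b c d \<bullet> rotation 1 = 2 * b"
    "torus4 a b c d \<bullet> rotation 2 = 2 * c" "torus4 a b c d \<bullet> rotation 3 = 2 * d"
    by (simp_all add: rotation_def inner_wedge inner_unit re_unit_def im_unit_def torus4_nth
        oct_unit_nth)
  then show ?thesis
    unfolding torus4_def[of a'] by (simp add: inner_add_right algebra_simps)
qed

lemma torus4_eq_iff: "torus4 a b c d = torus4 a' b' c' d' \<longleftrightarrow> a = a' \<and> b = b' \<and> c = c' \<and> d = d'"
proof
  assume eq: "torus4 a b c d = torus4 a' b' c' d'"
  show "a = a' \<and> b = b' \<and> c = c' \<and> d = d'"
    using arg_cong[OF eq, of "\<lambda>M. M \<bullet> torus4 1 0 0 0"] arg_cong[OF eq, of "\<lambda>M. M \<bullet> torus4 0 1 0 0"]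
      arg_cong[OF eq, of "\<lambda>M. M \<bullet> torus4 0 0 1 0"] arg_cong[OF eq, of "\<lambda>M. M \<bullet> torus4 0 0 0 1"]
    by (simp add: torus4_inner)
qed simp

lemma torus4_commute: "mat_bracket (torus4 a b c d) (torus4 a' b' c' d') = 0"
  by (simp add: mat_bracket_def matrix_eq matrix_vector_mult_diff_rdistrib vec_eq_8 torus4_nth
      flip: matrix_vector_mul_assoc)

lemma triality_left_rotation:
  "triality_left (rotation 0) = torus4 (- 1/2) (- 1/2) (- 1/2) (1/2)"
  "triality_left (rotation 1) = torus4 (1/2) (1/2) (- 1/2) (1/2)"
  "triality_left (rotation 2) = torus4 (1/2) (- 1/2) (1/2) (1/2)"
  "triality_left (rotation 3) = torus4 (- 1/2) (1/2) (1/2) (1/2)"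
  by (simp_all add: matrix_eq rotation_def triality_left_wedge_apply vec_eq_8 torus4_nth
      re_unit_def im_unit_def
      oct_mult_nth oct_cnj_nth oct_unit_nth neq_8)

lemma triality_left_torus4: "triality_left (torus4 a b c d) =
   torus4 ((- a + b + c - d) / 2) ((- a + b - c + d) / 2) ((- a - b + c + d) / 2) ((a + b + c + d)
       / 2)"
  unfolding torus4_def[of a b c d]
  by (simp add: triality_linear
      triality_left_rotation[unfolded One_nat_def] torus4_scale torus4_add torus4_eq_iff
          triality_left_rotation)

lemma triality_right_torus4: "triality_right (torus4 a b c d) =
   torus4 ((- a - b - c + d) / 2) ((b + a - c + d) / 2) ((a - b + c + d) / 2) ((- a + b + c + d) /
       2)"
  unfolding triality_cycle(1)[OF torus4_so8, symmetric] triality_left_torus4 torus4_eq_iff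
  by (simp add: field_simps)

lemma left_right_e1: "oct_left (oct_unit 1) = torus4 1 1 1 (- 1)"
    "oct_right (oct_unit 1) = torus4 1 (- 1) (- 1) 1"
  by (simp_all add: matrix_eq vec_eq_8 torus4_nth oct_mult_nth oct_unit_nth neq_8)

text \<open>In these coordinates \<open>L\<^bsub>e1\<^esub> = (1, 1, 1, -1)\<close> and \<open>R\<^bsub>e1\<^esub> = (1, -1, -1, 1)\<close>.\<close>

lemma torus2_iff: "Q \<in> torus2 \<longleftrightarrow> (\<exists>x y. Q = torus4 (x + y) (x - y) (x - y) (y - x))"
proof -
  have "Q \<in> torus2 \<longleftrightarrow> (\<exists>x y. Q - x *\<^sub>R torus4 1 1 1 (- 1) = y *\<^sub>R torus4 1 (- 1) (- 1) 1)"
    by (simp add: torus2_def left_right_e1 span_breakdown_eq span_singleton image_iff)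
  also have "\<dots> \<longleftrightarrow> (\<exists>x y. Q = torus4 (x + y) (x - y) (x - y) (y - x))"
    by (simp add: diff_eq_eq torus4_scale torus4_add add.commute)
  finally show ?thesis .
qed

lemma subspace_torus2: "subspace torus2"
  by (simp add: torus2_def)

lemma torus2_so8: "torus2 \<subseteq> so8"
  by (auto simp: torus2_iff torus4_so8)

text \<open>\<open>\<lambda>\<close> maps \<open>L\<^bsub>e1\<^esub>\<close> to \<open>R\<^bsub>e1\<^esub>\<close> and \<open>R\<^bsub>e1\<^esub>\<close> to \<open>- L\<^bsub>e1\<^esub> - R\<^bsub>e1\<^esub>\<close>.\<close>

lemma torus2_triality:
  assumes "Q \<in> torus2" shows "triality_left Q \<in> torus2" "triality_right Q \<in> torus2"
proof -
  obtain x y where Q: "Q = torus4 (x + y) (x - y) (x - y) (y - x)" using assms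
      by (auto simp: torus2_iff)
  show "triality_left Q \<in> torus2" unfolding torus2_iff
    by (rule exI[of _ "- y"], rule exI[of _ "x - y"]) (simp add: Q triality_left_torus4
        torus4_eq_iff field_simps)
  show "triality_right Q \<in> torus2" unfolding torus2_iff
    by (rule exI[of _ "y - x"], rule exI[of _ "- x"]) (simp add: Q triality_right_torus4
        torus4_eq_iff field_simps)
qed

section \<open>The subalgebra\<close>

definition complex_tensor :: "octonion \<times> octonion \<Rightarrow> mat8" where
  "complex_tensor p = oct_tensor (fst p) (oct_unit 0) + oct_tensor (snd p) (oct_unit 1)"

lemma linear_complex_tensor: "linear complex_tensor"
  by (rule linearI) (simp_all add: complex_tensor_def tensor_linear algebra_simps)

lemma oct_tensor_complex_range: "oct_tensor_complex = range complex_tensor"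
proof
  have "x \<in> range complex_tensor" if x: "x = oct_tensor a y" and y: "y \<in> oct_complex" for x a y
  proof -
    obtain r where "y - r *\<^sub>R oct_unit 0 \<in> span {oct_unit 1}"
      using y unfolding oct_complex_def span_breakdown_eq[of y] by blast
    then obtain s where "y - r *\<^sub>R oct_unit 0 = s *\<^sub>R oct_unit 1" by (auto simp: span_singleton)
    then have "y = r *\<^sub>R oct_unit 0 + s *\<^sub>R oct_unit 1" by (simp add: diff_eq_eq add.commute)
    then show ?thesis
      by (intro range_eqI[of _ _ "(r *\<^sub>R a, s *\<^sub>R a)"]) (simp add: x complex_tensor_def tensor_linear)
  qed
  then show "oct_tensor_complex \<subseteq> range complex_tensor"
    unfolding oct_tensor_complex_def
    by (intro span_minimal linear_subspace_image[OF linear_complex_tensor subspace_UNIV]) blast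
  have "oct_unit 0 \<in> oct_complex" "oct_unit 1 \<in> oct_complex"
      by (auto simp: oct_complex_def span_base)
  then show "range complex_tensor \<subseteq> oct_tensor_complex"
    unfolding oct_tensor_complex_def complex_tensor_def
        by (intro image_subsetI span_add; intro span_base) blast+
qed

lemma oct_tensor_complex_iff:
  "X \<in> oct_tensor_complex \<longleftrightarrow> (\<exists>a b. X = oct_tensor a (oct_unit 0) + oct_tensor b (oct_unit 1))"
  by (simp add: oct_tensor_complex_range image_iff complex_tensor_def)

lemma subspace_oct_tensor_complex: "subspace oct_tensor_complex"
  by (simp add: oct_tensor_complex_def)

lemma tensor_mem: "oct_tensor a (oct_unit 0) \<in> oct_tensor_complex"
    "oct_tensor a (oct_unit 1) \<in> oct_tensor_complex"
  by (auto simp: oct_tensor_complex_def oct_complex_def intro!: span_base)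

lemma complex_unit_mult:
  "oct_cnj (oct_unit 1) = - oct_unit 1"
  "oct_mult (oct_unit 1) (oct_unit 1) = - oct_unit 0"
  by (simp_all add: vec_eq_8 oct_mult_nth oct_unit_nth oct_cnj_nth neq_8)

lemma oo_prod_complex:
  assumes "X \<in> oct_tensor_complex" "Y \<in> oct_tensor_complex"
  shows "oo_prod X Y \<in> oct_tensor_complex"
proof -
  obtain a b c d where XY: "X = oct_tensor a (oct_unit 0) + oct_tensor b (oct_unit 1)"
    "Y = oct_tensor c (oct_unit 0) + oct_tensor d (oct_unit 1)" using assms
        by (auto simp: oct_tensor_complex_iff)
  show ?thesis unfolding XY
    by (simp add: prod_linear oo_prod_tensor complex_unit_mult oct_cnj_linear tensor_linear)
      (intro subspace_add subspace_diff subspace_neg subspace_oct_tensor_complex tensor_mem)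
qed

lemma torus4_units:
  "torus4 a b c d *v oct_unit 0 = a *\<^sub>R oct_unit 1" "torus4 a b c d *v oct_unit 1 = - (a *\<^sub>R
      oct_unit 0)"
  by (simp_all add: vec_eq_8 torus4_nth oct_unit_nth neq_8)

lemma so_act_complex:
  assumes "A \<in> so8 \<times> torus2" "X \<in> oct_tensor_complex"
  shows "so_act A X \<in> oct_tensor_complex"
proof -
  obtain a b where X: "X = oct_tensor a (oct_unit 0) + oct_tensor b (oct_unit 1)"
    using assms by (auto simp: oct_tensor_complex_iff)
  obtain P x y where A: "A = (P, torus4 (x + y) (x - y) (x - y) (y - x))" using assms(1)
      by (auto simp: torus2_iff)
  have "A \<in> so8 \<times> so8" using assms torus2_so8 by auto
  then show ?thesis unfolding X
    by (simp add: act_linear so_act_tensor, simp add: A torus4_units tensor_linear)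
      (intro subspace_add subspace_diff subspace_neg subspace_scale subspace_oct_tensor_complex
          tensor_mem)
qed

text \<open>The second component is a multiple of \<open>e\<^sub>1 \<and> e\<^sub>0 = (L\<^bsub>e1\<^esub> + R\<^bsub>e1\<^esub>) / 2\<close>.\<close>

lemma oo_wedge_complex:
  assumes "X \<in> oct_tensor_complex" "Y \<in> oct_tensor_complex"
  shows "oo_wedge X Y \<in> so8 \<times> torus2"
proof -
  obtain a b c d where XY: "X = oct_tensor a (oct_unit 0) + oct_tensor b (oct_unit 1)"
    "Y = oct_tensor c (oct_unit 0) + oct_tensor d (oct_unit 1)" using assms
        by (auto simp: oct_tensor_complex_iff)
  have w: "oct_wedge (oct_unit 1) (oct_unit 0) \<in> torus2"
  proof -
    have "oct_wedge (oct_unit 1) (oct_unit 0) = torus4 1 0 0 0"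
      by (simp add: torus4_def rotation_def re_unit_def im_unit_def)
    then show ?thesis unfolding torus2_iff
      by (intro exI[of _ "1/2"]) (simp add: torus4_eq_iff)
  qed
  then have w': "oct_wedge (oct_unit 0) (oct_unit 1) \<in> torus2"
    by (subst wedge_swap) (intro subspace_neg subspace_torus2)
  have "snd (oo_wedge X Y) \<in> torus2" unfolding XY
    by (simp add: wedge_linear oo_wedge_tensor)
      (intro subspace_add subspace_scale subspace_torus2 w w')
  then show ?thesis using oo_wedge_so8[of X Y] by (auto simp: mem_Times_iff)
qed

lemma e6_mem: "(A, u, v, w) \<in> e6 \<longleftrightarrow> A \<in> so8 \<times> torus2 \<and> u \<in> oct_tensor_complex \<and> v \<in>
    oct_tensor_complex \<and> w \<in> oct_tensor_complex"
  by (auto simp: e6_def)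

lemma subspace_so8_torus2: "subspace (so8 \<times> torus2)"
  by (intro subspace_Times subspace_so8 subspace_torus2)

lemma subspace_e6: "subspace e6"
  unfolding e6_def by (intro subspace_Times subspace_so8 subspace_torus2
      subspace_oct_tensor_complex)

lemma e6_subset: "e6 \<subseteq> e8"
  using torus2_so8 by (auto simp: e6_def e8_def)

lemma Lambda_so8_torus2:
  assumes "A \<in> so8 \<times> torus2" shows "Lambda A \<in> so8 \<times> torus2" "Lambda_inv A \<in> so8 \<times> torus2"
  using assms by (auto simp: Lambda_def Lambda_inv_def triality_left_so8 triality_right_so8
      torus2_triality)

lemma so_bracket_so8_torus2:
  assumes "A \<in> so8 \<times> torus2" "B \<in> so8 \<times> torus2" shows "so_bracket A B \<in> so8 \<times> torus2"
proof -
  obtain x y x' y' where "snd A = torus4 (x + y) (x - y) (x - y) (y - x)"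
      "snd B = torus4 (x' + y') (x' - y') (x' - y') (y' - x')"
    using assms unfolding mem_Times_iff torus2_iff by blast
  then have "mat_bracket (snd A) (snd B) \<in> torus2" using subspace_0[OF subspace_torus2]
      by (simp add: torus4_commute)
  then show ?thesis using assms by (simp add: so_bracket_def mem_Times_iff so8_bracket)
qed

lemma e6_br_closed:
  assumes "X \<in> e6" "Y \<in> e6" shows "e8_br X Y \<in> e6"
proof -
  obtain A u v w B x y z where XY: "X = (A, u, v, w)" "Y = (B, x, y, z)" by (metis prod.exhaust)
  then have *: "A \<in> so8 \<times> torus2" "B \<in> so8 \<times> torus2" "u \<in> oct_tensor_complex"
      "v \<in> oct_tensor_complex" "w \<in> oct_tensor_complex"
    "x \<in> oct_tensor_complex" "y \<in> oct_tensor_complex" "z \<in> oct_tensor_complex" using assms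
        by (auto simp only: e6_mem)
  show ?thesis unfolding XY e8_br.simps e6_mem
    by (intro conjI subspace_diff[OF subspace_so8_torus2] subspace_scale[OF subspace_so8_torus2]
        so_bracket_so8_torus2
        subspace_add[OF subspace_oct_tensor_complex] subspace_diff[OF subspace_oct_tensor_complex]
        Lambda_so8_torus2 oo_wedge_complex so_act_complex oo_prod_complex *)
qed

lemma e6_subalgebra: "lie_subalgebra e6 e8 e8_bracket"
  unfolding lie_subalgebra_def
proof (intro conjI ballI subspace_e6 e6_subset)
  fix X Y assume XY: "X \<in> e6" "Y \<in> e6"
  then have "X \<in> e8" "Y \<in> e8" using e6_subset by blast+
  then show "e8_bracket X Y \<in> e6"
    using e6_br_closed[OF XY] by (simp only: e8_bracket_eq)
qed

section \<open>Dimension and orthonormal coordinates\<close>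

lemma tensor_unit_inner:
  "oct_tensor (oct_unit i) (oct_unit j) \<bullet> oct_tensor (oct_unit k) (oct_unit l) = (if i = k \<and> j = l
      then 1 else 0)"
  by (simp add: inner_tensor tensor_apply unit_inner)

lemma dim_orthogonal_image:
  fixes f :: "'b \<Rightarrow> 'a::euclidean_space"
  assumes fin: "finite I" and nz: "\<And>i. i \<in> I \<Longrightarrow> f i \<noteq> 0"
    and orth: "\<And>i j. i \<in> I \<Longrightarrow> j \<in> I \<Longrightarrow> i \<noteq> j \<Longrightarrow> f i \<bullet> f j = 0"
    and S: "f ` I \<subseteq> S" "S \<subseteq> span (f ` I)"
  shows "dim S = card I"
proof -
  have inj: "inj_on f I"
  proof (rule inj_onI, rule ccontr)
    fix i j assume "i \<in> I" "j \<in> I" "f i = f j" "i \<noteq> j"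
    then show False using orth[of i j] nz by simp
  qed
  have "pairwise orthogonal (f ` I)"
    using orth by (force simp: pairwise_def orthogonal_def)
  moreover have "0 \<notin> f ` I" using nz by force
  ultimately have "independent (f ` I)" by (rule pairwise_orthogonal_independent)
  then have "dim S = card (f ` I)" using S by (intro dim_unique[of "f ` I"]) auto
  then show ?thesis by (simp add: card_image[OF inj])
qed

lemma dim_so8: "dim so8 = 28"
proof -
  let ?f = "\<lambda>(i, j). oct_wedge (oct_unit i) (oct_unit j)"
  define Il :: "(8 \<times> 8) list" where "Il = [(0,1), (0,2), (0,3), (0,4), (0,5), (0,6), (0,7), (1,2),
      (1,3), (1,4), (1,5), (1,6), (1,7), (2,3), (2,4), (2,5), (2,6), (2,7), (3,4), (3,5), (3,6),
      (3,7), (4,5), (4,6), (4,7), (5,6), (5,7), (6,7)]"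
  define I where "I = set Il"
  note I_simps = I_def Il_def list.set insert_iff empty_iff prod.inject neq_8 simp_thms
  have "\<forall>p\<in>I. fst p \<noteq> snd p \<and> (snd p, fst p) \<notin> I"
    by (simp only: I_simps ball_simps fst_conv snd_conv)
  then have I: "i \<noteq> j" "(j, i) \<notin> I" if "(i, j) \<in> I" for i j
    using that by auto
  have all: "i = j \<or> (i, j) \<in> I \<or> (j, i) \<in> I" for i j
    using exhaust_8[of i] exhaust_8[of j] by (elim disjE) (simp_all only: I_simps)
  have inner: "oct_wedge (oct_unit i) (oct_unit j) \<bullet> oct_wedge (oct_unit k) (oct_unit l) =
     ((if i = k \<and> j = l then 1 else 0) - (if i = l \<and> j = k then 1 else 0))
     - ((if j = k \<and> i = l then 1 else 0) - (if j = l \<and> i = k then 1 else 0))" for i j k l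
    by (simp only: oct_wedge_def inner_diff_left inner_diff_right tensor_unit_inner)
  have "dim so8 = card I"
  proof (rule dim_orthogonal_image[where f = ?f])
    show "finite I" by (simp add: I_def)
    show "?f p \<noteq> 0" if "p \<in> I" for p
    proof -
      obtain i j where p: "p = (i, j)" by (cases p)
      have "?f p \<bullet> ?f p = 2" using I[of i j] that by (simp add: p inner)
      then show ?thesis by auto
    qed
    show "?f p \<bullet> ?f q = 0" if "p \<in> I" "q \<in> I" "p \<noteq> q" for p q
      using that I by (cases p; cases q) (auto simp: inner)
    show "?f ` I \<subseteq> so8" using wedge_in_so8 by auto
    show "so8 \<subseteq> span (?f ` I)"
    proof
      fix P assume P: "P \<in> so8"
      have "oct_wedge (oct_unit i) (oct_unit j) \<in> span (?f ` I)" for i j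
      proof -
        consider "i = j" | "(i, j) \<in> I" | "(j, i) \<in> I" using all by blast
        then show ?thesis
        proof cases
          case 1 then show ?thesis by (simp add: span_zero)
        next
          case 2 then show ?thesis by (intro span_base) force
        next
          case 3
          then have "oct_wedge (oct_unit j) (oct_unit i) \<in> span (?f ` I)" by (intro span_base) force
          then show ?thesis by (subst wedge_swap) (rule span_neg)
        qed
      qed
      then show "P \<in> span (?f ` I)"
        by (subst so8_wedge_sum[OF P]) (intro span_sum span_scale)
    qed
  qed
  also have "card I = 28"
  proof -
    have "distinct Il" by (simp only: I_simps distinct.simps)
    then have "card I = length Il" unfolding I_def by (rule distinct_card)
    then show ?thesis by (simp add: Il_def)
  qed
  finally show ?thesis .
qed

lemma dim_torus2: "dim torus2 = 2"
proof -
  let ?g = "\<lambda>p :: real \<times> real. torus4 (fst p + snd p) (fst p - snd p) (fst p - snd p) (snd p - fst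
      p)"
  have lin: "linear ?g" by (rule linearI) (simp_all add: torus4_add torus4_scale torus4_eq_iff
      algebra_simps)
  have "inj ?g" by (rule injI) (auto simp: torus4_eq_iff prod_eq_iff)
  moreover have "torus2 = range ?g" by (simp add: set_eq_iff torus2_iff image_iff)
  ultimately show ?thesis using dim_image_eq[OF lin, of UNIV] by simp
qed

lemma dim_oct_tensor_complex: "dim oct_tensor_complex = 16"
proof -
  have "p = 0" if "complex_tensor p = 0" for p
  proof -
    have "complex_tensor p *v oct_unit 0 = fst p" "complex_tensor p *v oct_unit 1 = snd p"
      by (simp_all add: complex_tensor_def matrix_vector_mult_add_rdistrib tensor_apply unit_inner)
    then show ?thesis using that by (simp add: prod_eq_iff)
  qed
  then have "inj complex_tensor" by (simp add: linear_injective_0[OF linear_complex_tensor])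
  then show ?thesis
    using dim_image_eq[OF linear_complex_tensor, of UNIV] by (simp add: oct_tensor_complex_range)
qed

lemma dim_e6: "dim e6 = 78"
  unfolding e6_def
  by (simp add: dim_Times subspace_Times subspace_so8 subspace_torus2 subspace_oct_tensor_complex
      dim_so8 dim_torus2 dim_oct_tensor_complex)

text \<open>This rescaling turns \<open>e8_form\<close> into the standard inner product.\<close>

definition e8_scale :: "e8_vec \<Rightarrow> e8_vec" where
  "e8_scale X = ((1 / sqrt 8) *\<^sub>R fst X, snd X)"

lemma e8_scale_inner: "e8_scale X \<bullet> e8_scale Y = e8_form X Y"
  by (cases X rule: prod_cases4; cases Y rule: prod_cases4)
    (simp add: e8_scale_def inner_prod_def field_simps)

lemma linear_e8_scale: "linear e8_scale"
  by (rule linearI) (simp_all add: e8_scale_def prod_eq_iff algebra_simps)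

text \<open>After rescaling, a subspace of dimension 78 is isometric to \<open>\<real>\<^sup>7\<^sup>8\<close>.\<close>

lemma e6_coordinates:
  obtains \<Phi> :: "e8_vec \<Rightarrow> real ^ 78" and \<Psi> where "linear \<Phi>" "linear \<Psi>"
    "\<And>X. X \<in> e6 \<Longrightarrow> \<Psi> (\<Phi> X) = X" "\<And>x. \<Psi> x \<in> e6" "\<And>x. \<Phi> (\<Psi> x) = x"
    "\<And>X Y. X \<in> e6 \<Longrightarrow> Y \<in> e6 \<Longrightarrow> \<Phi> X \<bullet> \<Phi> Y = e8_form X Y"
proof -
  define R :: "e8_vec \<Rightarrow> e8_vec" where "R X = (sqrt 8 *\<^sub>R fst X, snd X)" for X
  have R: "R (e8_scale X) = X" "e8_scale (R X) = X" for X by (simp_all add: R_def e8_scale_def)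
  have linR: "linear R" by (rule linearI) (simp_all add: R_def prod_eq_iff algebra_simps)
  have inj: "inj e8_scale" by (rule inj_on_inverseI[of _ R]) (rule R)
  have sub: "subspace (e8_scale ` e6)" by (rule linear_subspace_image[OF linear_e8_scale
      subspace_e6])
  have "dim (e8_scale ` e6) = dim (UNIV :: (real ^ 78) set)"
    using dim_image_eq[OF linear_e8_scale, of e6] inj by (simp add: dim_e6 inj_on_subset[OF inj])
  then obtain f :: "e8_vec \<Rightarrow> real ^ 78" and g where fg: "linear f" "linear g"
      "f ` e8_scale ` e6 = UNIV" "g ` UNIV = e8_scale ` e6"
    "\<And>x. x \<in> e8_scale ` e6 \<Longrightarrow> norm (f x) = norm x" "\<And>x. x \<in> e8_scale ` e6 \<Longrightarrow> g (f x) = x"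
        "\<And>x. f (g x) = x"
    by (rule isometries_subspaces[OF sub subspace_UNIV]) auto
  have inner: "f x \<bullet> f y = x \<bullet> y" if "x \<in> e8_scale ` e6" "y \<in> e8_scale ` e6" for x y
  proof -
    have "norm (f (x + y)) = norm (x + y)" using that sub by (intro fg(5) subspace_add)
    then have "norm (f x + f y) ^ 2 = norm (x + y) ^ 2" by (simp add: linear_add[OF fg(1)])
    moreover have "norm (f x) ^ 2 = norm x ^ 2" "norm (f y) ^ 2 = norm y ^ 2" using that fg(5)
        by simp_all
    ultimately show ?thesis by (simp add: power2_norm_eq_inner inner_add_left inner_add_right
        inner_commute)
  qed
  show thesis
  proof (rule that[of "f \<circ> e8_scale" "R \<circ> g"])
    show "linear (f \<circ> e8_scale)" "linear (R \<circ> g)"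
      using linear_compose linear_e8_scale fg linR by blast+
    show "(R \<circ> g) ((f \<circ> e8_scale) X) = X" if "X \<in> e6" for X using that fg(6) by (simp add: R)
    show "(R \<circ> g) x \<in> e6" for x
    proof -
      have "g x \<in> e8_scale ` e6" using fg(4) by blast
      then show ?thesis by (auto simp: R)
    qed
    show "(f \<circ> e8_scale) ((R \<circ> g) x) = x" for x by (simp add: R fg(7))
    show "(f \<circ> e8_scale) X \<bullet> (f \<circ> e8_scale) Y = e8_form X Y" if "X \<in> e6" "Y \<in> e6" for X Y
      using that by (simp add: inner e8_scale_inner)
  qed
qed

section \<open>Root planes\<close>

text \<open>A key \<open>(i, a, b, s)\<close> with \<open>i = 3\<close> stands for the plane of \<open>so8\<close> on which the torus has
  speed \<open>\<theta>\<^sub>a + s \<theta>\<^sub>b\<close>. For \<open>i < 3\<close> it stands for a plane in the tensor summand number \<open>i\<close>; here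
  \<open>b = 0\<close>, because the right tensor factor is confined to the plane of \<open>e\<^sub>0\<close> and \<open>e\<^sub>1\<close>.\<close>

type_synonym root_key = "nat \<times> nat \<times> nat \<times> real"

definition root_keys :: "root_key list" where
  "root_keys = [
    (3, 0, 1, 1), (3, 0, 1, - 1), (3, 0, 2, 1), (3, 0, 2, - 1), (3, 0, 3, 1), (3, 0, 3, - 1),
    (3, 1, 2, 1), (3, 1, 2, - 1), (3, 1, 3, 1), (3, 1, 3, - 1), (3, 2, 3, 1), (3, 2, 3, - 1),
    (0, 0, 0, 1), (0, 0, 0, - 1), (0, 1, 0, 1), (0, 1, 0, - 1), (0, 2, 0, 1), (0, 2, 0, - 1), (0,
        3, 0, 1), (0, 3, 0, - 1),
    (1, 0, 0, 1), (1, 0, 0, - 1), (1, 1, 0, 1), (1, 1, 0, - 1), (1, 2, 0, 1), (1, 2, 0, - 1), (1,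
        3, 0, 1), (1, 3, 0, - 1),
    (2, 0, 0, 1), (2, 0, 0, - 1), (2, 1, 0, 1), (2, 1, 0, - 1), (2, 2, 0, 1), (2, 2, 0, - 1), (2,
        3, 0, 1), (2, 3, 0, - 1)]"

definition slot :: "nat \<Rightarrow> mat8 \<Rightarrow> e8_vec" where
  "slot i M = (if i = 0 then (0, M, 0, 0) else if i = 1 then (0, 0, M, 0) else if i = 2 then (0,
      0, 0, M) else ((M, 0), 0, 0, 0))"

text \<open>The planes of \<open>so8\<close> and of the tensor summands are handled alike: both are built from a
  bilinear map on which the torus acts as a derivation, the wedge in the one case and the tensor
  product in the other.\<close>

definition slot_product :: "nat \<Rightarrow> octonion \<Rightarrow> octonion \<Rightarrow> e8_vec" where
  "slot_product i x y = slot i (if i = 3 then oct_wedge x y else oct_tensor x y)"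

text \<open>With \<open>re_unit\<close> and \<open>im_unit\<close> in the roles of \<open>1\<close> and \<open>\<i>\<close>, \<open>plane_Y\<close> and \<open>plane_X\<close> are
  the real and the imaginary part of a product of two complex units; the second one is conjugated
  if \<open>s = - 1\<close>.\<close>

fun plane_X :: "root_key \<Rightarrow> e8_vec" where
  "plane_X (i, a, b, s) = slot_product i (im_unit a) (re_unit b) + s *\<^sub>R slot_product i (re_unit a)
      (im_unit b)"

fun plane_Y :: "root_key \<Rightarrow> e8_vec" where
  "plane_Y (i, a, b, s) = slot_product i (re_unit a) (re_unit b) - s *\<^sub>R slot_product i (im_unit a)
      (im_unit b)"

definition torus6 :: "e8_vec set" where
  "torus6 = {((P, Q), 0, 0, 0) |P Q. (\<exists>a b c d. P = torus4 a b c d) \<and> Q \<in> torus2}"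

definition Lambda_power :: "nat \<Rightarrow> mat8 \<times> mat8 \<Rightarrow> mat8 \<times> mat8" where
  "Lambda_power i A = (if i = 1 then Lambda A else if i = 2 then Lambda_inv A else A)"

text \<open>On tensor summand \<open>i\<close> the torus acts through \<open>\<Lambda>\<^sup>i\<close>, whose adjoint is \<open>\<Lambda>\<^sup>3\<^sup>-\<^sup>i\<close>. The factor
  \<open>4\<close> makes up for \<open>e8_form\<close> being \<open>1/4\<close> on a rotation paired with itself.\<close>

fun root_elt :: "root_key \<Rightarrow> e8_vec" where
  "root_elt (i, a, b, s) = (4 *\<^sub>R
     (if i = 3 then (rotation a + s *\<^sub>R rotation b, 0)
      else Lambda_power (3 - i) (rotation a, s *\<^sub>R rotation b)), 0, 0, 0)"

lemma bounded_bilinear_slot_product: "bounded_bilinear (slot_product i)"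
  by (auto intro!: bounded_bilinear_linearI linearI simp: slot_product_def slot_def oct_wedge_def
      tensor_linear
     algebra_simps)

lemma root_key_cases:
  assumes "k \<in> set root_keys"
  obtains i a s where "k = (i, a, 0, s)" "i < 3" "a < 4" "s * s = 1"
    | a b s where "k = (3, a, b, s)" "a < b" "b < 4" "s * s = 1"
  using assms unfolding root_keys_def by auto

lemma less_4: "a < 4 \<longleftrightarrow> a = 0 \<or> a = 1 \<or> a = 2 \<or> a = (3::nat)"
  by auto

lemma torus4_units_rotate:
  assumes "P = torus4 x y z t" "a < 4"
  shows "P *v re_unit a = ((P \<bullet> rotation a) / 2) *\<^sub>R im_unit a"
      "P *v im_unit a = - (((P \<bullet> rotation a) / 2) *\<^sub>R re_unit a)"
  using assms(2) unfolding assms(1) less_4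
  by (elim disjE; simp add: rotation_torus4 torus4_inner re_unit_def im_unit_def vec_eq_8
      torus4_nth oct_unit_nth neq_8)+

text \<open>If \<open>P\<close> and \<open>Q\<close> rotate two planes with speeds \<open>\<theta>\<close> and \<open>\<phi>\<close>, the induced derivation rotates
  two planes of products with speeds \<open>\<theta> \<plusminus> \<phi>\<close>.\<close>

lemma plane_rotation:
  fixes m :: "octonion \<Rightarrow> octonion \<Rightarrow> 'v::real_vector"
  assumes D: "linear D" "\<And>x y. D (m x y) = m (P *v x) y + m x (Q *v y)"
    and m: "\<And>r x y. m (r *\<^sub>R x) y = r *\<^sub>R m x y" "\<And>r x y. m x (r *\<^sub>R y) = r *\<^sub>R m x y"
    "\<And>x y. m (- x) y = - m x y" "\<And>x y. m x (- y) = - m x y"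
    and P: "P *v xr = \<theta> *\<^sub>R xi" "P *v xi = - (\<theta> *\<^sub>R xr)" and Q: "Q *v yr = \<phi> *\<^sub>R yi"
        "Q *v yi = - (\<phi> *\<^sub>R yr)"
    and s: "s * s = 1"
  shows "D (m xi yr + s *\<^sub>R m xr yi) = - ((\<theta> + s * \<phi>) *\<^sub>R (m xr yr - s *\<^sub>R m xi yi))"
    "D (m xr yr - s *\<^sub>R m xi yi) = (\<theta> + s * \<phi>) *\<^sub>R (m xi yr + s *\<^sub>R m xr yi)"
proof -
  have ss: "s * (s * r) = r" "s * (r * s) = r" for r using s
      by (simp_all flip: mult.assoc add: mult.commute[of r])
  show "D (m xi yr + s *\<^sub>R m xr yi) = - ((\<theta> + s * \<phi>) *\<^sub>R (m xr yr - s *\<^sub>R m xi yi))"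
    "D (m xr yr - s *\<^sub>R m xi yi) = (\<theta> + s * \<phi>) *\<^sub>R (m xi yr + s *\<^sub>R m xr yi)"
    by (simp_all add: linear_add[OF D(1)] linear_diff[OF D(1)] linear_scale[OF D(1)] D(2) m P Q
        algebra_simps ss s)
qed

lemma torus6_e6: "torus6 \<subseteq> e6"
  by (auto simp: torus6_def e6_def torus4_so8 subspace_0[OF subspace_oct_tensor_complex])

lemma torus6_act:
  assumes PQ: "(P, Q) \<in> so8 \<times> so8" and i: "i \<le> 3"
  defines "R \<equiv> (if i = 3 then P else fst (Lambda_power i (P, Q)))" and
      "R' \<equiv> (if i = 3 then P else snd (Lambda_power i (P, Q)))"
  shows "e8_br ((P, Q), 0, 0, 0) (slot_product i x y) = slot_product i (R *v x) y + slot_product i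
      x (R' *v y)"
proof -
  have z: "so_act A 0 = 0" "so_act 0 M = 0" "oo_wedge 0 M = 0" "oo_wedge M 0 = 0"
      "oo_prod 0 M = 0" "oo_prod M 0 = 0"
    "Lambda 0 = 0" "Lambda_inv 0 = 0" "so_bracket A 0 = 0" for A M
    by (simp_all add: act_linear wedge_linear prod_linear bracket_linear Lambda_linear)
  have t: "Lambda_power i (P, Q) \<in> so8 \<times> so8" using Lambda_so8[OF PQ] PQ
      by (simp add: Lambda_power_def)
  have w: "mat_bracket P (oct_wedge x y) = oct_wedge (P *v x) y + oct_wedge x (P *v y)"
    using PQ so8_transpose[of P] by (simp add: mat_bracket_def oct_wedge_def matrix_mult_tensor
        tensor_mult_matrix matrix_minus_apply
       matrix_mult_linear tensor_linear del: transpose_matrix_vector)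
  have sb: "so_bracket (P, Q) (M, 0) = (mat_bracket P M, 0)" for M
    by (simp add: so_bracket_def mat_bracket_def)
  consider "i = 0" | "i = 1" | "i = 2" | "i = 3" using i by linarith
  then show ?thesis
    using so_act_tensor[OF t, of x y]
    by cases (simp_all add: slot_product_def slot_def R_def R'_def Lambda_power_def z sb w)
qed

lemma root_elt_form:
  assumes "(P, Q) \<in> so8 \<times> so8" "i < 3"
  shows "e8_form (root_elt (i, a, b, s)) ((P, Q), 0, 0, 0) =
     (fst (Lambda_power i (P, Q)) \<bullet> rotation a) / 2 + s * ((snd (Lambda_power i (P, Q)) \<bullet> rotation
         b) / 2)"
proof -
  have r: "(rotation a, s *\<^sub>R rotation b) \<in> so8 \<times> so8"
    by (simp add: rotation_def wedge_in_so8 subspace_scale subspace_so8)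
  have "Lambda_power (3 - i) (rotation a, s *\<^sub>R rotation b) \<bullet> (P, Q) = (rotation a, s *\<^sub>R rotation
      b) \<bullet> Lambda_power i (P, Q)"
    using assms(2) Lambda_adjoint[OF r assms(1)]
    by (auto simp: Lambda_power_def numeral_eq_Suc less_Suc_eq)
  moreover have "(rotation a, s *\<^sub>R rotation b) \<bullet> X = fst X \<bullet> rotation a + s * (snd X \<bullet> rotation
      b)" for X
    by (cases X) (simp add: inner_commute)
  ultimately show ?thesis using assms(2) by (simp add: field_simps)
qed

lemma torus4_triality:
  assumes "P = torus4 a b c d"
  shows "\<exists>a b c d. triality_left P = torus4 a b c d" "\<exists>a b c d. triality_right P = torus4 a b c d"
  unfolding assms triality_left_torus4 triality_right_torus4 by blast+

lemma root_planes_e6: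
  assumes k: "k \<in> set root_keys" and H: "H \<in> torus6"
  shows "e8_br H (plane_X k) = - (e8_form (root_elt k) H *\<^sub>R plane_Y k)"
    "e8_br H (plane_Y k) = e8_form (root_elt k) H *\<^sub>R plane_X k"
proof -
  obtain P Q where H': "H = ((P, Q), 0, 0, 0)" and P: "\<exists>a b c d. P = torus4 a b c d" and Q:
      "\<exists>a b c d. Q = torus4 a b c d"
    using H unfolding torus6_def torus2_iff by blast
  have PQ: "(P, Q) \<in> so8 \<times> so8" using P Q torus4_so8 by auto
  have lin: "linear (e8_br H)" by (intro bounded_linear.linear
      bounded_bilinear.bounded_linear_right bounded_bilinear_e8_br)
  note m = bounded_bilinear.scaleR_left[OF bounded_bilinear_slot_product]
      bounded_bilinear.scaleR_right[OF bounded_bilinear_slot_product]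
     bounded_bilinear.minus_left[OF bounded_bilinear_slot_product] bounded_bilinear.minus_right[OF
         bounded_bilinear_slot_product]
  have "e8_br H (plane_X k) = - (e8_form (root_elt k) H *\<^sub>R plane_Y k) \<and>
    e8_br H (plane_Y k) = e8_form (root_elt k) H *\<^sub>R plane_X k"
    using k
  proof (cases rule: root_key_cases)
    case (1 i a s)
    let ?R = "fst (Lambda_power i (P, Q))" and ?R' = "snd (Lambda_power i (P, Q))"
    have R: "\<exists>a b c d. ?R = torus4 a b c d" "\<exists>a b c d. ?R' = torus4 a b c d"
      using P Q torus4_triality by (auto simp: Lambda_power_def Lambda_def Lambda_inv_def)
    have D: "e8_br H (slot_product i x y) = slot_product i (?R *v x) y + slot_product i x (?R' *v
        y)" for x y
      using torus6_act[OF PQ, of i x y] 1 by (simp add: H')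
    obtain a1 b1 c1 d1 a2 b2 c2 d2 where R': "?R = torus4 a1 b1 c1 d1" "?R' = torus4 a2 b2 c2 d2"
        using R by blast
    have F: "e8_form (root_elt (i, a, 0, s)) H = (?R \<bullet> rotation a) / 2 + s * ((?R' \<bullet> rotation 0) /
        2)"
      unfolding H' by (rule root_elt_form[OF PQ 1(2)])
    show ?thesis
      unfolding 1(1) plane_X.simps plane_Y.simps F
      using plane_rotation[OF lin D m torus4_units_rotate[OF R'(1) 1(3)] torus4_units_rotate[OF
          R'(2), of 0] 1(4)] by simp
  next
    case (2 a b s)
    have D: "e8_br H (slot_product 3 x y) = slot_product 3 (P *v x) y + slot_product 3 x (P *v y)"
        for x y
      using torus6_act[OF PQ, of 3 x y] by (simp add: H')
    obtain a1 b1 c1 d1 where P': "P = torus4 a1 b1 c1 d1" using P by blast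
    have F: "e8_form (root_elt (3, a, b, s)) H = (P \<bullet> rotation a) / 2 + s * ((P \<bullet> rotation b) / 2)"
      by (simp add: H' inner_add_right inner_commute[of _ P] field_simps)
    show ?thesis
      unfolding 2(1) plane_X.simps plane_Y.simps F
      using plane_rotation[OF lin D m torus4_units_rotate[OF P', of a] torus4_units_rotate[OF P',
          of b] 2(4)] 2 by simp
  qed
  then show "e8_br H (plane_X k) = - (e8_form (root_elt k) H *\<^sub>R plane_Y k)"
    "e8_br H (plane_Y k) = e8_form (root_elt k) H *\<^sub>R plane_X k" by blast+
qed

lemma torus6_abelian:
  assumes "H \<in> torus6" "H' \<in> torus6" shows "e8_br H H' = 0"
proof -
  have *: "\<exists>a b c d x y z t. H = ((torus4 a b c d, torus4 x y z t), 0, 0, 0)" if "H \<in> torus6" for H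
    using that unfolding torus6_def torus2_iff by blast
  obtain a b c d x y z t a' b' c' d' x' y' z' t'
    where H: "H = ((torus4 a b c d, torus4 x y z t), 0, 0, 0)"
        "H' = ((torus4 a' b' c' d', torus4 x' y' z' t'), 0, 0, 0)"
    using *[OF assms(1)] *[OF assms(2)] by (elim exE) (rule that)
  have "e8_br H H' = ((0, 0), 0, 0, 0)"
    unfolding H by (simp add: so_bracket_def torus4_commute act_linear wedge_linear prod_linear
        Lambda_linear)
  then show ?thesis by (simp add: zero_prod_def)
qed

lemma subspace_torus6: "subspace torus6"
proof -
  have "subspace {P. \<exists>a b c d. P = torus4 a b c d}"
  proof (rule subspaceI)
    show "0 \<in> {P. \<exists>a b c d. P = torus4 a b c d}" using torus4_zero[symmetric] by blast
    show "x + y \<in> {P. \<exists>a b c d. P = torus4 a b c d}"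
      if "x \<in> {P. \<exists>a b c d. P = torus4 a b c d}" "y \<in> {P. \<exists>a b c d. P = torus4 a b c d}" for x y
      using that torus4_add by blast
    show "c *\<^sub>R x \<in> {P. \<exists>a b c d. P = torus4 a b c d}"
        if "x \<in> {P. \<exists>a b c d. P = torus4 a b c d}" for c x
      using that torus4_scale by blast
  qed
  then have "subspace (({P. \<exists>a b c d. P = torus4 a b c d} \<times> torus2) \<times> {0 :: mat8 \<times> mat8 \<times> mat8})"
    by (intro subspace_Times subspace_torus2 subspace_single_0)
  also have "({P. \<exists>a b c d. P = torus4 a b c d} \<times> torus2) \<times> {0} = torus6"
    unfolding torus6_def zero_prod_def by blast
  finally show ?thesis .
qed

lemma less_3: "i < 3 \<longleftrightarrow> i = 0 \<or> i = 1 \<or> i = (2::nat)"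
  by auto

lemma unit_cases: "\<exists>a<4. oct_unit i = re_unit a \<or> oct_unit i = im_unit a"
proof -
  have ex: "(\<exists>a<4. p a) \<longleftrightarrow> p 0 \<or> p 1 \<or> p 2 \<or> p (3::nat)" for p by (auto simp: less_4)
  show ?thesis unfolding ex re_unit_def im_unit_def using exhaust_8[of i] by (elim disjE) simp_all
qed

lemma key_mem:
  assumes "s = 1 \<or> s = - 1"
  shows "i < 3 \<Longrightarrow> a < 4 \<Longrightarrow> (i, a, 0, s) \<in> set root_keys" "a < b \<Longrightarrow> b < 4 \<Longrightarrow> (3, a, b, s) \<in> set
      root_keys"
proof -
  show "(i, a, 0, s) \<in> set root_keys" if "i < 3" "a < 4"
    using that assms unfolding less_3 less_4 root_keys_def by (elim disjE) simp_all
  have "a = 0 \<and> b = 1 \<or> a = 0 \<and> b = 2 \<or> a = 0 \<and> b = 3 \<or> a = 1 \<and> b = 2 \<or> a = 1 \<and> b = 3 \<or> a = 2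
      \<and> b = 3"
    if "a < b" "b < 4" using that by linarith
  then show "(3, a, b, s) \<in> set root_keys" if "a < b" "b < 4"
    using that assms unfolding root_keys_def by (elim disjE conjE) simp_all
qed

lemma plane_span:
  assumes k: "(i, a, b, 1) \<in> set root_keys" "(i, a, b, - 1) \<in> set root_keys"
    and x: "x = re_unit a \<or> x = im_unit a" and y: "y = re_unit b \<or> y = im_unit b"
  shows "slot_product i x y \<in> span (plane_X ` set root_keys \<union> plane_Y ` set root_keys)" (is
      "_ \<in> ?S")
proof -
  have S: "plane_X (i, a, b, 1) \<in> ?S" "plane_X (i, a, b, - 1) \<in> ?S" "plane_Y (i, a, b, 1) \<in> ?S"
      "plane_Y (i, a, b, - 1) \<in> ?S"
    using k by (blast intro: span_base)+
  have "slot_product i (im_unit a) (re_unit b) = (1/2) *\<^sub>R (plane_X (i, a, b, 1) + plane_X (i, a,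
      b, - 1))"
    "slot_product i (re_unit a) (im_unit b) = (1/2) *\<^sub>R (plane_X (i, a, b, 1) - plane_X (i, a, b, -
        1))"
    "slot_product i (re_unit a) (re_unit b) = (1/2) *\<^sub>R (plane_Y (i, a, b, 1) + plane_Y (i, a, b, -
        1))"
    "slot_product i (im_unit a) (im_unit b) = (1/2) *\<^sub>R (plane_Y (i, a, b, - 1) - plane_Y (i, a, b,
        1))"
    by (simp_all flip: scaleR_2)
  then show ?thesis using x y S by (auto simp only: intro!: span_scale span_add span_diff)
qed

lemma e6_span: "e6 \<subseteq> span (torus6 \<union> plane_X ` set root_keys \<union> plane_Y ` set root_keys)" (is
    "_ \<subseteq> span ?S")
proof
  fix Z assume Z: "Z \<in> e6"
  obtain P Q u v w where Z': "Z = ((P, Q), u, v, w)" by (metis prod.exhaust)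
  have mem: "P \<in> so8" "Q \<in> torus2" "u \<in> oct_tensor_complex" "v \<in> oct_tensor_complex"
      "w \<in> oct_tensor_complex"
    using Z by (auto simp: Z' e6_mem)
  have plane: "slot_product i x y \<in> span ?S"
    if "(i, a, b, 1) \<in> set root_keys" "(i, a, b, - 1) \<in> set root_keys"
        "x = re_unit a \<or> x = im_unit a" "y = re_unit b \<or> y = im_unit b" for i a b x y
    using plane_span[OF that] span_mono[of "plane_X ` set root_keys \<union> plane_Y ` set root_keys" ?S]
        by blast
  have torus: "X \<in> span ?S" if "X \<in> torus6" for X using that by (intro span_base) blast
  have swap: "slot_product 3 x y = - slot_product 3 y x" for x y
    by (simp add: slot_product_def slot_def) (subst wedge_swap, simp)
  have so: "slot_product 3 (oct_unit i) (oct_unit j) \<in> span ?S" for i j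
  proof -
    obtain a b where ab: "a < 4" "oct_unit i = re_unit a \<or> oct_unit i = im_unit a" "b < 4"
        "oct_unit j = re_unit b \<or> oct_unit j = im_unit b"
      using unit_cases by metis
    consider "a < b" | "b < a" | "a = b" by linarith
    then show ?thesis
    proof cases
      case 1
      then show ?thesis using ab by (intro plane[of 3 a b] key_mem) auto
    next
      case 2
      then have "slot_product 3 (oct_unit j) (oct_unit i) \<in> span ?S" using ab
          by (intro plane[of 3 b a] key_mem) auto
      then show ?thesis by (subst swap) (rule span_neg)
    next
      case 3
      have "\<exists>x y z t. rotation a = torus4 x y z t" using ab(1) rotation_torus4 unfolding less_4
          by metis
      then have r: "slot_product 3 (im_unit a) (re_unit a) \<in> torus6"
        by (auto simp: slot_product_def slot_def torus6_def rotation_def subspace_0[OF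
            subspace_torus2])
      then have "slot_product 3 (re_unit a) (im_unit a) \<in> torus6"
        by (subst swap) (rule subspace_neg[OF subspace_torus6])
      moreover have "slot_product 3 x x \<in> torus6" for x
        using subspace_0[OF subspace_torus6] by (simp add: slot_product_def slot_def zero_prod_def)
      ultimately show ?thesis using ab 3 r by (auto intro: torus)
    qed
  qed
  have "((P, 0), 0, 0, 0) \<in> span ?S"
  proof -
    have lin: "linear (slot 3)" by (rule linearI) (auto simp: slot_def)
    have "slot 3 P = (\<Sum>i\<in>UNIV. \<Sum>j\<in>UNIV. (P $ i $ j / 2) *\<^sub>R slot_product 3 (oct_unit i) (oct_unit
        j))"
      by (subst so8_wedge_sum[OF mem(1)]) (simp add: linear_sum[OF lin] linear_scale[OF lin]
          slot_product_def)
    then have "slot 3 P \<in> span ?S" using so by (simp add: span_sum span_scale)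
    then show ?thesis by (simp add: slot_def)
  qed
  moreover have "((0, Q), 0, 0, 0) \<in> torus6"
    using mem(2) torus4_zero[symmetric] unfolding torus6_def by blast
  then have "((0, Q), 0, 0, 0) \<in> span ?S" by (rule torus)
  moreover have tens: "slot i M \<in> span ?S" if "i < 3" and M_mem: "M \<in> oct_tensor_complex" for i M
  proof -
    obtain a b where M: "M = oct_tensor a (oct_unit 0) + oct_tensor b (oct_unit 1)"
        using M_mem unfolding oct_tensor_complex_iff by blast
    have *: "slot_product i a y \<in> span ?S" if "y = re_unit 0 \<or> y = im_unit 0" for a y
    proof -
      have "slot_product i (oct_unit j) y \<in> span ?S" for j
      proof -
        obtain c where "c < 4" "oct_unit j = re_unit c \<or> oct_unit j = im_unit c" using unit_cases
            by metis
        then show ?thesis using \<open>i < 3\<close> \<open>y = re_unit 0 \<or> y = im_unit 0\<close>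
            by (intro plane[of i c 0] key_mem) auto
      qed
      then have "(\<Sum>j\<in>UNIV. a $ j *\<^sub>R slot_product i (oct_unit j) y) \<in> span ?S"
          by (intro span_sum span_scale)
      then have "slot_product i (\<Sum>j\<in>UNIV. a $ j *\<^sub>R oct_unit j) y \<in> span ?S"
        by (simp add: bounded_bilinear.sum_left[OF bounded_bilinear_slot_product]
            bounded_bilinear.scaleR_left[OF bounded_bilinear_slot_product])
      then show ?thesis by (simp only: vec_unit_sum)
    qed
    have "slot i M = slot_product i a (re_unit 0) + slot_product i b (im_unit 0)"
      using \<open>i < 3\<close> by (auto simp: M slot_product_def slot_def re_unit_def im_unit_def)
    then show ?thesis using *[of "re_unit 0" a] *[of "im_unit 0" b] by (simp add: span_add)
  qed
  ultimately have "((P, 0), 0, 0, 0) + ((0, Q), 0, 0, 0) + slot 0 u + slot 1 v + slot 2 w \<in> span ?S"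
    using mem by (intro span_add tens) auto
  then show "Z \<in> span ?S" by (simp add: Z' slot_def)
qed

lemma slot_product_mem: "i < 3 \<Longrightarrow> b = 0 \<Longrightarrow> slot_product i x (re_unit b) \<in> e6 \<and> slot_product i x
    (im_unit b) \<in> e6" "slot_product 3 x y \<in> e6"
  by (auto simp: slot_product_def slot_def e6_def tensor_mem re_unit_def im_unit_def wedge_in_so8
      zero_prod_def subspace_0[OF subspace_so8]
      subspace_0[OF subspace_torus2] subspace_0[OF subspace_oct_tensor_complex] mem_Times_iff)

lemma planes_e6: assumes "k \<in> set root_keys" shows "plane_X k \<in> e6" "plane_Y k \<in> e6"
  using assms by (cases rule: root_key_cases; simp add: subspace_add subspace_diff subspace_scale
      subspace_e6 slot_product_mem)+

lemma re_im_unit_inner: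
  assumes "a < 4" "b < 4"
  shows "re_unit a \<bullet> re_unit b = (if a = b then 1 else 0)" "im_unit a \<bullet> re_unit b = 0"
      "im_unit b \<bullet> re_unit b = 0"
  using assms unfolding less_4 re_unit_def im_unit_def
  by (elim disjE; simp add: unit_inner)+

lemma plane_X_nonzero:
  assumes "k \<in> set root_keys" shows "plane_X k \<noteq> 0"
  using assms
proof (cases rule: root_key_cases)
  case (1 i a s)
  have "(oct_tensor (im_unit a) (re_unit 0) + s *\<^sub>R oct_tensor (re_unit a) (im_unit 0)) *v re_unit
      0 = im_unit a"
    using 1 by (simp add: matrix_vector_mult_add_rdistrib tensor_apply re_im_unit_inner flip:
        scaleR_matrix_vector_assoc)
  moreover have "im_unit a \<noteq> 0" by (simp add: im_unit_def oct_unit_def axis_eq_0_iff)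
  ultimately have "oct_tensor (im_unit a) (re_unit 0) + s *\<^sub>R oct_tensor (re_unit a) (im_unit 0)
      \<noteq> 0" by auto
  then show ?thesis using 1 by (auto simp: slot_product_def slot_def zero_prod_def)
next
  case (2 a b s)
  have "(oct_wedge (im_unit a) (re_unit b) + s *\<^sub>R oct_wedge (re_unit a) (im_unit b)) *v re_unit b
      = im_unit a"
    using 2 by (simp add: matrix_vector_mult_add_rdistrib wedge_apply re_im_unit_inner flip:
        scaleR_matrix_vector_assoc)
  moreover have "im_unit a \<noteq> 0" by (simp add: im_unit_def oct_unit_def axis_eq_0_iff)
  ultimately have "oct_wedge (im_unit a) (re_unit b) + s *\<^sub>R oct_wedge (re_unit a) (im_unit b) \<noteq> 0"
      by auto
  then show ?thesis using 2 by (auto simp: slot_product_def slot_def zero_prod_def)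
qed

section \<open>The root system\<close>

definition torus8 :: "real \<Rightarrow> real \<Rightarrow> real \<Rightarrow> real \<Rightarrow> real \<Rightarrow> real \<Rightarrow> real \<Rightarrow> real \<Rightarrow> e8_vec" where
  "torus8 a b c d x y z t = ((torus4 a b c d, torus4 x y z t), 0, 0, 0)"

lemma torus8_simps:
  "torus8 a b c d x y z t + torus8 a' b' c' d' x' y' z' t' = torus8 (a + a') (b + b') (c + c') (d
      + d') (x + x') (y + y') (z + z') (t + t')"
  "r *\<^sub>R torus8 a b c d x y z t = torus8 (r * a) (r * b) (r * c) (r * d) (r * x) (r * y) (r * z) (r
      * t)"
  "torus8 a b c d x y z t = torus8 a' b' c' d' x' y' z' t' \<longleftrightarrow> a = a' \<and> b = b' \<and> c = c' \<and> d = d'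
      \<and> x = x' \<and> y = y' \<and> z = z' \<and> t = t'"
  "e8_form (torus8 a b c d x y z t) (torus8 a' b' c' d' x' y' z' t') = (a * a' + b * b' + c * c' +
      d * d' + x * x' + y * y' + z * z' + t * t') / 4"
  by (auto simp: torus8_def torus4_add torus4_scale torus4_eq_iff torus4_inner inner_prod_def)

lemma torus8_zero: "0 = torus8 0 0 0 0 0 0 0 0"
  by (simp add: torus8_def torus4_zero zero_prod_def)

text \<open>The combination of the six simple roots with the given coefficients, in Bourbaki's
  numbering and in torus coordinates (see \<open>simple_sum\<close>).\<close>

definition simple_comb :: "real \<Rightarrow> real \<Rightarrow> real \<Rightarrow> real \<Rightarrow> real \<Rightarrow> real \<Rightarrow> e8_vec" where
  "simple_comb c1 c2 c3 c4 c5 c6 = torus8 (4 * c1 - 2 * c3 - 2 * c5 + 4 * c6)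
     (- 2 * c3 + 4 * c4 - 2 * c5) (4 * c2 - 2 * c3 - 2 * c5) (4 * c2 + 2 * c3 - 4 * c4 + 2 * c5)
     (4 * c1 - 2 * c3 + 2 * c5 - 4 * c6) (- 2 * c3 + 2 * c5) (- 2 * c3 + 2 * c5) (2 * c3 - 2 * c5)"

text \<open>All 36 roots in terms of the simple ones. Within each row no two entries have opposite
  signs.\<close>

lemma root_elt_table:
  "root_elt (3, 0, 1, 1) = simple_comb 1 1 1 2 1 1"
  "root_elt (3, 0, 1, - 1) = simple_comb 0 (- 1) (- 1) (- 2) (- 1) 0"
  "root_elt (3, 0, 2, 1) = simple_comb 0 0 (- 1) (- 1) (- 1) 0"
  "root_elt (3, 0, 2, - 1) = simple_comb 1 0 1 1 1 1"
  "root_elt (3, 0, 3, 1) = simple_comb 1 1 1 1 1 1"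
  "root_elt (3, 0, 3, - 1) = simple_comb 0 (- 1) (- 1) (- 1) (- 1) 0"
  "root_elt (3, 1, 2, 1) = simple_comb 0 1 0 1 0 0"
  "root_elt (3, 1, 2, - 1) = simple_comb 1 1 2 3 2 1"
  "root_elt (3, 1, 3, 1) = simple_comb 1 2 2 3 2 1"
  "root_elt (3, 1, 3, - 1) = simple_comb 0 0 0 1 0 0"
  "root_elt (3, 2, 3, 1) = simple_comb 0 1 0 0 0 0"
  "root_elt (3, 2, 3, - 1) = simple_comb (- 1) (- 1) (- 2) (- 2) (- 2) (- 1)"
  "root_elt (0, 0, 0, 1) = simple_comb 1 0 0 0 0 0"
  "root_elt (0, 0, 0, - 1) = simple_comb 0 0 0 0 0 1"
  "root_elt (0, 1, 0, 1) = simple_comb 1 1 1 2 1 0"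
  "root_elt (0, 1, 0, - 1) = simple_comb 0 1 1 2 1 1"
  "root_elt (0, 2, 0, 1) = simple_comb 0 0 (- 1) (- 1) (- 1) (- 1)"
  "root_elt (0, 2, 0, - 1) = simple_comb (- 1) 0 (- 1) (- 1) (- 1) 0"
  "root_elt (0, 3, 0, 1) = simple_comb 1 1 1 1 1 0"
  "root_elt (0, 3, 0, - 1) = simple_comb 0 1 1 1 1 1"
  "root_elt (1, 0, 0, 1) = simple_comb (- 1) 0 (- 1) 0 0 0"
  "root_elt (1, 0, 0, - 1) = simple_comb 0 0 0 0 (- 1) (- 1)"
  "root_elt (1, 1, 0, 1) = simple_comb 0 1 1 2 2 1"
  "root_elt (1, 1, 0, - 1) = simple_comb 1 1 2 2 1 0"
  "root_elt (1, 2, 0, 1) = simple_comb (- 1) 0 (- 1) (- 1) 0 0"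
  "root_elt (1, 2, 0, - 1) = simple_comb 0 0 0 (- 1) (- 1) (- 1)"
  "root_elt (1, 3, 0, 1) = simple_comb 0 1 0 1 1 1"
  "root_elt (1, 3, 0, - 1) = simple_comb 1 1 1 1 0 0"
  "root_elt (2, 0, 0, 1) = simple_comb 0 0 1 0 0 0"
  "root_elt (2, 0, 0, - 1) = simple_comb 0 0 0 0 1 0"
  "root_elt (2, 1, 0, 1) = simple_comb 1 1 2 2 1 1"
  "root_elt (2, 1, 0, - 1) = simple_comb 1 1 1 2 2 1"
  "root_elt (2, 2, 0, 1) = simple_comb 0 0 0 (- 1) (- 1) 0"
  "root_elt (2, 2, 0, - 1) = simple_comb 0 0 (- 1) (- 1) 0 0"
  "root_elt (2, 3, 0, 1) = simple_comb 0 1 1 1 0 0"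
  "root_elt (2, 3, 0, - 1) = simple_comb 0 1 0 1 1 0"
  by (simp_all add: simple_comb_def torus8_def Lambda_power_def Lambda_def Lambda_inv_def
      rotation_torus4
      torus4_scale torus4_add triality_left_torus4 triality_right_torus4 torus4_zero[symmetric]
          torus4_eq_iff zero_prod_def)

definition simple_key :: "nat \<Rightarrow> root_key" where
  "simple_key i = [(0,0,0,1), (3,2,3,1), (2,0,0,1), (3,1,3,-1), (2,0,0,-1), (0,0,0,-1)] ! (i - 1)"

lemma upto_6: "i \<in> {1..6} \<longleftrightarrow> i = 1 \<or> i = 2 \<or> i = 3 \<or> i = 4 \<or> i = 5 \<or> i = (6::nat)"
  by auto

lemma sum_1_6: "(\<Sum>i=1..6. f i) = f 1 + f 2 + f 3 + f 4 + f 5 + f (6::nat)"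
proof -
  have "{1..6} = {1, 2, 3, 4, 5, 6 :: nat}" by auto
  then show ?thesis by (simp add: ac_simps)
qed

lemma simple_elt:
  "root_elt (simple_key 1) = simple_comb 1 0 0 0 0 0" "root_elt (simple_key 2) = simple_comb 0 1 0
      0 0 0"
  "root_elt (simple_key 3) = simple_comb 0 0 1 0 0 0" "root_elt (simple_key 4) = simple_comb 0 0 0
      1 0 0"
  "root_elt (simple_key 5) = simple_comb 0 0 0 0 1 0" "root_elt (simple_key 6) = simple_comb 0 0 0
      0 0 1"
  by (simp_all add: simple_key_def root_elt_table del: root_elt.simps One_nat_def)

lemma simple_sum: "(\<Sum>i=1..6. c i *\<^sub>R root_elt (simple_key i)) = simple_comb (c 1) (c 2) (c 3) (c 4)
    (c 5) (c 6)"
  unfolding sum_1_6 simple_elt by (simp add: simple_comb_def torus8_simps)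

lemma simple_comb_minus: "- simple_comb a b c d e f = simple_comb (- a) (- b) (- c) (- d) (- e) (-
    f)"
  using torus8_simps(2)[of "- 1"] by (simp add: simple_comb_def torus8_simps(3))

lemma simple_comb_signed:
  assumes "set [a, b, c, d, e, f] \<subseteq> \<nat> \<or> set [- a, - b, - c, - d, - e, - f] \<subseteq> \<nat>"
  shows "\<exists>m :: nat \<Rightarrow> nat. simple_comb a b c d e f = (\<Sum>i=1..6. real (m i) *\<^sub>R root_elt (simple_key
      i)) \<or>
     simple_comb a b c d e f = - (\<Sum>i=1..6. real (m i) *\<^sub>R root_elt (simple_key i))"
proof -
  have nat: "\<exists>m :: nat \<Rightarrow> nat. simple_comb a b c d e f = (\<Sum>i=1..6. real (m i) *\<^sub>R root_elt
      (simple_key i))"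
    if "set [a, b, c, d, e, f] \<subseteq> \<nat>" for a b c d e f
  proof -
    have mem: "a \<in> \<nat>" "b \<in> \<nat>" "c \<in> \<nat>" "d \<in> \<nat>" "e \<in> \<nat>" "f \<in> \<nat>" using that by simp_all
    obtain a' b' c' :: nat where "a = real a'" "b = real b'" "c = real c'"
      using mem(1-3) by (elim Nats_cases)
    moreover obtain d' e' f' :: nat where "d = real d'" "e = real e'" "f = real f'"
      using mem(4-6) by (elim Nats_cases)
    ultimately show ?thesis
      by (intro exI[of _ "\<lambda>i. [a', b', c', d', e', f'] ! (i - 1)"], unfold simple_sum) simp
  qed
  from assms show ?thesis
  proof
    assume "set [a, b, c, d, e, f] \<subseteq> \<nat>"
    then show ?thesis using nat by blast
  next
    assume "set [- a, - b, - c, - d, - e, - f] \<subseteq> \<nat>"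
    from nat[OF this] obtain m :: "nat \<Rightarrow> nat"
      where "simple_comb (- a) (- b) (- c) (- d) (- e) (- f) = (\<Sum>i=1..6. real (m i) *\<^sub>R root_elt
          (simple_key i))" by blast
    then have "simple_comb a b c d e f = - (\<Sum>i=1..6. real (m i) *\<^sub>R root_elt (simple_key i))"
      by (metis simple_comb_minus minus_minus)
    then show ?thesis by blast
  qed
qed

lemma root_elt_signed:
  assumes "k \<in> set root_keys"
  shows "\<exists>m :: nat \<Rightarrow> nat. root_elt k = (\<Sum>i=1..6. real (m i) *\<^sub>R root_elt (simple_key i)) \<or>
     root_elt k = - (\<Sum>i=1..6. real (m i) *\<^sub>R root_elt (simple_key i))"
  using assms unfolding root_keys_def list.set insert_iff empty_iff
  by (elim disjE FalseE) (simp_all only: root_elt_table, (rule simple_comb_signed, simp)+)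

text \<open>The point of the torus where the simple roots take the values \<open>1, 2, 3, 9, 10, 7\<close>. With
  this choice the 36 roots have distinct absolute values.\<close>

definition regular_elt :: e8_vec where
  "regular_elt = torus8 4 37 (- 26) 28 (- 3) (10/3) (10/3) (- 10/3)"

lemma simple_comb_regular: "e8_form (simple_comb a b c d e f) regular_elt = a + 2 * b + 3 * c + 9
    * d + 10 * e + 7 * f"
  by (simp add: simple_comb_def regular_elt_def torus8_simps field_simps)

lemma torus8_torus6: "torus8 a b c d (x + y) (x - y) (x - y) (y - x) \<in> torus6"
  by (auto simp: torus6_def torus8_def torus2_iff)

text \<open>The coefficients come from inverting the coordinates of the simple roots.\<close>

lemma torus6_simple_comb:
  assumes "H \<in> torus6" shows "\<exists>c1 c2 c3 c4 c5 c6. H = simple_comb c1 c2 c3 c4 c5 c6"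
proof -
  obtain a b c d x y where H: "H = torus8 a b c d (x + y) (x - y) (x - y) (y - x)"
    using assms by (auto simp: torus6_def torus8_def torus2_iff)
  have "H = simple_comb (((1/2) * a + (1/2) * b + (-1/2) * c + (1/2) * d + (1) * y) / 4)
    (((1) * b + (1) * d) / 4)
    (((1) * b + (-1) * c + (1) * d + (-1) * x + (1) * y) / 4)
    (((2) * b + (-1) * c + (1) * d) / 4)
    (((1) * b + (-1) * c + (1) * d + (1) * x + (-1) * y) / 4)
    (((1/2) * a + (1/2) * b + (-1/2) * c + (1/2) * d + (-1) * y) / 4)"
    by (simp add: H simple_comb_def torus8_simps field_simps)
  then show ?thesis by blast
qed

lemma simple_comb_torus6: "simple_comb c1 c2 c3 c4 c5 c6 \<in> torus6"
proof -
  have "simple_comb c1 c2 c3 c4 c5 c6 = torus8 (4 * c1 - 2 * c3 - 2 * c5 + 4 * c6)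
     (- 2 * c3 + 4 * c4 - 2 * c5) (4 * c2 - 2 * c3 - 2 * c5) (4 * c2 + 2 * c3 - 4 * c4 + 2 * c5)
    ((2 * c1 - 2 * c3 + 2 * c5 - 2 * c6) + (2 * c1 - 2 * c6)) ((2 * c1 - 2 * c3 + 2 * c5 - 2 * c6)
        - (2 * c1 - 2 * c6))
    ((2 * c1 - 2 * c3 + 2 * c5 - 2 * c6) - (2 * c1 - 2 * c6)) ((2 * c1 - 2 * c6) - (2 * c1 - 2 *
        c3 + 2 * c5 - 2 * c6))"
    by (simp add: simple_comb_def torus8_simps)
  then show ?thesis using torus8_torus6 by metis
qed

lemma regular_torus6: "regular_elt \<in> torus6"
  using torus8_torus6[of 4 37 "- 26" 28 "1/6" "- 19/6"] by (simp add: regular_elt_def)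

lemma root_elt_torus6: assumes "k \<in> set root_keys" shows "root_elt k \<in> torus6"
  using assms unfolding root_keys_def
  by (auto simp only: list.set insert_iff empty_iff root_elt_table simple_comb_torus6)

text \<open>Evaluated once, so that distinctness becomes a statement about a list of numerals.\<close>

lemma regular_values:
  "map (\<lambda>k. e8_form (root_elt k) regular_elt) root_keys = [41, - 33, - 22, 30, 32, - 24, 11, 63,
      65, 9, 2, - 54, 1, 7, 34, 40, - 29, - 23, 25, 31, - 4, - 17, 50, 37, - 13, - 26, 28, 15, 3,
      10, 44, 51, - 19, - 12, 14, 21]"
  unfolding root_keys_def list.map root_elt_table simple_comb_regular by simp

lemma regular_distinct:
  "inj_on (\<lambda>k. (e8_form (root_elt k) regular_elt)\<^sup>2) (set root_keys)"
  "k \<in> set root_keys \<Longrightarrow> e8_form (root_elt k) regular_elt \<noteq> 0"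
proof -
  have "map (\<lambda>k. (e8_form (root_elt k) regular_elt)\<^sup>2) root_keys = map (\<lambda>x. x\<^sup>2) (map (\<lambda>k. e8_form
      (root_elt k) regular_elt) root_keys)"
    by simp
  also have "distinct \<dots>" unfolding regular_values by simp
  finally show "inj_on (\<lambda>k. (e8_form (root_elt k) regular_elt)\<^sup>2) (set root_keys)"
    by (simp add: distinct_map)
  have "0 \<notin> set (map (\<lambda>k. e8_form (root_elt k) regular_elt) root_keys)" unfolding regular_values
      by simp
  then show "e8_form (root_elt k) regular_elt \<noteq> 0" if "k \<in> set root_keys" using that by force
qed

lemma simple_form:
  "e8_form (simple_comb a b c d e f) (simple_comb a' b' c' d' e' f') =
    8 * (a * a' + b * b' + c * c' + d * d' + e * e' + f * f')
    - 4 * (a * c' + c * a' + c * d' + d * c' + d * e' + e * d' + e * f' + f * e' + b * d' + d * b')"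
  by (simp add: simple_comb_def torus8_simps field_simps)

lemma simple_comb_zero: "simple_comb a b c d e f = 0 \<Longrightarrow> a = 0 \<and> b = 0 \<and> c = 0 \<and> d = 0 \<and> e = 0 \<and> f =
    0"
  unfolding torus8_zero simple_comb_def torus8_simps by linarith

lemma connected_E6:
  assumes J: "J \<subseteq> {1..6}" "J \<noteq> {}" and step: "\<And>i j. i \<in> J \<Longrightarrow> j \<in> {1..6} \<Longrightarrow> cartan_E6 i j \<noteq> 0 \<Longrightarrow> j \<in> J"
  shows "J = {1..6}"
proof -
  have adj: "j \<in> J" if "i \<in> J" "{i, j} \<in> {{1,3}, {3,4}, {4,5}, {5,6}, {2,4}}" for i j
    using that(2) by (intro step[OF that(1)]) (auto simp: cartan_E6_def doubleton_eq_iff)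
  have edges: "1 \<in> J \<longleftrightarrow> 3 \<in> J" "3 \<in> J \<longleftrightarrow> 4 \<in> J" "4 \<in> J \<longleftrightarrow> 5 \<in> J" "5 \<in> J \<longleftrightarrow> 6 \<in> J" "2 \<in> J \<longleftrightarrow> 4 \<in> J"
    by (rule iffI; erule adj; simp add: doubleton_eq_iff)+
  obtain i where i: "i \<in> J" using J(2) by blast
  then have "i \<in> {1..6}" using J(1) by blast
  then have "4 \<in> J" using i edges unfolding upto_6 by (elim disjE) simp_all
  then have "k \<in> J" if "k \<in> {1..6}" for k
    using that edges unfolding upto_6 by (elim disjE) simp_all
  then show ?thesis using J(1) by blast
qed

lemma cartan_simple:
  assumes "i \<in> {1..6}" "j \<in> {1..6}"
  shows "2 * e8_form (root_elt (simple_key j)) (root_elt (simple_key i)) / e8_form (root_elt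
      (simple_key i)) (root_elt (simple_key i)) = cartan_E6 i j"
  using assms unfolding upto_6
  by (elim disjE; hypsubst) (simp_all only: simple_elt simple_form, simp_all add: cartan_E6_def
      doubleton_eq_iff)

text \<open>The bracket of \<open>e6\<close> is carried to \<open>\<real>\<^sup>7\<^sup>8\<close> by the isometric coordinates, which turn the
  roots, given by their pairing with \<open>e8_form\<close>, into vectors of the torus.\<close>

lemma e6_real78:
  obtains br' :: "real ^ 78 \<Rightarrow> real ^ 78 \<Rightarrow> real ^ 78" and \<Phi> T d X Y H0
  where "lie_root_planes_base br' T (set root_keys) d X Y H0 6 simple_key cartan_E6"
    "lie_iso \<Phi> e6 e8_bracket UNIV br'"
proof -
  obtain \<Phi> :: "e8_vec \<Rightarrow> real ^ 78" and \<Psi> where lin: "linear \<Phi>" "linear \<Psi>"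
    and inv: "\<And>X. X \<in> e6 \<Longrightarrow> \<Psi> (\<Phi> X) = X" "\<And>x. \<Psi> x \<in> e6" "\<And>x. \<Phi> (\<Psi> x) = x"
    and form: "\<And>X Y. X \<in> e6 \<Longrightarrow> Y \<in> e6 \<Longrightarrow> \<Phi> X \<bullet> \<Phi> Y = e8_form X Y"
    by (rule e6_coordinates) blast
  define br' where "br' x y = \<Phi> (e8_br (\<Psi> x) (\<Psi> y))" for x y
  have e8: "\<And>X. X \<in> e6 \<Longrightarrow> X \<in> e8" using e6_subset by blast
  have \<Psi>br: "\<Psi> (br' x y) = e8_br (\<Psi> x) (\<Psi> y)" for x y
    unfolding br'_def by (intro inv(1) e6_br_closed inv(2))
  have hom: "br' (\<Phi> X) (\<Phi> Y) = \<Phi> (e8_br X Y)" if "X \<in> e6" "Y \<in> e6" for X Y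
    using that by (simp add: br'_def inv(1))
  note bb = bounded_bilinear_e8_br
  have "invariant_lie_bracket br'"
  proof
    show "bilinear br'"
      unfolding bilinear_def br'_def
      by (intro conjI allI linearI)
        (simp_all add: linear_add[OF lin(1)] linear_add[OF lin(2)] linear_scale[OF lin(1)]
            linear_scale[OF lin(2)]
          bounded_bilinear.add_left[OF bb] bounded_bilinear.add_right[OF bb]
          bounded_bilinear.scaleR_left[OF bb] bounded_bilinear.scaleR_right[OF bb])
    show "br' x x = 0" for x by (simp add: br'_def e8_br_self linear_0[OF lin(1)])
    show "br' x (br' y z) + br' y (br' z x) + br' z (br' x y) = 0" for x y z
    proof -
      have "br' x (br' y z) + br' y (br' z x) + br' z (br' x y) =
         \<Phi> (e8_br (\<Psi> x) (e8_br (\<Psi> y) (\<Psi> z)) + e8_br (\<Psi> y) (e8_br (\<Psi> z) (\<Psi> x)) + e8_br (\<Psi> z) (e8_br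
             (\<Psi> x) (\<Psi> y)))"
        by (simp add: br'_def[of _ "br' _ _"] \<Psi>br linear_add[OF lin(1)])
      then show ?thesis by (simp add: e8_jacobi e8 inv(2) linear_0[OF lin(1)])
    qed
    show "br' x y \<bullet> z = x \<bullet> br' y z" for x y z
    proof -
      have "br' x y \<bullet> \<Phi> (\<Psi> z) = \<Phi> (\<Psi> x) \<bullet> br' y z"
        unfolding br'_def
        by (simp only: form e6_br_closed inv(2) e8_form_invariant e8)
      then show ?thesis by (simp only: inv(3))
    qed
  qed
  then interpret invariant_lie_bracket br' .
  note mem = planes_e6 root_elt_torus6 torus6_e6[THEN subsetD]
  have inj: "X = 0" if "X \<in> e6" "\<Phi> X = 0" for X
    using inv(1)[OF that(1)] that(2) by (simp add: linear_0[OF lin(2)])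
  have simple_mem: "root_elt (simple_key i) \<in> e6" if "i \<in> {1..6}" for i
    using that simple_comb_torus6 torus6_e6 unfolding upto_6
        by (elim disjE) (auto simp only: simple_elt)
  have key: "simple_key i \<in> set root_keys" if "i \<in> {1..6}" for i
    using that unfolding upto_6 by (elim disjE) (simp_all add: simple_key_def root_keys_def)
  have sumPhi: "(\<Sum>i=1..6. c i *\<^sub>R \<Phi> (root_elt (simple_key i))) = \<Phi> (\<Sum>i=1..6. c i *\<^sub>R root_elt
      (simple_key i))" for c
    by (simp only: linear_sum[OF lin(1)] linear_scale[OF lin(1)])
  have "lie_root_planes_base br' (\<Phi> ` torus6) (set root_keys) (\<Phi> \<circ> root_elt) (\<Phi> \<circ> plane_X) (\<Phi>
      \<circ> plane_Y)
     (\<Phi> regular_elt) 6 simple_key cartan_E6"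
  proof
    show "subspace (\<Phi> ` torus6)" by (rule linear_subspace_image[OF lin(1) subspace_torus6])
    show "br' H H' = 0" if HH': "H \<in> \<Phi> ` torus6" "H' \<in> \<Phi> ` torus6" for H H'
    proof -
      obtain Z Z' where Z: "H = \<Phi> Z" "Z \<in> torus6" "H' = \<Phi> Z'" "Z' \<in> torus6" using HH' by blast
      show ?thesis
        using hom[OF mem(4) mem(4), OF Z(2,4)] torus6_abelian[OF Z(2,4)]
            by (simp add: Z(1,3) linear_0[OF lin(1)])
    qed
    show "finite (set root_keys)" by simp
    show "(\<Phi> \<circ> root_elt) k \<in> \<Phi> ` torus6" if "k \<in> set root_keys" for k using that mem by simp
    show "(\<Phi> \<circ> plane_X) k \<noteq> 0" if k: "k \<in> set root_keys" for k
      using inj[OF planes_e6(1)[OF k]] plane_X_nonzero[OF k] by auto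
    show "br' H ((\<Phi> \<circ> plane_X) k) = - (((\<Phi> \<circ> root_elt) k \<bullet> H) *\<^sub>R (\<Phi> \<circ> plane_Y) k)"
      "br' H ((\<Phi> \<circ> plane_Y) k) = ((\<Phi> \<circ> root_elt) k \<bullet> H) *\<^sub>R (\<Phi> \<circ> plane_X) k"
      if k: "k \<in> set root_keys" and H: "H \<in> \<Phi> ` torus6" for k H
    proof -
      obtain Z where Z: "H = \<Phi> Z" "Z \<in> torus6" using H by blast
      have F: "\<Phi> (root_elt k) \<bullet> \<Phi> Z = e8_form (root_elt k) Z"
        by (intro form mem Z(2) root_elt_torus6 k)
      show "br' H ((\<Phi> \<circ> plane_X) k) = - (((\<Phi> \<circ> root_elt) k \<bullet> H) *\<^sub>R (\<Phi> \<circ> plane_Y) k)"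
        "br' H ((\<Phi> \<circ> plane_Y) k) = ((\<Phi> \<circ> root_elt) k \<bullet> H) *\<^sub>R (\<Phi> \<circ> plane_X) k"
        using hom[OF mem(4)[OF Z(2)] planes_e6(1)[OF k]] hom[OF mem(4)[OF Z(2)] planes_e6(2)[OF k]]
        by (simp_all only: comp_apply Z(1) F root_planes_e6[OF k Z(2)] linear_neg[OF lin(1)]
            linear_scale[OF lin(1)])
    qed
    show "\<Phi> regular_elt \<in> \<Phi> ` torus6" using regular_torus6 by blast
    have reg: "(\<Phi> \<circ> root_elt) k \<bullet> \<Phi> regular_elt = e8_form (root_elt k) regular_elt"
        if "k \<in> set root_keys" for k
      using that mem regular_torus6 by (simp add: form)
    then show "(\<Phi> \<circ> root_elt) k \<bullet> \<Phi> regular_elt \<noteq> 0" if "k \<in> set root_keys" for k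
      using that regular_distinct(2) by metis
    show "inj_on (\<lambda>k. ((\<Phi> \<circ> root_elt) k \<bullet> \<Phi> regular_elt)\<^sup>2) (set root_keys)"
    proof -
      have "inj_on (\<lambda>k. ((\<Phi> \<circ> root_elt) k \<bullet> \<Phi> regular_elt)\<^sup>2) (set root_keys) \<longleftrightarrow>
          inj_on (\<lambda>k. (e8_form (root_elt k) regular_elt)\<^sup>2) (set root_keys)"
        by (rule inj_on_cong) (simp only: reg)
      then show ?thesis using regular_distinct(1) by blast
    qed
    show "span (\<Phi> ` torus6 \<union> (\<Phi> \<circ> plane_X) ` set root_keys \<union> (\<Phi> \<circ> plane_Y) ` set root_keys) = UNIV"
    proof -
      have 1: "span (\<Phi> ` torus6 \<union> (\<Phi> \<circ> plane_X) ` set root_keys \<union> (\<Phi> \<circ> plane_Y) ` set root_keys) =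
         \<Phi> ` span (torus6 \<union> plane_X ` set root_keys \<union> plane_Y ` set root_keys)"
        by (simp only: linear_span_image[OF lin(1), symmetric] image_Un image_comp)
      have "x \<in> \<Phi> ` span (torus6 \<union> plane_X ` set root_keys \<union> plane_Y ` set root_keys)" for x
        by (rule image_eqI[of _ _ "\<Psi> x"]) (simp add: inv(3), rule subsetD[OF e6_span inv(2)])
      then have U: "\<Phi> ` span (torus6 \<union> plane_X ` set root_keys \<union> plane_Y ` set root_keys) = UNIV"
        by (rule UNIV_eq_I[symmetric])
      show ?thesis unfolding 1 by (rule U)
    qed
    show "simple_key i \<in> set root_keys" if "i \<in> {1..6}" for i using that by (rule key)
    show "(1 :: nat) \<le> 6" by simp
    show "\<Phi> ` torus6 \<subseteq> span ((\<lambda>i. (\<Phi> \<circ> root_elt) (simple_key i)) ` {1..6})"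
    proof
      fix x assume "x \<in> \<Phi> ` torus6"
      then obtain c1 c2 c3 c4 c5 c6 where x: "x = \<Phi> (simple_comb c1 c2 c3 c4 c5 c6)"
        using torus6_simple_comb by blast
      let ?c = "\<lambda>i. [c1, c2, c3, c4, c5, c6] ! (i - 1)"
      have "x = (\<Sum>i=1..6. ?c i *\<^sub>R \<Phi> (root_elt (simple_key i)))"
        unfolding sumPhi simple_sum x by simp
      also have "\<dots> \<in> span ((\<lambda>i. (\<Phi> \<circ> root_elt) (simple_key i)) ` {1..6})"
        by (intro span_sum span_scale span_base) simp
      finally show "x \<in> span ((\<lambda>i. (\<Phi> \<circ> root_elt) (simple_key i)) ` {1..6})" .
    qed
    show "c i = 0" if "(\<Sum>i=1..6. c i *\<^sub>R (\<Phi> \<circ> root_elt) (simple_key i)) = 0" "i \<in> {1..6}" for c i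
    proof -
      have "\<Phi> (simple_comb (c 1) (c 2) (c 3) (c 4) (c 5) (c 6)) = 0"
        using that(1) by (simp only: comp_apply sumPhi simple_sum)
      then have "simple_comb (c 1) (c 2) (c 3) (c 4) (c 5) (c 6) = 0"
        using inj simple_comb_torus6 torus6_e6 by blast
      from simple_comb_zero[OF this] show ?thesis using that(2) unfolding upto_6 by blast
    qed
    show "\<exists>m :: nat \<Rightarrow> nat. (\<Phi> \<circ> root_elt) k = (\<Sum>i=1..6. real (m i) *\<^sub>R (\<Phi> \<circ> root_elt) (simple_key
        i)) \<or>
         (\<Phi> \<circ> root_elt) k = - (\<Sum>i=1..6. real (m i) *\<^sub>R (\<Phi> \<circ> root_elt) (simple_key i))" if "k \<in> set
             root_keys" for k
    proof -
      obtain m :: "nat \<Rightarrow> nat" where "root_elt k = (\<Sum>i=1..6. real (m i) *\<^sub>R root_elt (simple_key i)) \<or>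
         root_elt k = - (\<Sum>i=1..6. real (m i) *\<^sub>R root_elt (simple_key
             i))" using root_elt_signed[OF \<open>k \<in> _\<close>] by blast
      then show ?thesis unfolding comp_apply sumPhi
        by (elim disjE; intro exI[of _ m]; simp only: linear_neg[OF lin(1)] simp_thms)
    qed
    show "2 * ((\<Phi> \<circ> root_elt) (simple_key j) \<bullet> (\<Phi> \<circ> root_elt) (simple_key i)) /
       ((\<Phi> \<circ> root_elt) (simple_key i) \<bullet> (\<Phi> \<circ> root_elt) (simple_key i)) = cartan_E6 i j"
      if "i \<in> {1..6}" "j \<in> {1..6}" for i j
      unfolding comp_apply form[OF simple_mem simple_mem, OF that(2,1)] form[OF simple_mem
          simple_mem, OF that(1,1)]
      by (rule cartan_simple[OF that])
    show "J = {1..6}" if "J \<subseteq> {1..6}" "J \<noteq> {}" "\<And>i j. i \<in> J \<Longrightarrow> j \<in> {1..6} \<Longrightarrow> cartan_E6 i j \<noteq> 0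
        \<Longrightarrow> j \<in> J" for J
      using that by (rule connected_E6)
  qed
  moreover have "lie_iso \<Phi> e6 e8_bracket UNIV br'"
    unfolding lie_iso_def
  proof (intro conjI ballI allI)
    show "bij_betw \<Phi> e6 UNIV" by (rule bij_betw_byWitness[of _ \<Psi>]) (auto simp: inv)
    show "\<Phi> (e8_bracket X Y) = br' (\<Phi> X) (\<Phi> Y)" if "X \<in> e6" "Y \<in> e6" for X Y
      by (simp only: hom that e8_bracket_eq e8)
  qed (simp_all add: linear_add[OF lin(1)] linear_scale[OF lin(1)])
  ultimately show thesis by (rule that)
qed

theorem lemma5p1:
  shows "lie_subalgebra e6 e8 e8_bracket \<and>
    (\<exists>G :: (real ^ 78 ^ 78) set. compact_simple_lie_group_E6 G \<and>
       lie_isomorphic e6 e8_bracket (lie_algebra_of G) mat_bracket)"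
proof
  show "lie_subalgebra e6 e8 e8_bracket" by (rule e6_subalgebra)
  obtain br' :: "real ^ 78 \<Rightarrow> real ^ 78 \<Rightarrow> real ^ 78" and \<Phi> T d X Y H0
    where planes: "lie_root_planes_base br' T (set root_keys) d X Y H0 6 simple_key cartan_E6"
      and iso: "lie_iso \<Phi> e6 e8_bracket UNIV br'" by (rule e6_real78)
  obtain G :: "(real ^ 78 ^ 78) set" and f where "compact_simple_lie_group G"
      "lie_has_cartan_matrix (lie_algebra_of G) mat_bracket 6 cartan_E6"
          "lie_iso f UNIV br' (lie_algebra_of G) mat_bracket"
    using compact_group_of_root_planes[OF planes] by blast
  moreover have "lie_iso (f \<circ> \<Phi>) e6 e8_bracket (lie_algebra_of G) mat_bracket"
    using e6_subalgebra unfolding lie_subalgebra_def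
        by (intro lie_iso_trans[OF iso calculation(3)]) auto
  ultimately show "\<exists>G :: (real ^ 78 ^ 78) set. compact_simple_lie_group_E6 G \<and>
       lie_isomorphic e6 e8_bracket (lie_algebra_of G) mat_bracket"
    unfolding compact_simple_lie_group_E6_def lie_isomorphic_def by blast
qed

end
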